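(* Let $\mathfrak{q}\in\mathbb{R}^{4,1}$ be non-zero, let $M_{\mathfrak{q}}$ be the associated $3$-dimensional space form, let $\Sigma$ be an oriented surface, and let $x\colon\Sigma\to M_{\mathfrak{q}}$ be an immersion with constant mean curvature $H$. Let $q=\mathrm{II}^{2,0}$ be its Hopf differential (a holomorphic quadratic differential), let $\eta_x^q\in\Omega^1_\Sigma\otimes\mathfrak{g}$ be its (closed) retraction form, with class $[\eta_x^q]\in H^1(\Sigma,\mathbb{R})\otimes\mathfrak{g}$, and let $\mu_x\in H^1(\Sigma,\mathbb{R})\otimes\mathfrak{g}_{M_{\mathfrak{q}}}^*$ be its moment class. Then: 1. $[\eta_x^q]\in H^1(\Sigma,\mathbb{R})\otimes\mathfrak{g}_{M_{\mathfrak{q}}}$; 2. $S[\eta_x^q]=\mu_x$, where $S\colon\mathfrak{g}_{M_{\mathfrak{q}}}\to\mathfrak{g}_{M_{\mathfrak{q}}}^*$ is applied to coefficients.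
   Context: $\mathbb{R}^{4,1}$ is a $5$-dimensional real vector space with symmetric bilinear form $(\,,\,)$ of signature $(4,1)$ (four positive directions), with lightcone $\mathcal{L}=\{v\mid (v,v)=0\}$. For $\mathfrak{q}\neq 0$, $E_{\mathfrak{q}}=\{v\mid (v,\mathfrak{q})=-1\}$ and $M_{\mathfrak{q}}=\mathcal{L}\cap E_{\mathfrak{q}}$ with the (positive definite) induced metric; it is a $3$-dimensional space form of curvature $K=-(\mathfrak{q},\mathfrak{q})$ (when $(\mathfrak{q},\mathfrak{q})>0$ it has two components, each a space form). $T_pM_{\mathfrak{q}}=\{p,\mathfrak{q}\}^\perp$. $\mathfrak{g}=\mathfrak{so}(4,1)$ is identified with $\Lambda^2\mathbb{R}^{4,1}$ by $(a\wedge b)c=(a,c)b-(b,c)a$. An element $Y\in\mathfrak{g}$ is identified with the conformal vector field $Y(p)=-Yp-(Yp,\mathfrak{q})p$ on $M_{\mathfrak{q}}$. The Killing fields are $\mathfrak{g}_{M_{\mathfrak{q}}}=\{Y\in\mathfrak{g}\mid Y\mathfrak{q}=0\}=\Lambda^2\mathfrak{q}^\perp$. The dual $\mathfrak{g}^*$ is identified with $\mathfrak{g}$ via $(Y_1,Y_2)_{\mathfrak{g}}=\tfrac12\operatorname{trace}Y_1Y_2$. Fix $\det\in(\Lambda^5\mathbb{R}^{4,1})^*$ a volume form taking values $\pm1$ on orthonormal bases; orient $M_{\mathfrak{q}}$ by $\mathrm{vol}_{M_{\mathfrak{q}}}|_p(v_1,v_2,v_3)=\det(p\wedge\mathfrak{q}\wedge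 v_1\wedge v_2\wedge v_3)$. Define $S\colon\Lambda^2\mathfrak{q}^\perp\to(\Lambda^2\mathfrak{q}^\perp)^*$ by $S(Y_1)(Y_2)=\det(\mathfrak{o}\wedge Y_1\wedge Y_2)$ for any $\mathfrak{o}\in E_{\mathfrak{q}}$ (independent of this choice). For an immersion $x\colon\Sigma\to M_{\mathfrak{q}}$: $\mathrm{I}$ is the induced metric and $\mathrm{vol}_x$ its area form; $N$ is the unit normal with $x^*(i_N\mathrm{vol}_{M_{\mathfrak{q}}})=\mathrm{vol}_x$; $\mathrm{II}$ is the second fundamental form with respect to $N$, $H=\tfrac12\operatorname{trace}\mathrm{II}$; $\mathrm{II}^{2,0}$ is the $(2,0)$-part of $\mathrm{II}$ for the complex structure on $\Sigma$ determined by $\mathrm{I}$ and the orientation. For a vector field $Y$ on $M_{\mathfrak{q}}$, $Y^\top$ is the vector field on $\Sigma$ such that $Y\circ x-dx(Y^\top)$ is normal to $x$. Retraction form: for a holomorphic quadratic differential $q$ on $\Sigma$ and a conformal vector field $Y\in\mathfrak{g}$, $\eta_Y\in\Omega^1_\Sigma$ is $\eta_Y(U)=2\operatorname{Re}q(Y^\top,U)$; $\eta_x^q\in\Omega^1_\Sigma\otimes\mathfrak{g}^*\cong\Omega^1_\Sigma\otimes\mathfrak{g}$ is defined by $\eta_x^q(Y)=\eta_Y$, i.e. $(\eta_x^q,Y)_{\mathfrak{g}}=\eta_Y$. For $x$ of constant mean curvature and $q=\mathrm{II}^{2,0}$, $q$ is holomorphic and $d\eta_x^q=0$. Moment class: for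 $Y\in\mathfrak{g}_{M_{\mathfrak{q}}}$ there is a $1$-form $\alpha_Y$ on $M_{\mathfrak{q}}$, unique up to exact forms, with $d\alpha_Y=i_Y\mathrm{vol}_{M_{\mathfrak{q}}}$. For $x$ of constant mean curvature $H$, the $1$-form $i_{Y^\top}\mathrm{vol}_x-2Hx^*\alpha_Y$ is closed and $\mu_x\in H^1(\Sigma,\mathbb{R})\otimes\mathfrak{g}_{M_{\mathfrak{q}}}^*$ is defined by $\mu_x(Y)=[i_{Y^\top}\mathrm{vol}_x-2Hx^*\alpha_Y]$. *)

theory Defs
  imports "HOL-Analysis.Analysis"
begin

section \<open>Smooth maps between Euclidean spaces\<close>

primrec Ck_on :: "nat \<Rightarrow> 'a::euclidean_space set \<Rightarrow> ('a \<Rightarrow> 'b::real_normed_vector) \<Rightarrow> bool" where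
  "Ck_on 0 S f \<longleftrightarrow> continuous_on S f"
| "Ck_on (Suc k) S f \<longleftrightarrow>
     (\<forall>u\<in>S. f differentiable (at u)) \<and> (\<forall>v. Ck_on k S (\<lambda>u. frechet_derivative f (at u) v))"

text \<open>Class $C^\infty$; only used for open \<open>S\<close>.\<close>

definition smooth_on :: "'a::euclidean_space set \<Rightarrow> ('a \<Rightarrow> 'b::real_normed_vector) \<Rightarrow> bool" where
  "smooth_on S f \<longleftrightarrow> (\<forall>k. Ck_on k S f)"


section \<open>Oriented surfaces\<close>

text \<open>A chart is a pair (domain, coordinate map). The surface itself is the whole type \<open>'a\<close>,
  with its topology, and carries a smooth oriented atlas \<open>A\<close>.\<close>

type_synonym 'a chart = "'a set \<times> ('a \<Rightarrow> real^2)"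

definition chart_inv :: "'a chart \<Rightarrow> real^2 \<Rightarrow> 'a" where
  "chart_inv c = inv_into (fst c) (snd c)"

definition is_chart :: "('a::topological_space) chart \<Rightarrow> bool" where
  "is_chart c \<longleftrightarrow> open (fst c) \<and> open (snd c ` fst c)
     \<and> homeomorphism (fst c) (snd c ` fst c) (snd c) (chart_inv c)"

definition transition :: "'a chart \<Rightarrow> 'a chart \<Rightarrow> real^2 \<Rightarrow> real^2" where
  "transition c d = snd d \<circ> chart_inv c"

definition oriented_surface :: "('a::{t2_space,second_countable_topology}) chart set \<Rightarrow> bool" where
  "oriented_surface A \<longleftrightarrow>
     (\<forall>c\<in>A. is_chart c) \<and> (\<Union>c\<in>A. fst c) = UNIV \<and>
     (\<forall>c\<in>A. \<forall>d\<in>A. smooth_on (snd c ` (fst c \<inter> fst d)) (transition c d) \<and>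
        (\<forall>u\<in>snd c ` (fst c \<inter> fst d).
           det (matrix (frechet_derivative (transition c d) (at u))) > 0))"

text \<open>A tangent vector at \<open>p\<close> is a family of coordinate vectors, one for each chart around \<open>p\<close>,
  obeying the transformation law (and with value \<open>0\<close> at all irrelevant arguments).\<close>

type_synonym 'a tvec = "'a chart \<Rightarrow> real^2"

definition tangent :: "'a chart set \<Rightarrow> 'a \<Rightarrow> 'a tvec set" where
  "tangent A p = {U.
     (\<forall>c\<in>A. \<forall>d\<in>A. p \<in> fst c \<inter> fst d \<longrightarrow>
        U d = frechet_derivative (transition c d) (at (snd c p)) (U c)) \<and>
     (\<forall>c. c \<notin> A \<or> p \<notin> fst c \<longrightarrow> U c = 0)}"

text \<open>The tangent vector at \<open>p\<close> with components \<open>v\<close> in the chart \<open>c\<close>.\<close>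

definition coord_vec :: "'a chart set \<Rightarrow> 'a chart \<Rightarrow> 'a \<Rightarrow> real^2 \<Rightarrow> 'a tvec" where
  "coord_vec A c p v = (\<lambda>d. if d \<in> A \<and> p \<in> fst d
     then frechet_derivative (transition c d) (at (snd c p)) v else 0)"

definition chart_at :: "'a chart set \<Rightarrow> 'a \<Rightarrow> 'a chart" where
  "chart_at A p = (SOME c. c \<in> A \<and> p \<in> fst c)"

definition smooth_map :: "'a chart set \<Rightarrow> ('a \<Rightarrow> 'b::real_normed_vector) \<Rightarrow> bool" where
  "smooth_map A f \<longleftrightarrow> (\<forall>c\<in>A. smooth_on (snd c ` fst c) (f \<circ> chart_inv c))"

text \<open>The differential $df_p(U)$; it does not depend on the chart used to compute it.\<close>

definition differential ::
    "'a chart set \<Rightarrow> ('a \<Rightarrow> 'b::real_normed_vector) \<Rightarrow> 'a \<Rightarrow> 'a tvec \<Rightarrow> 'b" where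
  "differential A f p U =
     frechet_derivative (f \<circ> chart_inv (chart_at A p)) (at (snd (chart_at A p) p)) (U (chart_at A p))"

text \<open>The sign of a pair of tangent vectors with respect to the orientation.\<close>

definition orient_sgn :: "'a chart set \<Rightarrow> 'a \<Rightarrow> 'a tvec \<Rightarrow> 'a tvec \<Rightarrow> real" where
  "orient_sgn A p U V = sgn (det (vector [U (chart_at A p), V (chart_at A p)]))"


section \<open>Vector-valued 1-forms and first cohomology of a surface\<close>

text \<open>A 1-form is a function of a point \<open>p\<close> and a vector \<open>U \<in> tangent A p\<close>. Its values at other
  arguments are irrelevant: all notions below depend on tangent vectors only.\<close>

type_synonym ('a, 'b) form1 = "'a \<Rightarrow> 'a tvec \<Rightarrow> 'b"

definition local_coeff ::
    "'a chart set \<Rightarrow> 'a chart \<Rightarrow> ('a, 'b) form1 \<Rightarrow> real^2 \<Rightarrow> real^2 \<Rightarrow> 'b" where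
  "local_coeff A c \<omega> v u = \<omega> (chart_inv c u) (coord_vec A c (chart_inv c u) v)"

definition one_form :: "'a chart set \<Rightarrow> ('a, 'b::real_normed_vector) form1 \<Rightarrow> bool" where
  "one_form A \<omega> \<longleftrightarrow> (\<forall>c\<in>A.
     (\<forall>u\<in>snd c ` fst c. linear (\<lambda>v. local_coeff A c \<omega> v u)) \<and>
     (\<forall>v. smooth_on (snd c ` fst c) (local_coeff A c \<omega> v)))"

definition closed_form :: "'a chart set \<Rightarrow> ('a, 'b::real_normed_vector) form1 \<Rightarrow> bool" where
  "closed_form A \<omega> \<longleftrightarrow> one_form A \<omega> \<and> (\<forall>c\<in>A. \<forall>u\<in>snd c ` fst c. \<forall>v w.
     frechet_derivative (local_coeff A c \<omega> w) (at u) v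
       - frechet_derivative (local_coeff A c \<omega> v) (at u) w = 0)"

definition valued_in :: "'a chart set \<Rightarrow> 'b set \<Rightarrow> ('a, 'b) form1 \<Rightarrow> bool" where
  "valued_in A W \<omega> \<longleftrightarrow> (\<forall>p. \<forall>U\<in>tangent A p. \<omega> p U \<in> W)"

definition dR_class :: "'a chart set \<Rightarrow> ('a, 'b::real_normed_vector) form1 \<Rightarrow> ('a, 'b) form1 set" where
  "dR_class A \<omega> = {\<omega>'. \<exists>f. smooth_map A f \<and>
     (\<forall>p. \<forall>U\<in>tangent A p. \<omega>' p U = \<omega> p U + differential A f p U)}"

text \<open>For a subspace \<open>W\<close> of a finite-dimensional space \<open>'b\<close>, this is
  $H^1(\Sigma,\mathbb{R})\otimes W$, regarded as a subspace of $H^1(\Sigma,\mathbb{R})\otimes$ \<open>'b\<close>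
  (closed \<open>'b\<close>-valued forms modulo exact ones): the classes having a closed \<open>W\<close>-valued representative.\<close>

definition H1 :: "'a chart set \<Rightarrow> 'b::real_normed_vector set \<Rightarrow> ('a, 'b) form1 set set" where
  "H1 A W = dR_class A ` {\<omega>. closed_form A \<omega> \<and> valued_in A W \<omega>}"

text \<open>The map $H^1(\Sigma,\mathbb{R})\otimes W\to H^1(\Sigma,\mathbb{R})$ given by a linear functional
  \<open>L\<close> on \<open>W\<close> applied to coefficients. The classes in the union all coincide: if two
  \<open>W\<close>-valued forms differ by \<open>df\<close>, then \<open>df\<close> is \<open>W\<close>-valued and \<open>L \<circ> df = d (L \<circ> f)\<close> after replacing
  \<open>f\<close> by its projection to \<open>W\<close>.\<close>

definition apply_coeff ::
    "'a chart set \<Rightarrow> 'b set \<Rightarrow> ('b::real_normed_vector \<Rightarrow> real) \<Rightarrow> ('a, 'b) form1 set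
      \<Rightarrow> ('a, real) form1 set" where
  "apply_coeff A W L C = \<Union> {dR_class A (\<lambda>p U. L (\<omega> p U)) | \<omega>. \<omega> \<in> C \<and> valued_in A W \<omega>}"


section \<open>Lorentz space and its orthogonal Lie algebra\<close>

definition sig :: "5 \<Rightarrow> real" where
  "sig i = (if i = 5 then - 1 else 1)"

definition lor :: "real^5 \<Rightarrow> real^5 \<Rightarrow> real" where
  "lor v w = (\<Sum>i\<in>UNIV. sig i * v $ i * w $ i)"

text \<open>An element of $(\Lambda^5\mathbb{R}^{4,1})^*$ with values $\pm1$ on orthonormal bases; its
  arguments are the rows of a matrix.\<close>

definition is_volume_form :: "(real^5^5 \<Rightarrow> real) \<Rightarrow> bool" where
  "is_volume_form D \<longleftrightarrow>
     (\<forall>M i. linear (\<lambda>v. D (\<chi> j. if j = i then v else M $ j))) \<and>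
     (\<forall>M i j. i \<noteq> j \<and> M $ i = M $ j \<longrightarrow> D M = 0) \<and>
     (\<forall>M. (\<forall>i j. i \<noteq> j \<longrightarrow> lor (M $ i) (M $ j) = 0) \<and> (\<forall>i. \<bar>lor (M $ i) (M $ i)\<bar> = 1)
        \<longrightarrow> \<bar>D M\<bar> = 1)"

definition so41 :: "(real^5^5) set" where
  "so41 = {Y. \<forall>v w. lor (Y *v v) w + lor v (Y *v w) = 0}"

definition wedge :: "real^5 \<Rightarrow> real^5 \<Rightarrow> real^5^5" where
  "wedge a b = matrix (\<lambda>c. lor a c *\<^sub>R b - lor b c *\<^sub>R a)"

definition pairing_g :: "real^5^5 \<Rightarrow> real^5^5 \<Rightarrow> real" where
  "pairing_g Y Z = trace (Y ** Z) / 2"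

text \<open>\<open>so41\<close> is identified with $\Lambda^2\mathbb{R}^{4,1}$ through \<open>wedge\<close>: if \<open>e\<^sub>i\<close> is the standard basis,
  \<open>Y \<in> so41\<close> is one half of the sum over all \<open>i, j\<close> of \<open>bivec Y i j *\<^sub>R wedge e\<^sub>i e\<^sub>j\<close>. Consequently
  \<open>det_wedge D v Y Z\<close> is $\det(v\wedge Y\wedge Z)$; see \<open>so41_bivec\<close> and \<open>det_wedge_wedge\<close> below.\<close>

definition bivec :: "real^5^5 \<Rightarrow> 5 \<Rightarrow> 5 \<Rightarrow> real" where
  "bivec Y i j = sig i * Y $ j $ i"

definition det_wedge :: "(real^5^5 \<Rightarrow> real) \<Rightarrow> real^5 \<Rightarrow> real^5^5 \<Rightarrow> real^5^5 \<Rightarrow> real" where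
  "det_wedge D v Y Z = (\<Sum>i\<in>UNIV. \<Sum>j\<in>UNIV. \<Sum>k\<in>UNIV. \<Sum>l\<in>UNIV.
     bivec Y i j * bivec Z k l * D (vector [v, axis i 1, axis j 1, axis k 1, axis l 1])) / 4"


section \<open>Space forms\<close>

definition E_plane :: "real^5 \<Rightarrow> (real^5) set" where
  "E_plane \<qq> = {v. lor v \<qq> = - 1}"

definition space_form :: "real^5 \<Rightarrow> (real^5) set" where
  "space_form \<qq> = {v. lor v v = 0} \<inter> E_plane \<qq>"

definition tangent_M :: "real^5 \<Rightarrow> real^5 \<Rightarrow> (real^5) set" where
  "tangent_M \<qq> y = {v. lor v y = 0 \<and> lor v \<qq> = 0}"

definition vol_M :: "(real^5^5 \<Rightarrow> real) \<Rightarrow> real^5 \<Rightarrow> real^5 \<Rightarrow> real^5 \<Rightarrow> real^5 \<Rightarrow> real^5 \<Rightarrow> real" where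
  "vol_M D \<qq> y v1 v2 v3 = D (vector [y, \<qq>, v1, v2, v3])"

definition conf_field :: "real^5 \<Rightarrow> real^5^5 \<Rightarrow> real^5 \<Rightarrow> real^5" where
  "conf_field \<qq> Y y = - (Y *v y) - lor (Y *v y) \<qq> *\<^sub>R y"

definition killing :: "real^5 \<Rightarrow> (real^5^5) set" where
  "killing \<qq> = {Y \<in> so41. Y *v \<qq> = 0}"

definition S_form :: "(real^5^5 \<Rightarrow> real) \<Rightarrow> real^5 \<Rightarrow> real^5^5 \<Rightarrow> real^5^5 \<Rightarrow> real" where
  "S_form D \<qq> Y1 Y2 = det_wedge D (SOME v. v \<in> E_plane \<qq>) Y1 Y2"

text \<open>A 1-form on the submanifold \<open>space_form \<qq>\<close> is smooth if near each point it is the restriction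
  of a smooth 1-form \<open>\<beta>\<close> on an open subset of the ambient space; its exterior derivative is then the
  restriction of that of \<open>\<beta>\<close>.\<close>

definition local_extension ::
    "real^5 \<Rightarrow> (real^5 \<Rightarrow> real^5 \<Rightarrow> real) \<Rightarrow> (real^5) set \<Rightarrow> (real^5 \<Rightarrow> real^5 \<Rightarrow> real) \<Rightarrow> bool" where
  "local_extension \<qq> \<alpha> B \<beta> \<longleftrightarrow> open B \<and> (\<forall>y\<in>B. linear (\<beta> y)) \<and> (\<forall>v. smooth_on B (\<lambda>y. \<beta> y v)) \<and>
     (\<forall>y\<in>B \<inter> space_form \<qq>. \<forall>v\<in>tangent_M \<qq> y. \<beta> y v = \<alpha> y v)"

text \<open>\<open>\<alpha>\<close> is a smooth 1-form on \<open>space_form \<qq>\<close> with $d\alpha=i_Y\mathrm{vol}$.\<close>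

definition flux_primitive ::
    "(real^5^5 \<Rightarrow> real) \<Rightarrow> real^5 \<Rightarrow> real^5^5 \<Rightarrow> (real^5 \<Rightarrow> real^5 \<Rightarrow> real) \<Rightarrow> bool" where
  "flux_primitive D \<qq> Y \<alpha> \<longleftrightarrow> (\<forall>y\<in>space_form \<qq>. \<exists>B \<beta>. y \<in> B \<and> local_extension \<qq> \<alpha> B \<beta> \<and>
     (\<forall>v\<in>tangent_M \<qq> y. \<forall>w\<in>tangent_M \<qq> y.
        frechet_derivative (\<lambda>z. \<beta> z w) (at y) v - frechet_derivative (\<lambda>z. \<beta> z v) (at y) w
          = vol_M D \<qq> y (conf_field \<qq> Y y) v w))"


section \<open>Immersed surfaces in space forms\<close>

definition immersion :: "'a chart set \<Rightarrow> real^5 \<Rightarrow> ('a \<Rightarrow> real^5) \<Rightarrow> bool" where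
  "immersion A \<qq> x \<longleftrightarrow> smooth_map A x \<and> range x \<subseteq> space_form \<qq> \<and>
     (\<forall>p. inj_on (differential A x p) (tangent A p))"

definition fundI :: "'a chart set \<Rightarrow> ('a \<Rightarrow> real^5) \<Rightarrow> 'a \<Rightarrow> 'a tvec \<Rightarrow> 'a tvec \<Rightarrow> real" where
  "fundI A x p U V = lor (differential A x p U) (differential A x p V)"

definition area_form :: "'a chart set \<Rightarrow> ('a \<Rightarrow> real^5) \<Rightarrow> 'a \<Rightarrow> 'a tvec \<Rightarrow> 'a tvec \<Rightarrow> real" where
  "area_form A x p U V = orient_sgn A p U V *
     sqrt (fundI A x p U U * fundI A x p V V - (fundI A x p U V)\<^sup>2)"

definition unit_normal ::
    "'a chart set \<Rightarrow> (real^5^5 \<Rightarrow> real) \<Rightarrow> real^5 \<Rightarrow> ('a \<Rightarrow> real^5) \<Rightarrow> 'a \<Rightarrow> real^5" where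
  "unit_normal A D \<qq> x p = (THE n. n \<in> tangent_M \<qq> (x p) \<and> lor n n = 1 \<and>
     (\<forall>U\<in>tangent A p. lor n (differential A x p U) = 0) \<and>
     (\<forall>U\<in>tangent A p. \<forall>V\<in>tangent A p.
        vol_M D \<qq> (x p) n (differential A x p U) (differential A x p V) = area_form A x p U V))"

text \<open>Sign convention: $\mathrm{II}(U,V)=(\nabla_U(dx(V)),N)=-(dN(U),dx(V))$. Since \<open>dx(V)\<close> is tangent
  to the space form, the flat derivative of \<open>N\<close> may be used in place of the Levi-Civita one.\<close>

definition fundII ::
    "'a chart set \<Rightarrow> (real^5^5 \<Rightarrow> real) \<Rightarrow> real^5 \<Rightarrow> ('a \<Rightarrow> real^5) \<Rightarrow> 'a \<Rightarrow> 'a tvec \<Rightarrow> 'a tvec \<Rightarrow> real"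
  where
  "fundII A D \<qq> x p U V = - lor (differential A (unit_normal A D \<qq> x) p U) (differential A x p V)"

definition mean_curvature ::
    "'a chart set \<Rightarrow> (real^5^5 \<Rightarrow> real) \<Rightarrow> real^5 \<Rightarrow> ('a \<Rightarrow> real^5) \<Rightarrow> 'a \<Rightarrow> real" where
  "mean_curvature A D \<qq> x p = (THE h. \<forall>E\<in>tangent A p. \<forall>F\<in>tangent A p.
     fundI A x p E E = 1 \<and> fundI A x p F F = 1 \<and> fundI A x p E F = 0 \<longrightarrow>
     h = (fundII A D \<qq> x p E E + fundII A D \<qq> x p F F) / 2)"

text \<open>Rotation by $+90^\circ$ in the tangent planes: the complex structure of the induced metric and
  the orientation.\<close>

definition cplx_J :: "'a chart set \<Rightarrow> ('a \<Rightarrow> real^5) \<Rightarrow> 'a \<Rightarrow> 'a tvec \<Rightarrow> 'a tvec" where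
  "cplx_J A x p U = (THE V. V \<in> tangent A p \<and> fundI A x p U V = 0 \<and>
     fundI A x p V V = fundI A x p U U \<and> area_form A x p U V \<ge> 0)"

text \<open>$\mathrm{II}^{2,0}(U,V)=\mathrm{II}(\pi U,\pi V)$ with $\pi U=(U-iJU)/2$ the projection to the
  $(1,0)$-part and $\mathrm{II}$ extended complex bilinearly.\<close>

definition hopf ::
    "'a chart set \<Rightarrow> (real^5^5 \<Rightarrow> real) \<Rightarrow> real^5 \<Rightarrow> ('a \<Rightarrow> real^5) \<Rightarrow> 'a \<Rightarrow> 'a tvec \<Rightarrow> 'a tvec \<Rightarrow> complex"
  where
  "hopf A D \<qq> x p U V =
     (let J = cplx_J A x p; II = fundII A D \<qq> x p
      in Complex ((II U V - II (J U) (J V)) / 4) (- (II (J U) V + II U (J V)) / 4))"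

text \<open>$Y^\top$, for the conformal vector field given by \<open>Y \<in> so41\<close>.\<close>

definition tan_part :: "'a chart set \<Rightarrow> real^5 \<Rightarrow> ('a \<Rightarrow> real^5) \<Rightarrow> real^5^5 \<Rightarrow> 'a \<Rightarrow> 'a tvec" where
  "tan_part A \<qq> x Y p = (THE U. U \<in> tangent A p \<and>
     (\<forall>V\<in>tangent A p. lor (conf_field \<qq> Y (x p) - differential A x p U) (differential A x p V) = 0))"

definition retraction_form ::
    "'a chart set \<Rightarrow> real^5 \<Rightarrow> ('a \<Rightarrow> real^5) \<Rightarrow> ('a \<Rightarrow> 'a tvec \<Rightarrow> 'a tvec \<Rightarrow> complex)
      \<Rightarrow> ('a, real^5^5) form1" where
  "retraction_form A \<qq> x q p U = (THE Z. Z \<in> so41 \<and>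
     (\<forall>Y\<in>so41. pairing_g Z Y = 2 * Re (q p (tan_part A \<qq> x Y p) U)))"

text \<open>$\mu_x(Y)$, for mean curvature \<open>H\<close>. The primitives \<open>\<alpha>\<close> are unique up to exact forms, so all
  classes in the union coincide.\<close>

definition moment_class ::
    "'a chart set \<Rightarrow> (real^5^5 \<Rightarrow> real) \<Rightarrow> real^5 \<Rightarrow> ('a \<Rightarrow> real^5) \<Rightarrow> real \<Rightarrow> real^5^5
      \<Rightarrow> ('a, real) form1 set" where
  "moment_class A D \<qq> x H Y = \<Union> {dR_class A (\<lambda>p U.
       area_form A x p (tan_part A \<qq> x Y p) U - 2 * H * \<alpha> (x p) (differential A x p U))
     | \<alpha>. flux_primitive D \<qq> Y \<alpha>}"


section \<open>The identification of \<open>so41\<close> with bivectors\<close>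

lemma exhaust_5: "i = 1 \<or> i = 2 \<or> i = 3 \<or> i = 4 \<or> i = (5::5)"
proof (induct i)
  case (of_int z)
  then have "0 \<le> z" "z < 5" by simp_all
  then have "z = 0 \<or> z = 1 \<or> z = 2 \<or> z = 3 \<or> z = 4" by arith
  then show ?case by auto
qed

lemma forall_5: "(\<forall>i::5. P i) \<longleftrightarrow> P 1 \<and> P 2 \<and> P 3 \<and> P 4 \<and> P 5"
  by (metis exhaust_5)

lemma vector_5:
  "vector [a,b,c,d,e] $ (1::5) = (a::'a::zero)" "vector [a,b,c,d,e] $ (2::5) = b"
  "vector [a,b,c,d,e] $ (3::5) = c" "vector [a,b,c,d,e] $ (4::5) = d"
  "vector [a,b,c,d,e] $ (5::5) = e"
  unfolding vector_def by simp_all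

lemma lor_axis: "lor a (axis i 1) = sig i * a $ i"
  unfolding lor_def by (simp add: axis_def if_distrib cong: if_cong)

lemma wedge_nth: "wedge a b $ j $ i = sig i * (a $ i * b $ j - b $ i * a $ j)"
  by (simp add: wedge_def matrix_def lor_axis algebra_simps)

lemma bivec_wedge: "bivec (wedge a b) i j = a $ i * b $ j - b $ i * a $ j"
  by (simp add: bivec_def wedge_nth sig_def)

lemma so41_skew:
  assumes "Y \<in> so41" shows "sig i * Y $ i $ j = - sig j * Y $ j $ i"
proof -
  have "lor (Y *v axis j 1) (axis i 1) + lor (Y *v axis i 1) (axis j 1) = 0"
  proof -
    have "lor (axis j 1) (Y *v axis i 1) = lor (Y *v axis i 1) (axis j 1)"
      unfolding lor_def by (simp add: mult_ac)
    then show ?thesis using assms unfolding so41_def by (metis (mono_tags, lifting) mem_Collect_eq)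
  qed
  then show ?thesis
    unfolding lor_axis by (simp add: matrix_vector_mul_component matrix_vector_mult_basis column_def)
qed

lemma sum_delta2:
  fixes f :: "5 \<Rightarrow> 5 \<Rightarrow> real"
  shows "(\<Sum>i\<in>UNIV. \<Sum>j\<in>UNIV. if i = a then if j = b then f i j else 0 else 0) = f a b"
proof -
  have "(\<Sum>j\<in>UNIV. if i = a then if j = b then f i j else 0 else 0) = (if i = a then f i b else 0)" for i
    by (cases "i = a") simp_all
  then show ?thesis by simp
qed

lemma so41_bivec:
  assumes "Y \<in> so41"
  shows "Y = (1/2) *\<^sub>R (\<Sum>i\<in>UNIV. \<Sum>j\<in>UNIV. bivec Y i j *\<^sub>R wedge (axis i 1) (axis j 1))"
proof -
  have skew: "bivec Y i j = - bivec Y j i" for i j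
    using so41_skew[OF assms, of i j] by (auto simp: bivec_def sig_def split: if_splits)
  have "Y $ m $ n = (1/2) * (\<Sum>i\<in>UNIV. \<Sum>j\<in>UNIV. bivec Y i j * wedge (axis i 1) (axis j 1) $ m $ n)" for m n
  proof -
    have "(\<Sum>i\<in>UNIV. \<Sum>j\<in>UNIV. bivec Y i j * wedge (axis i 1) (axis j 1) $ m $ n)
       = (\<Sum>i\<in>UNIV. \<Sum>j\<in>UNIV. (if i = n then if j = m then sig n * bivec Y i j else 0 else 0))
         - (\<Sum>i\<in>UNIV. \<Sum>j\<in>UNIV. (if i = m then if j = n then sig n * bivec Y i j else 0 else 0))"
      unfolding sum_subtractf[symmetric] wedge_nth
      by (intro sum.cong refl) (simp add: axis_def)
    also have "\<dots> = sig n * bivec Y n m - sig n * bivec Y m n"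
      unfolding sum_delta2 by (rule refl)
    also have "\<dots> = 2 * Y $ m $ n"
      using skew[of m n] by (simp add: bivec_def sig_def split: if_splits)
    finally show ?thesis by simp
  qed
  then show ?thesis by (simp add: vec_eq_iff sum_component)
qed

lemma volume_form_sum:
  assumes "is_volume_form D"
  shows "(\<Sum>k\<in>UNIV. a $ k * D (\<chi> j. if j = i then axis k 1 else M $ j))
     = D (\<chi> j. if j = i then a else M $ j)"
proof -
  let ?f = "\<lambda>v. D (\<chi> j. if j = i then v else M $ j)"
  have lin: "linear ?f" using assms unfolding is_volume_form_def by blast
  have "a = (\<Sum>k\<in>UNIV. a $ k *\<^sub>R axis k 1)"
    by (simp add: basis_expansion scalar_mult_eq_scaleR[symmetric])
  then have "?f a = ?f (\<Sum>k\<in>UNIV. a $ k *\<^sub>R axis k 1)" by (rule arg_cong)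
  also have "\<dots> = (\<Sum>k\<in>UNIV. a $ k * ?f (axis k 1))"
    using lin by (simp add: linear_sum[OF lin] linear_scale[OF lin])
  finally show ?thesis by simp
qed

lemma vector_5_upd:
  "vector [v,a,b,c,d] = (\<chi> j. if j = (2::5) then a else (vector [v,0,b,c,d]) $ j)"
  "vector [v,a,b,c,d] = (\<chi> j. if j = (3::5) then b else (vector [v,a,0,c,d]) $ j)"
  "vector [v,a,b,c,d] = (\<chi> j. if j = (4::5) then c else (vector [v,a,b,0,d]) $ j)"
  "vector [v,a,b,c,d] = (\<chi> j. if j = (5::5) then d else (vector [v,a,b,c,0]) $ j)"
  by (simp_all add: vec_eq_iff forall_5 vector_5)

lemma volume_form_expand:
  assumes "is_volume_form D"
  shows "(\<Sum>i\<in>UNIV. a $ i * D (vector [v, axis i 1, b, c, d])) = D (vector [v,a,b,c,d])"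
    and "(\<Sum>i\<in>UNIV. b $ i * D (vector [v, a, axis i 1, c, d])) = D (vector [v,a,b,c,d])"
    and "(\<Sum>i\<in>UNIV. c $ i * D (vector [v, a, b, axis i 1, d])) = D (vector [v,a,b,c,d])"
    and "(\<Sum>i\<in>UNIV. d $ i * D (vector [v, a, b, c, axis i 1])) = D (vector [v,a,b,c,d])"
  using volume_form_sum[OF assms, of a 2 "vector [v,0,b,c,d]"]
    volume_form_sum[OF assms, of b 3 "vector [v,a,0,c,d]"]
    volume_form_sum[OF assms, of c 4 "vector [v,a,b,0,d]"]
    volume_form_sum[OF assms, of d 5 "vector [v,a,b,c,0]"]
  unfolding vector_5_upd[symmetric] by blast+

lemma volume_form_expand4:
  assumes "is_volume_form D"
  shows "(\<Sum>i\<in>UNIV. \<Sum>j\<in>UNIV. \<Sum>k\<in>UNIV. \<Sum>l\<in>UNIV. (a $ i * b $ j) * (c $ k * d $ l) *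
      D (vector [v, axis i 1, axis j 1, axis k 1, axis l 1])) = D (vector [v,a,b,c,d])"
proof -
  have "(\<Sum>i\<in>UNIV. \<Sum>j\<in>UNIV. \<Sum>k\<in>UNIV. \<Sum>l\<in>UNIV. (a $ i * b $ j) * (c $ k * d $ l) *
      D (vector [v, axis i 1, axis j 1, axis k 1, axis l 1]))
    = (\<Sum>i\<in>UNIV. a $ i * (\<Sum>j\<in>UNIV. b $ j * (\<Sum>k\<in>UNIV. c $ k * (\<Sum>l\<in>UNIV. d $ l *
      D (vector [v, axis i 1, axis j 1, axis k 1, axis l 1])))))"
    by (simp add: sum_distrib_left mult_ac)
  then show ?thesis by (simp add: volume_form_expand[OF assms])
qed

lemma linear_swap:
  fixes F :: "real^5 \<Rightarrow> real^5 \<Rightarrow> real"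
  assumes "\<And>b. linear (\<lambda>a. F a b)" "\<And>a. linear (F a)" "\<And>a. F a a = 0"
  shows "F b a = - F a b"
proof -
  have "0 = F (a + b) (a + b)" using assms(3) by simp
  also have "\<dots> = F a a + F b a + (F a b + F b b)"
    by (simp add: linear_add[OF assms(1)] linear_add[OF assms(2)])
  finally show ?thesis using assms(3) by simp
qed

lemma volume_form_swap:
  assumes "is_volume_form D"
  shows "D (vector [v,b,a,c,d]) = - D (vector [v,a,b,c,d])"
    and "D (vector [v,a,b,d,c]) = - D (vector [v,a,b,c,d])"
proof -
  have lin: "linear (\<lambda>w. D (\<chi> j. if j = i then w else M $ j))" for M i
    using assms unfolding is_volume_form_def by blast
  have alt: "D M = 0" if "i \<noteq> j" "M $ i = M $ j" for M i j
    using assms that unfolding is_volume_form_def by blast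
  show "D (vector [v,b,a,c,d]) = - D (vector [v,a,b,c,d])"
  proof (rule linear_swap[where F = "\<lambda>a b. D (vector [v,a,b,c,d])"])
    show "linear (\<lambda>a. D (vector [v,a,b,c,d]))" for b
      using lin[of 2 "vector [v,0,b,c,d]"] unfolding vector_5_upd(1)[symmetric] .
    show "linear (\<lambda>b. D (vector [v,a,b,c,d]))" for a
      using lin[of 3 "vector [v,a,0,c,d]"] unfolding vector_5_upd(2)[symmetric] .
    show "D (vector [v,a,a,c,d]) = 0" for a
      by (rule alt[of 2 3]) (simp_all add: vector_5)
  qed
  show "D (vector [v,a,b,d,c]) = - D (vector [v,a,b,c,d])"
  proof (rule linear_swap[where F = "\<lambda>c d. D (vector [v,a,b,c,d])"])
    show "linear (\<lambda>c. D (vector [v,a,b,c,d]))" for d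
      using lin[of 4 "vector [v,a,b,0,d]"] unfolding vector_5_upd(3)[symmetric] .
    show "linear (\<lambda>d. D (vector [v,a,b,c,d]))" for c
      using lin[of 5 "vector [v,a,b,c,0]"] unfolding vector_5_upd(4)[symmetric] .
    show "D (vector [v,a,b,c,c]) = 0" for c
      by (rule alt[of 4 5]) (simp_all add: vector_5)
  qed
qed

lemma ring_expand:
  fixes p q r s p' q' r' s' t :: real
  shows "(p * q - r * s) * (p' * q' - r' * s') * t
    = (p * q) * (p' * q') * t - (r * s) * (p' * q') * t - (p * q) * (r' * s') * t + (r * s) * (r' * s') * t"
  by algebra

lemma det_wedge_wedge:
  assumes "is_volume_form D"
  shows "det_wedge D v (wedge a b) (wedge c d) = D (vector [v,a,b,c,d])"
proof -
  let ?T = "\<lambda>a b c d. (\<Sum>i\<in>UNIV. \<Sum>j\<in>UNIV. \<Sum>k\<in>UNIV. \<Sum>l\<in>UNIV. (a $ i * b $ j) * (c $ k * d $ l) *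
      D (vector [v, axis i 1, axis j 1, axis k 1, axis l 1]))"
  have "4 * det_wedge D v (wedge a b) (wedge c d)
      = (\<Sum>i\<in>UNIV. \<Sum>j\<in>UNIV. \<Sum>k\<in>UNIV. \<Sum>l\<in>UNIV.
          (a $ i * b $ j - b $ i * a $ j) * (c $ k * d $ l - d $ k * c $ l) *
          D (vector [v, axis i 1, axis j 1, axis k 1, axis l 1]))"
    unfolding det_wedge_def bivec_wedge by simp
  also have "\<dots> = ?T a b c d - ?T b a c d - ?T a b d c + ?T b a d c"
    unfolding ring_expand sum_subtractf sum.distrib by (rule refl)
  also have "\<dots> = D (vector [v,a,b,c,d]) - D (vector [v,b,a,c,d])
      - D (vector [v,a,b,d,c]) + D (vector [v,b,a,d,c])"
    unfolding volume_form_expand4[OF assms] by (rule refl)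
  also have "\<dots> = 4 * D (vector [v,a,b,c,d])"
    using volume_form_swap(1)[OF assms, of v b a c d] volume_form_swap(2)[OF assms, of v a b d c]
      volume_form_swap(2)[OF assms, of v b a d c] by linarith
  finally show ?thesis by simp
qed

end

theory Submission
  imports Defs
begin

text \<open>
  With \<open>N\<close> the unit normal, twice the real part of the Hopf differential is the trace-free second
  fundamental form, so the retraction form is \<open>(dN + H dx) \<and> x\<close>. For a fixed \<open>v\<close> with
  \<open>(v, \<qq>) = -1\<close>, subtracting \<open>d((N + H x) \<and> v)\<close> leaves \<open>\<omega> = (dN + H dx) \<and> (x - v)\<close>,
  whose values annihilate \<open>\<qq>\<close>; it is closed since \<open>dN \<and> dx = - H dx \<and> dx\<close>.

  For a Killing field \<open>Y\<close>, \<open>det(v \<and> a \<and> b \<and> Y)\<close> with \<open>a, b \<bottom> \<qq>\<close> depends on \<open>v\<close> only through \<open>(v, \<qq>)\<close>.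
  Replacing \<open>v\<close> by \<open>x\<close> shows that \<open>S \<omega> Y\<close> is the sum of \<open>d(det(v \<and> N \<and> x \<and> Y))\<close>, the flux of \<open>Y\<close>'s tangential
  part, and \<open>- 2 H \<alpha>(dx)\<close>, where \<open>\<alpha>(w) = det(v \<and> y \<and> w \<and> Y) / 2\<close> at \<open>y\<close> is a primitive of the flux form.
  Any other primitive differs from it by an exact form, because each component of the space form
  is covered by one stereographic chart with convex image, or, for a sphere, by two with connected overlap.
\<close>


section \<open>Smooth maps between Euclidean spaces\<close>

text \<open>Why the correction term is there: the retraction form applied to \<qq> is dN + H dx,
  because (x, \<qq>) = -1 while dN and dx are orthogonal to \<qq>. So its failure to be Killing is
  itself exact, equal to d(N + H x), and d((N + H x) \<and> v) acts on \<qq> in the same way as soon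
  as (v, \<qq>) = -1. The factor 1/2 in \<alpha> makes up for the doubling under antisymmetrization
  in the exterior derivative; it also reduces the coefficient 2 H of the moment class to the H of
  the retraction form.

  Two obstacles shape the proof. The normal, the rotation J, the tangential part, the mean curvature
  and the retraction form are definite descriptions, so each is computed in an orthonormal frame and
  shown to be unique; such a frame is chosen point by point, and smoothness of N therefore needs a
  separate formula. Moreover \<open>moment_class\<close> is a union over all primitives, so any two
  of them must yield one class. The surface may have any topology, hence exactness of their
  difference has to come from the space form; this is why potentials are built there.\<close>

lemma Ck_on_cong:
  assumes "open S" "\<And>u. u \<in> S \<Longrightarrow> f u = g u" "Ck_on k S f"
  shows "Ck_on k S g"
  using assms(2,3)
proof (induction k arbitrary: f g)
  case 0
  then show ?case by (metis Ck_on.simps(1) continuous_on_cong)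
next
  case (Suc k)
  have der: "f differentiable (at u)" if "u \<in> S" for u using Suc.prems(2) that by simp
  have "(g has_derivative frechet_derivative f (at u)) (at u)" if "u \<in> S" for u
    using der[OF that] that Suc.prems(1) assms(1)
    by (meson frechet_derivative_works has_derivative_transform_within_open)
  then have g: "g differentiable (at u)" "frechet_derivative g (at u) = frechet_derivative f (at u)"
    if "u \<in> S" for u
    using that by (auto intro: differentiableI frechet_derivative_at[symmetric])
  have "Ck_on k S (\<lambda>u. frechet_derivative g (at u) v)" for v
    by (rule Suc.IH[of "\<lambda>u. frechet_derivative f (at u) v"]) (use Suc.prems g in auto)
  then show ?case using g by simp
qed

text \<open>Uniqueness of derivatives identifies a known f' with the chosen
  \<open>frechet_derivative\<close> on S, so that concrete derivative rules can drive the inductions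
  below.\<close>

lemma Ck_on_SucI:
  assumes "open S" "\<And>u. u \<in> S \<Longrightarrow> (f has_derivative f' u) (at u)"
    "\<And>v. Ck_on k S (\<lambda>u. f' u v)"
  shows "Ck_on (Suc k) S f"
proof -
  have "f' u = frechet_derivative f (at u)" if "u \<in> S" for u
    using assms(2)[OF that] by (rule frechet_derivative_at)
  then have "Ck_on k S (\<lambda>u. frechet_derivative f (at u) v)" for v
    by (intro Ck_on_cong[OF assms(1) _ assms(3)[of v]]) simp
  then show ?thesis using assms(2) by (auto intro: differentiableI)
qed

lemma Ck_on_has_derivative:
  "Ck_on (Suc k) S f \<Longrightarrow> u \<in> S \<Longrightarrow> (f has_derivative frechet_derivative f (at u)) (at u)"
  by (simp add: frechet_derivative_works)

lemma Ck_on_continuous: "Ck_on k S f \<Longrightarrow> continuous_on S f"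
  by (cases k) (auto intro: continuous_at_imp_continuous_on differentiable_imp_continuous_within)

lemma Ck_on_SucD: "Ck_on (Suc k) S f \<Longrightarrow> Ck_on k S f"
proof (induction k arbitrary: f)
  case 0 then show ?case using Ck_on_continuous Ck_on.simps(1) by blast
next
  case (Suc k) then show ?case by (metis Ck_on.simps(2))
qed

lemma Ck_on_local:
  assumes "\<And>u. u \<in> S \<Longrightarrow> \<exists>T. open T \<and> u \<in> T \<and> Ck_on k T f"
  shows "Ck_on k S f"
  using assms
proof (induction k arbitrary: f)
  case 0
  then have "continuous (at u) f" if "u \<in> S" for u
    using that by (metis Ck_on.simps(1) continuous_on_eq_continuous_at)
  then show ?case by (simp add: continuous_at_imp_continuous_on)
next
  case (Suc k)
  then show ?case by (simp, metis)
qed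

lemma Ck_on_const: "Ck_on k S (\<lambda>u. c)"
  by (induction k arbitrary: c) (simp_all)

lemma Ck_on_linear:
  assumes "open S" "bounded_linear L" "Ck_on k S f"
  shows "Ck_on k S (\<lambda>u. L (f u))"
  using assms(3)
proof (induction k arbitrary: f)
  case 0
  then show ?case using assms(2) by (simp add: bounded_linear.continuous_on)
next
  case (Suc k)
  show ?case
    by (rule Ck_on_SucI[OF assms(1) bounded_linear.has_derivative[OF assms(2) Ck_on_has_derivative[OF Suc.prems]]])
      (use Suc in auto)
qed

lemma Ck_on_add:
  assumes "open S" "Ck_on k S f" "Ck_on k S g"
  shows "Ck_on k S (\<lambda>u. f u + g u)"
  using assms(2,3)
proof (induction k arbitrary: f g)
  case 0 then show ?case by (simp add: continuous_on_add)
next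
  case (Suc k)
  show ?case
    by (rule Ck_on_SucI[OF assms(1) has_derivative_add[OF Ck_on_has_derivative[OF Suc.prems(1)] Ck_on_has_derivative[OF Suc.prems(2)]]])
      (use Suc in auto)
qed

lemma Ck_on_bilinear:
  assumes "open S" "bounded_bilinear B" "Ck_on k S f" "Ck_on k S g"
  shows "Ck_on k S (\<lambda>u. B (f u) (g u))"
  using assms(3,4)
proof (induction k arbitrary: f g)
  case 0 then show ?case using assms(2) by (simp add: bounded_bilinear.continuous_on)
next
  case (Suc k)
  have "Ck_on k S f" "Ck_on k S g" using Suc.prems Ck_on_SucD by blast+
  then show ?case
    by (intro Ck_on_SucI[OF assms(1) bounded_bilinear.FDERIV[OF assms(2) Ck_on_has_derivative[OF Suc.prems(1)] Ck_on_has_derivative[OF Suc.prems(2)]]])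
      (use Suc assms(1) in \<open>auto intro!: Ck_on_add\<close>)
qed

lemma Ck_on_sum:
  assumes "open S" "\<And>i. i \<in> I \<Longrightarrow> Ck_on k S (f i)"
  shows "Ck_on k S (\<lambda>u. \<Sum>i\<in>I. f i u)"
  using assms(2) by (induction I rule: infinite_finite_induct)
    (auto intro: Ck_on_const Ck_on_add[OF assms(1)])

lemma Ck_on_ident: "Ck_on k S (\<lambda>u. u)"
  by (cases k) (simp_all add: Ck_on_const)

text \<open>The chain rule writes the derivative of a composition as a sum over a basis, so that the
  induction hypothesis applies to the partial derivatives of the outer function.\<close>

lemma Ck_on_compose:
  fixes f :: "'a::euclidean_space \<Rightarrow> 'b::euclidean_space"
  assumes "open S" "open T" "f ` S \<subseteq> T" "Ck_on k S f" "Ck_on k T g"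
  shows "Ck_on k S (\<lambda>u. g (f u))"
  using assms(4,5)
proof (induction k arbitrary: g)
  case 0 then show ?case using assms(3) by (auto intro: continuous_on_compose2)
next
  case (Suc k)
  let ?D = "\<lambda>u. frechet_derivative g (at (f u))"
  have der: "((\<lambda>u. g (f u)) has_derivative (\<lambda>v. ?D u (frechet_derivative f (at u) v))) (at u)"
    if "u \<in> S" for u
    by (rule has_derivative_compose[OF Ck_on_has_derivative[OF Suc.prems(1) that]
          Ck_on_has_derivative[OF Suc.prems(2)]]) (use that assms(3) in auto)
  have lin: "?D u w = (\<Sum>b\<in>Basis. (w \<bullet> b) *\<^sub>R ?D u b)" if "u \<in> S" for u w
  proof -
    have "linear (?D u)" using Suc.prems(2) that assms(3) by (auto intro!: linear_frechet_derivative)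
    then have "?D u (\<Sum>b\<in>Basis. (w \<bullet> b) *\<^sub>R b) = (\<Sum>b\<in>Basis. (w \<bullet> b) *\<^sub>R ?D u b)"
      by (simp add: linear_sum linear_scale)
    then show ?thesis by (simp add: euclidean_representation)
  qed
  have f: "Ck_on k S f" using Suc.prems Ck_on_SucD by blast
  have "Ck_on k S (\<lambda>u. \<Sum>b\<in>Basis. (frechet_derivative f (at u) v \<bullet> b) *\<^sub>R ?D u b)" for v
    by (intro Ck_on_sum assms(1) Ck_on_bilinear[OF _ bounded_bilinear_scaleR]
        Ck_on_linear[OF _ bounded_linear_inner_left] Suc.IH f)
      (use Suc.prems in auto)
  then have "Ck_on k S (\<lambda>u. ?D u (frechet_derivative f (at u) v))" for v
    by (rule Ck_on_cong[OF assms(1), rotated]) (use lin in simp)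
  then show ?case by (intro Ck_on_SucI[OF assms(1) der])
qed

lemma smooth_on_derivative:
  "smooth_on S f \<Longrightarrow> smooth_on S (\<lambda>u. frechet_derivative f (at u) v)"
  unfolding smooth_on_def by (metis Ck_on.simps(2))

lemma smooth_on_has_derivative:
  "smooth_on S f \<Longrightarrow> u \<in> S \<Longrightarrow> (f has_derivative frechet_derivative f (at u)) (at u)"
  unfolding smooth_on_def using Ck_on_has_derivative by blast

lemma smooth_on_cong:
  "open S \<Longrightarrow> (\<And>u. u \<in> S \<Longrightarrow> f u = g u) \<Longrightarrow> smooth_on S f \<Longrightarrow> smooth_on S g"
  unfolding smooth_on_def using Ck_on_cong[of S f g] by blast

lemma smooth_on_subset: "smooth_on S f \<Longrightarrow> T \<subseteq> S \<Longrightarrow> smooth_on T f"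
proof -
  have "Ck_on k S f \<Longrightarrow> T \<subseteq> S \<Longrightarrow> Ck_on k T f" for k f
  proof (induction k arbitrary: f)
    case 0 then show ?case using continuous_on_subset by auto
  next
    case (Suc k) then show ?case by auto
  qed
  then show "smooth_on S f \<Longrightarrow> T \<subseteq> S \<Longrightarrow> smooth_on T f" unfolding smooth_on_def by blast
qed

text \<open>Meant for potentials, which are known only through their derivative: a C^k derivative
  makes f of class C^(k+1), for every k.\<close>

lemma smooth_onI:
  assumes "open S" "\<And>u. u \<in> S \<Longrightarrow> (f has_derivative f' u) (at u)"
    "\<And>v. smooth_on S (\<lambda>u. f' u v)"
  shows "smooth_on S f"
proof -
  have "Ck_on (Suc k) S f" for k
    using assms(3) by (intro Ck_on_SucI[OF assms(1,2)]) (simp_all add: smooth_on_def)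
  then show ?thesis unfolding smooth_on_def using Ck_on_SucD by blast
qed

lemma smooth_on_local:
  "(\<And>u. u \<in> S \<Longrightarrow> \<exists>T. open T \<and> u \<in> T \<and> smooth_on T f) \<Longrightarrow> smooth_on S f"
  unfolding smooth_on_def by (meson Ck_on_local)

lemma smooth_on_const: "smooth_on S (\<lambda>u. c)"
  and smooth_on_ident: "smooth_on S (\<lambda>u. u)"
  by (simp_all add: smooth_on_def Ck_on_const Ck_on_ident)

lemma smooth_on_linear:
  "open S \<Longrightarrow> bounded_linear L \<Longrightarrow> smooth_on S f \<Longrightarrow> smooth_on S (\<lambda>u. L (f u))"
  by (simp add: smooth_on_def Ck_on_linear)

lemma smooth_on_add:
  "open S \<Longrightarrow> smooth_on S f \<Longrightarrow> smooth_on S g \<Longrightarrow> smooth_on S (\<lambda>u. f u + g u)"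
  by (simp add: smooth_on_def Ck_on_add)

lemma smooth_on_bilinear:
  "open S \<Longrightarrow> bounded_bilinear B \<Longrightarrow> smooth_on S f \<Longrightarrow> smooth_on S g
    \<Longrightarrow> smooth_on S (\<lambda>u. B (f u) (g u))"
  by (simp add: smooth_on_def Ck_on_bilinear)

lemma smooth_on_sum:
  "open S \<Longrightarrow> (\<And>i. i \<in> I \<Longrightarrow> smooth_on S (f i)) \<Longrightarrow> smooth_on S (\<lambda>u. \<Sum>i\<in>I. f i u)"
  by (simp add: smooth_on_def Ck_on_sum)

lemma smooth_on_compose:
  fixes f :: "'a::euclidean_space \<Rightarrow> 'b::euclidean_space"
  shows "open S \<Longrightarrow> open T \<Longrightarrow> f ` S \<subseteq> T \<Longrightarrow> smooth_on S f \<Longrightarrow> smooth_on T g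
    \<Longrightarrow> smooth_on S (\<lambda>u. g (f u))"
  unfolding smooth_on_def using Ck_on_compose by blast

lemmas smooth_on_mult = smooth_on_bilinear[OF _ bounded_bilinear_mult]
lemmas smooth_on_scaleR = smooth_on_bilinear[OF _ bounded_bilinear_scaleR]

lemma smooth_on_minus: "open S \<Longrightarrow> smooth_on S f \<Longrightarrow> smooth_on S (\<lambda>u. - f u)"
  by (rule smooth_on_linear[OF _ bounded_linear_minus[OF bounded_linear_ident]])

lemma smooth_on_diff:
  "open S \<Longrightarrow> smooth_on S f \<Longrightarrow> smooth_on S g \<Longrightarrow> smooth_on S (\<lambda>u. f u - g u)"
  using smooth_on_add[OF _ _ smooth_on_minus, of S f g] by simp

text \<open>Differentiation only shifts the exponent and adds a factor, so the induction runs over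
  all r at once. The exponents used later are -1 for reciprocals and -1/2 for normalization.\<close>

lemma smooth_on_powr: "smooth_on {0<..} (\<lambda>t::real. t powr r)"
proof -
  have "Ck_on k {0<..} (\<lambda>t::real. t powr r)" for k
  proof (induction k arbitrary: r)
    case 0 show ?case by (auto intro!: continuous_intros)
  next
    case (Suc k)
    have "((\<lambda>t. t powr r) has_derivative (\<lambda>v. (r * v) * t powr (r - 1))) (at t)" if "t \<in> {0<..}" for t
    proof -
      have "(*) (r * t powr (r - 1)) = (\<lambda>v. (r * v) * t powr (r - 1))" by auto
      then show ?thesis using has_real_derivative_powr[of t r] that
        by (simp add: has_field_derivative_def)
    qed
    then show ?case
      by (rule Ck_on_SucI[OF open_greaterThan]) (auto intro!: Ck_on_linear[OF _ bounded_linear_mult_right] Suc.IH)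
  qed
  then show ?thesis by (simp add: smooth_on_def)
qed

lemma smooth_on_vec:
  fixes f :: "'a::euclidean_space \<Rightarrow> real^'n"
  assumes "open S" "\<And>i. smooth_on S (\<lambda>u. f u $ i)"
  shows "smooth_on S f"
proof -
  have "smooth_on S (\<lambda>u. \<Sum>i\<in>UNIV. f u $ i *\<^sub>R (axis i 1 :: real^'n))"
    by (intro smooth_on_sum smooth_on_scaleR assms smooth_on_const)
  moreover have "(\<Sum>i\<in>UNIV. f u $ i *\<^sub>R (axis i 1 :: real^'n)) = f u" for u
    by (simp add: basis_expansion scalar_mult_eq_scaleR[symmetric])
  ultimately show ?thesis by simp
qed

section \<open>Commuting second derivatives and the Poincare lemma on convex sets\<close>

lemma has_derivative_along_line:
  assumes "(f has_derivative f') (at (a + t *\<^sub>R v))"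
  shows "((\<lambda>t. f (a + t *\<^sub>R v)) has_derivative (\<lambda>s. s *\<^sub>R f' v)) (at t within T)"
proof -
  have "((\<lambda>t. f (a + t *\<^sub>R v)) has_derivative (\<lambda>s. f' (s *\<^sub>R v))) (at t)"
    by (rule has_derivative_compose[where f="\<lambda>t. a + t *\<^sub>R v", OF _ assms]) (auto intro!: derivative_eq_intros)
  moreover have "linear f'" using assms has_derivative_linear by blast
  ultimately show ?thesis by (simp add: linear_scale has_derivative_at_withinI)
qed

text \<open>Two applications of the mean value theorem: first along v, to the difference of f on the
  two parallel segments, then along w, to the derivative in direction v.\<close>

lemma second_difference_mean_value:
  fixes f :: "'a::euclidean_space \<Rightarrow> real"
  assumes S: "\<And>r t. r \<in> {0..s} \<Longrightarrow> t \<in> {0..s} \<Longrightarrow> u + r *\<^sub>R v + t *\<^sub>R w \<in> S"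
    and C2: "Ck_on 2 S f" and s: "s > 0"
  shows "\<exists>r\<in>{0..s}. \<exists>t\<in>{0..s}. f (u + s *\<^sub>R v + s *\<^sub>R w) - f (u + s *\<^sub>R v) - f (u + s *\<^sub>R w) + f u
    = s * s * frechet_derivative (\<lambda>y. frechet_derivative f (at y) v) (at (u + r *\<^sub>R v + t *\<^sub>R w)) w"
proof -
  let ?D = "\<lambda>y. frechet_derivative f (at y)"
  have f: "(f has_derivative ?D y) (at y)" if "y \<in> S" for y
    using C2 that by (intro Ck_on_has_derivative[of 1]) (simp_all add: numeral_2_eq_2)
  have D: "((\<lambda>y. ?D y v) has_derivative frechet_derivative (\<lambda>y. ?D y v) (at y)) (at y)" if "y \<in> S" for y
    using C2 that by (intro Ck_on_has_derivative[of 0]) (simp_all add: numeral_2_eq_2)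
  let ?F = "\<lambda>r. f ((u + s *\<^sub>R w) + r *\<^sub>R v) - f (u + r *\<^sub>R v)"
  have "\<exists>r\<in>{0<..<s}. ?F s - ?F 0 = (s - 0) *\<^sub>R ?D ((u + s *\<^sub>R w) + r *\<^sub>R v) v - (s - 0) *\<^sub>R ?D (u + r *\<^sub>R v) v"
  proof (rule mvt_simple[OF s, of ?F "\<lambda>r h. h *\<^sub>R ?D ((u + s *\<^sub>R w) + r *\<^sub>R v) v - h *\<^sub>R ?D (u + r *\<^sub>R v) v"])
    fix r assume r: "0 \<le> r" "r \<le> s"
    have "u + s *\<^sub>R w + r *\<^sub>R v \<in> S" "u + r *\<^sub>R v \<in> S"
      using S[of r s] S[of r 0] r s by (simp_all add: add_ac)
    then show "(?F has_derivative (\<lambda>h. h *\<^sub>R ?D ((u + s *\<^sub>R w) + r *\<^sub>R v) v - h *\<^sub>R ?D (u + r *\<^sub>R v) v)) (at r within {0..s})"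
      by (intro has_derivative_diff has_derivative_along_line f)
  qed
  then obtain r where r: "r \<in> {0<..<s}" "?F s - ?F 0 = s * (?D ((u + r *\<^sub>R v) + s *\<^sub>R w) v - ?D ((u + r *\<^sub>R v) + 0 *\<^sub>R w) v)"
    by (auto simp: algebra_simps)
  let ?G = "\<lambda>t. ?D ((u + r *\<^sub>R v) + t *\<^sub>R w) v"
  have "\<exists>t\<in>{0<..<s}. ?G s - ?G 0 = (s - 0) *\<^sub>R frechet_derivative (\<lambda>y. ?D y v) (at ((u + r *\<^sub>R v) + t *\<^sub>R w)) w"
  proof (rule mvt_simple[OF s, of ?G "\<lambda>t h. h *\<^sub>R frechet_derivative (\<lambda>y. ?D y v) (at ((u + r *\<^sub>R v) + t *\<^sub>R w)) w"])
    fix t assume t: "0 \<le> t" "t \<le> s"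
    show "(?G has_derivative (\<lambda>h. h *\<^sub>R frechet_derivative (\<lambda>y. ?D y v) (at ((u + r *\<^sub>R v) + t *\<^sub>R w)) w)) (at t within {0..s})"
      by (rule has_derivative_along_line[OF D]) (use S r t in auto)
  qed
  then obtain t where t: "t \<in> {0<..<s}" "?G s - ?G 0 = s * frechet_derivative (\<lambda>y. ?D y v) (at ((u + r *\<^sub>R v) + t *\<^sub>R w)) w"
    by auto
  have "f (u + s *\<^sub>R v + s *\<^sub>R w) - f (u + s *\<^sub>R v) - f (u + s *\<^sub>R w) + f u = ?F s - ?F 0"
    by (simp add: algebra_simps)
  also have "\<dots> = s * (?G s - ?G 0)" using r by simp
  also have "\<dots> = s * s * frechet_derivative (\<lambda>y. ?D y v) (at (u + r *\<^sub>R v + t *\<^sub>R w)) w"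
    using t by simp
  finally show ?thesis using r(1) t(1) by (meson atLeastAtMost_iff greaterThanLessThan_iff less_imp_le)
qed

lemma symmetric_second_derivative_real:
  fixes f :: "'a::euclidean_space \<Rightarrow> real"
  assumes "open S" and C2: "Ck_on 2 S f" and "u \<in> S"
  shows "frechet_derivative (\<lambda>y. frechet_derivative f (at y) v) (at u) w
       = frechet_derivative (\<lambda>y. frechet_derivative f (at y) w) (at u) v"
proof -
  let ?D2 = "\<lambda>v w y. frechet_derivative (\<lambda>y. frechet_derivative f (at y) v) (at y) w"
  have cont: "continuous (at u) (?D2 v w)" for v w
  proof -
    have "Ck_on 0 S (?D2 v w)" using C2 by (simp add: numeral_2_eq_2)
    then show ?thesis using assms by (simp add: continuous_on_eq_continuous_at)
  qed
  define F where "F s = (f (u + s *\<^sub>R v + s *\<^sub>R w) - f (u + s *\<^sub>R v) - f (u + s *\<^sub>R w) + f u) / (s * s)" for s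
  \<comment> \<open>Stated for free v, w and F, since it is used twice with v and w
    exchanged.\<close>
  have main: "(F \<longlongrightarrow> ?D2 v w u) (at_right 0)"
    if F: "\<And>s. F s = (f (u + s *\<^sub>R v + s *\<^sub>R w) - f (u + s *\<^sub>R v) - f (u + s *\<^sub>R w) + f u) / (s * s)"
    for v w F
  proof (rule tendstoI)
    fix e :: real assume "e > 0"
    then obtain d where d: "d > 0" "\<And>y. dist y u < d \<Longrightarrow> dist (?D2 v w y) (?D2 v w u) < e"
      using cont[of v w] unfolding continuous_at_eps_delta dist_norm by blast
    obtain d' where d': "d' > 0" "ball u d' \<subseteq> S" using assms openE by blast
    \<comment> \<open>For s < m the whole parallelogram lies in both balls; the summand 1 keeps the
      denominator positive when v and w vanish.\<close>
    define m where "m = min d d' / (norm v + norm w + 1)"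
    have m: "m > 0" using d d' by (auto simp: m_def intro!: divide_pos_pos add_nonneg_pos)
    have near: "dist (u + r *\<^sub>R v + t *\<^sub>R w) u < min d d'" if "s < m" "r \<in> {0..s}" "t \<in> {0..s}" for r s t
    proof -
      have "norm (r *\<^sub>R v + t *\<^sub>R w) \<le> r * norm v + t * norm w"
        using that norm_triangle_ineq[of "r *\<^sub>R v" "t *\<^sub>R w"] by simp
      also have "\<dots> \<le> s * norm v + s * norm w"
        using that by (intro add_mono mult_right_mono) auto
      also have "\<dots> \<le> s * (norm v + norm w + 1)" using that by (simp add: algebra_simps)
      also have "\<dots> < m * (norm v + norm w + 1)" using that by (intro mult_strict_right_mono add_nonneg_pos) auto
      also have "\<dots> = min d d'" by (simp add: m_def add_nonneg_eq_0_iff)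
      finally show ?thesis by (simp add: dist_norm add.assoc)
    qed
    have "dist (F s) (?D2 v w u) < e" if s: "0 < s" "s < m" for s
    proof -
      have "\<exists>r\<in>{0..s}. \<exists>t\<in>{0..s}. f (u + s *\<^sub>R v + s *\<^sub>R w) - f (u + s *\<^sub>R v) - f (u + s *\<^sub>R w) + f u
         = s * s * ?D2 v w (u + r *\<^sub>R v + t *\<^sub>R w)"
        by (rule second_difference_mean_value[OF _ C2 s(1)])
          (use near[OF s(2)] d' in \<open>auto simp: dist_commute subset_iff\<close>)
      then obtain r t where rt: "r\<in>{0..s}" "t\<in>{0..s}" "F s = ?D2 v w (u + r *\<^sub>R v + t *\<^sub>R w)"
        unfolding F using s by auto
      then show ?thesis using near[OF s(2) rt(1,2)] d(2) by simp
    qed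
    then show "\<forall>\<^sub>F s in at_right 0. dist (F s) (?D2 v w u) < e"
      using m unfolding eventually_at_right_field by blast
  qed
  have "(F \<longlongrightarrow> ?D2 v w u) (at_right 0)" "(F \<longlongrightarrow> ?D2 w v u) (at_right 0)"
    by (rule main; simp add: F_def algebra_simps)+
  then show ?thesis by (rule tendsto_unique[rotated]) simp
qed

lemma symmetric_second_derivative:
  fixes f :: "'a::euclidean_space \<Rightarrow> 'b::euclidean_space"
  assumes "open S" and sm: "smooth_on S f" and "u \<in> S"
  shows "frechet_derivative (\<lambda>y. frechet_derivative f (at y) v) (at u) w
       = frechet_derivative (\<lambda>y. frechet_derivative f (at y) w) (at u) v"
proof (rule euclidean_eqI)
  fix b :: 'b assume "b \<in> Basis"
  have 1: "frechet_derivative (\<lambda>y. f y \<bullet> b) (at y) = (\<lambda>v. frechet_derivative f (at y) v \<bullet> b)" if "y \<in> S" for y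
    using smooth_on_has_derivative[OF sm that]
    by (intro frechet_derivative_at[symmetric]) (auto intro!: derivative_eq_intros)
  have 2: "frechet_derivative (\<lambda>y. frechet_derivative (\<lambda>y. f y \<bullet> b) (at y) v) (at u) w
      = frechet_derivative (\<lambda>y. frechet_derivative f (at y) v) (at u) w \<bullet> b" for v w
  proof -
    have "((\<lambda>y. frechet_derivative f (at y) v \<bullet> b) has_derivative
      (\<lambda>w. frechet_derivative (\<lambda>y. frechet_derivative f (at y) v) (at u) w \<bullet> b)) (at u)"
      using smooth_on_has_derivative[OF smooth_on_derivative[OF sm] assms(3)]
      by (auto intro!: derivative_eq_intros)
    then have "((\<lambda>y. frechet_derivative (\<lambda>y. f y \<bullet> b) (at y) v) has_derivative
      (\<lambda>w. frechet_derivative (\<lambda>y. frechet_derivative f (at y) v) (at u) w \<bullet> b)) (at u)"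
      by (rule has_derivative_transform_within_open[OF _ assms(1,3)]) (simp add: 1)
    then show ?thesis by (metis frechet_derivative_at)
  qed
  have "Ck_on 2 S (\<lambda>y. f y \<bullet> b)"
    using sm smooth_on_linear[OF assms(1) bounded_linear_inner_left] unfolding smooth_on_def by blast
  from symmetric_second_derivative_real[OF assms(1) this assms(3), of v w]
  show "frechet_derivative (\<lambda>y. frechet_derivative f (at y) v) (at u) w \<bullet> b
    = frechet_derivative (\<lambda>y. frechet_derivative f (at y) w) (at u) v \<bullet> b"
    unfolding 2 .
qed

text \<open>The potential integrates the form along segments from a base point a. Differentiating
  under the integral and using closedness turns the integrand into a total derivative in the segment
  parameter.\<close>

lemma poincare_lemma_convex:
  fixes \<omega> :: "'a::euclidean_space \<Rightarrow> 'a \<Rightarrow> real"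
  assumes "open S" "convex S"
    and lin: "\<And>w. w \<in> S \<Longrightarrow> linear (\<omega> w)"
    and C1: "\<And>v. Ck_on 1 S (\<lambda>w. \<omega> w v)"
    and closed: "\<And>w h v. w \<in> S \<Longrightarrow>
      frechet_derivative (\<lambda>w. \<omega> w v) (at w) h = frechet_derivative (\<lambda>w. \<omega> w h) (at w) v"
  shows "\<exists>g. \<forall>w\<in>S. (g has_derivative \<omega> w) (at w)"
proof (cases "S = {}")
  case False
  then obtain a where a: "a \<in> S" by blast
  define D where "D w v h = frechet_derivative (\<lambda>w. \<omega> w v) (at w) h" for w v h
  have D: "((\<lambda>w. \<omega> w v) has_derivative D w v) (at w)" if "w \<in> S" for w v
    using C1[of v] that unfolding D_def One_nat_def by (rule Ck_on_has_derivative)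
  have Dlin: "linear (D w v)" if "w \<in> S" for w v
    using D[OF that] has_derivative_linear by blast
  have sym: "D w v h = D w h v" if "w \<in> S" for w v h
    using closed[OF that] by (simp add: D_def)
  have Dcont: "continuous_on S (\<lambda>w. D w v h)" for v h
    using C1[of v] by (simp add: D_def)
  have wcont: "continuous_on S (\<lambda>w. \<omega> w v)" for v
    using C1[of v] Ck_on_continuous by blast
  have expand: "L v = (\<Sum>b\<in>Basis. (v \<bullet> b) * L b)" if "linear L" for L :: "'a \<Rightarrow> real" and v
  proof -
    have "L (\<Sum>b\<in>Basis. (v \<bullet> b) *\<^sub>R b) = (\<Sum>b\<in>Basis. (v \<bullet> b) * L b)"
      using that by (simp add: linear_sum linear_scale)
    then show ?thesis by (simp add: euclidean_representation)
  qed
  let ?c = "\<lambda>x t. a + t *\<^sub>R (x - a)"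
  have c: "?c x t \<in> S" if "x \<in> S" "t \<in> {0..1}" for x t
  proof -
    have "(1 - t) *\<^sub>R a + t *\<^sub>R x \<in> S"
      using \<open>convex S\<close> a that by (intro convexD) auto
    then show ?thesis by (simp add: algebra_simps)
  qed
  define f where "f x t = \<omega> (?c x t) (x - a)" for x t
  \<comment> \<open>The derivative of the integrand is packed as a bounded linear function, the
    format that \<open>leibniz_rule\<close> expects.\<close>
  define fx where "fx x t = Blinfun (\<lambda>h. \<omega> (?c x t) h + t * D (?c x t) h (x - a))" for x t
  have fx: "blinfun_apply (fx x t) h = \<omega> (?c x t) h + t * D (?c x t) h (x - a)"
    if "x \<in> S" "t \<in> {0..1}" for x t h
  proof -
    have "linear (\<lambda>h. \<omega> (?c x t) h + t * D (?c x t) (x - a) h)"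
      by (intro linear_compose_add lin c that linear_compose[OF Dlin[OF c[OF that]], unfolded o_def]
          bounded_linear.linear[OF bounded_linear_mult_right])
    then have "bounded_linear (\<lambda>h. \<omega> (?c x t) h + t * D (?c x t) h (x - a))"
      using sym[OF c[OF that]] by (simp add: linear_conv_bounded_linear)
    then show ?thesis unfolding fx_def by (simp add: bounded_linear_Blinfun_apply)
  qed
  have der: "((\<lambda>x. f x t) has_derivative blinfun_apply (fx x t)) (at x within S)"
    if "x \<in> S" "t \<in> cbox 0 1" for x t
  proof -
    have t: "t \<in> {0..1}" using that by simp
    have 1: "((\<lambda>x. \<omega> (?c x t) b) has_derivative (\<lambda>h. D (?c x t) b (t *\<^sub>R h))) (at x within S)" for b
      by (rule has_derivative_compose[where f="\<lambda>x. ?c x t" and x=x and g="\<lambda>w. \<omega> w b", OF _ D[OF c[OF that(1) t]]])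
        (auto intro!: derivative_eq_intros)
    \<comment> \<open>In \<open>f x t\<close> the variable x occurs both in the base point and in
      the vector; expanding over a basis leaves products of scalar functions.\<close>
    have 2: "((\<lambda>x. \<Sum>b\<in>Basis. ((x - a) \<bullet> b) * \<omega> (?c x t) b) has_derivative
      (\<lambda>h. \<Sum>b\<in>Basis. ((x - a) \<bullet> b) * D (?c x t) b (t *\<^sub>R h) + (h \<bullet> b) * \<omega> (?c x t) b)) (at x within S)"
      by (intro has_derivative_sum has_derivative_mult 1) (auto intro!: derivative_eq_intros)
    have 3: "(\<Sum>b\<in>Basis. ((x - a) \<bullet> b) * D (?c x t) b (t *\<^sub>R h) + (h \<bullet> b) * \<omega> (?c x t) b)
      = blinfun_apply (fx x t) h" for h
    proof -
      have "D (?c x t) b (t *\<^sub>R h) = t * D (?c x t) h b" for b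
        using linear_scale[OF Dlin[OF c[OF that(1) t]]] sym[OF c[OF that(1) t], of b h] by simp
      then show ?thesis
        using expand[OF Dlin[OF c[OF that(1) t]], of h "x - a"] expand[OF lin[OF c[OF that(1) t]], of h]
        by (simp add: fx[OF that(1) t] sum.distrib sum_distrib_left mult_ac)
    qed
    show ?thesis
      by (rule has_derivative_transform[OF that(1) _ 2[unfolded 3]])
        (use expand[OF lin[OF c[OF _ t]]] in \<open>simp add: f_def\<close>)
  qed
  have ccont: "continuous_on (S \<times> {0..1}) (\<lambda>z. ?c (fst z) (snd z))"
    by (auto intro!: continuous_intros)
  have cim: "(\<lambda>z. ?c (fst z) (snd z)) ` (S \<times> {0..1}) \<subseteq> S" using c by auto
  have fxcont: "continuous_on (S \<times> cbox 0 1) (\<lambda>(x, t). fx x t)"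
  proof (rule continuous_on_blinfun_componentwise)
    fix i :: 'a assume "i \<in> Basis"
    have "continuous_on (S \<times> {0..1}) (\<lambda>z. \<omega> (?c (fst z) (snd z)) i
        + snd z * (\<Sum>b\<in>Basis. ((fst z - a) \<bullet> b) * D (?c (fst z) (snd z)) i b))"
      by (intro continuous_intros continuous_on_compose2[OF wcont ccont cim]
          continuous_on_compose2[OF Dcont ccont cim])
    then show "continuous_on (S \<times> cbox 0 1) (\<lambda>x. blinfun_apply (case x of (x, t) \<Rightarrow> fx x t) i)"
      unfolding box_real
      by (rule continuous_on_eq) (auto simp: fx expand[OF Dlin[OF c], symmetric])
  qed
  have fint: "f x integrable_on cbox 0 1" if "x \<in> S" for x
  proof -
    have "continuous_on {0..1} (\<lambda>t. ?c x t)" by (auto intro!: continuous_intros)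
    then have "continuous_on {0..1} (f x)" unfolding f_def
      by (rule continuous_on_compose2[OF wcont]) (use c[OF that] in auto)
    then show ?thesis unfolding box_real by (rule integrable_continuous_real)
  qed
  have "((\<lambda>x. integral (cbox 0 1) (f x)) has_derivative \<omega> x) (at x)" if x: "x \<in> S" for x
  proof -
    have "blinfun_apply (integral (cbox 0 1) (fx x)) = \<omega> x"
    proof
      fix h
      have "continuous_on (cbox 0 1) (fx x)"
      proof -
        have "continuous_on (cbox 0 1) (\<lambda>t::real. (x, t))" by (intro continuous_intros)
        from continuous_on_compose2[OF fxcont this] x show ?thesis by auto
      qed
      then have "fx x integrable_on cbox 0 1" by (rule integrable_continuous)
      then have "blinfun_apply (integral (cbox 0 1) (fx x)) h = integral (cbox 0 1) (\<lambda>t. blinfun_apply (fx x t) h)"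
        using integral_linear[of "fx x" "cbox 0 1" "\<lambda>l. blinfun_apply l h"]
        by (simp add: o_def blinfun.bounded_linear_left)
      also have "\<dots> = integral {0..1} (\<lambda>t. \<omega> (?c x t) h + t * D (?c x t) h (x - a))"
        unfolding box_real by (rule integral_cong) (simp add: fx[OF x])
      \<comment> \<open>The integrand is the derivative in t of t \<omega>(a + t (x - a)) h.\<close>
      also have "\<dots> = 1 * \<omega> (?c x 1) h - 0 * \<omega> (?c x 0) h"
      proof (rule integral_unique, rule fundamental_theorem_of_calculus)
        fix t :: real assume t: "t \<in> {0..1}"
        have "((\<lambda>t. \<omega> (?c x t) h) has_derivative (\<lambda>s. s *\<^sub>R D (?c x t) h (x - a))) (at t within {0..1})"
          by (rule has_derivative_along_line[OF D[OF c[OF x t]]])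
        then have "((\<lambda>t. t * \<omega> (?c x t) h) has_derivative
            (\<lambda>s. t * (s *\<^sub>R D (?c x t) h (x - a)) + s * \<omega> (?c x t) h)) (at t within {0..1})"
          by (intro has_derivative_mult has_derivative_ident)
        then show "((\<lambda>t. t * \<omega> (?c x t) h) has_vector_derivative
            \<omega> (?c x t) h + t * D (?c x t) h (x - a)) (at t within {0..1})"
          unfolding has_vector_derivative_def by (simp add: algebra_simps)
      qed simp
      finally show "blinfun_apply (integral (cbox 0 1) (fx x)) h = \<omega> x h" by simp
    qed
    moreover have "((\<lambda>x. integral (cbox 0 1) (f x)) has_derivative
        blinfun_apply (integral (cbox 0 1) (fx x))) (at x within S)"
      by (rule leibniz_rule[OF der fint fxcont x \<open>convex S\<close>])
    ultimately show ?thesis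
      by (simp add: at_within_open[OF x \<open>open S\<close>])
  qed
  then show ?thesis by blast
qed auto


section \<open>Charts, tangent vectors and differentials\<close>

locale surface =
  fixes A :: "('a::{t2_space,second_countable_topology}) chart set"
  assumes surf: "oriented_surface A"
begin

lemma chart_homeomorphism:
  assumes "c \<in> A"
  shows "open (fst c)" "open (snd c ` fst c)"
    "homeomorphism (fst c) (snd c ` fst c) (snd c) (chart_inv c)"
  using surf assms by (auto simp: oriented_surface_def is_chart_def)

lemma chart_inv_snd: "c \<in> A \<Longrightarrow> p \<in> fst c \<Longrightarrow> chart_inv c (snd c p) = p"
  using chart_homeomorphism(3) by (rule homeomorphism_apply1)

lemma snd_chart_inv: "c \<in> A \<Longrightarrow> u \<in> snd c ` fst c \<Longrightarrow> snd c (chart_inv c u) = u"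
  using chart_homeomorphism(3) by (rule homeomorphism_apply2)

lemma chart_inv_in: "c \<in> A \<Longrightarrow> u \<in> snd c ` fst c \<Longrightarrow> chart_inv c u \<in> fst c"
  by (metis chart_inv_snd imageE)

lemma chart_at_in: "chart_at A p \<in> A" "p \<in> fst (chart_at A p)"
proof -
  have "\<exists>c. c \<in> A \<and> p \<in> fst c" using surf UN_iff[of p fst A] by (auto simp: oriented_surface_def)
  then have "chart_at A p \<in> A \<and> p \<in> fst (chart_at A p)"
    unfolding chart_at_def by (rule someI_ex)
  then show "chart_at A p \<in> A" "p \<in> fst (chart_at A p)" by auto
qed

lemma open_chart_overlap:
  assumes "c \<in> A" "d \<in> A" shows "open (snd c ` (fst c \<inter> fst d))"
proof -
  have "snd c ` (fst c \<inter> fst d) = snd c ` fst c \<inter> chart_inv c -` fst d"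
    using assms(1) chart_inv_snd[OF assms(1)] by auto
  then show ?thesis
    using chart_homeomorphism(2,3)[OF assms(1)] chart_homeomorphism(1)[OF assms(2)]
    by (metis continuous_on_open_vimage homeomorphism_def inf_commute)
qed

abbreviation "trD c d p \<equiv> frechet_derivative (transition c d) (at (snd c p))"

lemma transition_has_derivative:
  assumes "c \<in> A" "d \<in> A" "p \<in> fst c" "p \<in> fst d"
  shows "(transition c d has_derivative trD c d p) (at (snd c p))"
proof -
  have "smooth_on (snd c ` (fst c \<inter> fst d)) (transition c d)"
    using surf assms by (auto simp: oriented_surface_def)
  then show ?thesis by (rule smooth_on_has_derivative) (use assms in auto)
qed

lemma transition_cocycle:
  assumes "c \<in> A" "d \<in> A" "e \<in> A" "p \<in> fst c" "p \<in> fst d" "p \<in> fst e"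
  shows "trD d e p (trD c d p v) = trD c e p v"
proof -
  have "transition c d (snd c p) = snd d p"
    using chart_inv_snd assms by (simp add: transition_def)
  then have "((\<lambda>u. transition d e (transition c d u)) has_derivative (\<lambda>v. trD d e p (trD c d p v))) (at (snd c p))"
    using has_derivative_compose[OF transition_has_derivative[OF assms(1,2,4,5)], of "transition d e"]
      transition_has_derivative[OF assms(2,3,5,6)] by simp
  then have "(transition c e has_derivative (\<lambda>v. trD d e p (trD c d p v))) (at (snd c p))"
    by (rule has_derivative_transform_within_open[OF _ open_chart_overlap[OF assms(1,2)]])
      (use assms in \<open>auto simp: transition_def chart_inv_snd[OF assms(1)] chart_inv_snd[OF assms(2)]\<close>)
  then show ?thesis by (metis frechet_derivative_at)
qed

lemma transition_refl:
  assumes "c \<in> A" "p \<in> fst c" shows "trD c c p v = v"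
proof -
  have "((\<lambda>u. u) has_derivative (\<lambda>v. v)) (at (snd c p))" by simp
  then have "(transition c c has_derivative (\<lambda>v. v)) (at (snd c p))"
    by (rule has_derivative_transform_within_open[OF _ chart_homeomorphism(2)[OF assms(1)]])
      (use assms snd_chart_inv in \<open>auto simp: transition_def chart_inv_snd\<close>)
  then show ?thesis by (metis frechet_derivative_at)
qed

lemma coord_vec_tangent:
  assumes "c \<in> A" "p \<in> fst c" shows "coord_vec A c p v \<in> tangent A p"
  using transition_cocycle[OF assms(1) _ _ assms(2)] by (auto simp: tangent_def coord_vec_def)

lemma coord_vec_self:
  assumes "c \<in> A" "p \<in> fst c" shows "coord_vec A c p v c = v"
  using assms transition_refl by (simp add: coord_vec_def)

lemma tangent_transform:
  assumes "c \<in> A" "d \<in> A" "p \<in> fst c" "p \<in> fst d" "U \<in> tangent A p"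
  shows "U d = trD c d p (U c)"
  using assms unfolding tangent_def by blast

lemma tangent_coord_vec:
  assumes "c \<in> A" "p \<in> fst c" "U \<in> tangent A p" shows "coord_vec A c p (U c) = U"
proof
  show "coord_vec A c p (U c) d = U d" for d
  proof (cases "d \<in> A \<and> p \<in> fst d")
    case True
    with tangent_transform[OF assms(1) _ assms(2) _ assms(3), of d] show ?thesis
      by (simp add: coord_vec_def)
  next
    case False
    moreover from this assms(3) have "U d = 0" unfolding tangent_def by blast
    ultimately show ?thesis unfolding coord_vec_def by argo
  qed
qed

lemma tangent_eqI:
  assumes "c \<in> A" "p \<in> fst c" "U \<in> tangent A p" "V \<in> tangent A p" "U c = V c"
  shows "U = V"
  by (metis assms tangent_coord_vec)

section \<open>Differentials of smooth maps and equality of de Rham classes\<close>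

lemma smooth_map_chart:
  "smooth_map A f \<Longrightarrow> c \<in> A \<Longrightarrow> smooth_on (snd c ` fst c) (\<lambda>u. f (chart_inv c u))"
  by (simp add: smooth_map_def o_def)

lemma smooth_map_has_derivative:
  "smooth_map A f \<Longrightarrow> c \<in> A \<Longrightarrow> p \<in> fst c \<Longrightarrow>
    ((\<lambda>u. f (chart_inv c u)) has_derivative frechet_derivative (\<lambda>u. f (chart_inv c u)) (at (snd c p))) (at (snd c p))"
  by (rule smooth_on_has_derivative[OF smooth_map_chart]) auto

text \<open>\<open>differential\<close> uses the arbitrary chart \<open>chart_at\<close>. The chain
  rule through the transition map, together with the transformation law of tangent vectors, allows
  any chart instead.\<close>

lemma differential_eqI:
  assumes f: "((\<lambda>u. f (chart_inv c u)) has_derivative f') (at (snd c p))"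
    and c: "c \<in> A" "p \<in> fst c" and U: "U \<in> tangent A p"
  shows "differential A f p U = f' (U c)"
proof -
  let ?d = "chart_at A p"
  note d = chart_at_in[of p]
  have p: "transition ?d c (snd ?d p) = snd c p"
    using chart_inv_snd d by (simp add: transition_def)
  have "((\<lambda>u. f (chart_inv c (transition ?d c u))) has_derivative (\<lambda>v. f' (trD ?d c p v))) (at (snd ?d p))"
    by (rule has_derivative_compose[OF transition_has_derivative[OF d(1) c(1) d(2) c(2)]])
      (use f p in simp)
  then have "(f \<circ> chart_inv ?d has_derivative (\<lambda>v. f' (trD ?d c p v))) (at (snd ?d p))"
    by (rule has_derivative_transform_within_open[OF _ open_chart_overlap[OF d(1) c(1)]])
      (use c d in \<open>auto simp: transition_def chart_inv_snd[OF c(1)] chart_inv_snd[OF d(1)]\<close>)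
  then have "differential A f p U = f' (trD ?d c p (U ?d))"
    unfolding differential_def by (metis frechet_derivative_at)
  also have "trD ?d c p (U ?d) = U c" by (rule tangent_transform[OF d(1) c(1) d(2) c(2) U, symmetric])
  finally show ?thesis .
qed

lemma differential_chart:
  assumes "smooth_map A f" "c \<in> A" "p \<in> fst c" "U \<in> tangent A p"
  shows "differential A f p U = frechet_derivative (\<lambda>u. f (chart_inv c u)) (at (snd c p)) (U c)"
  by (rule differential_eqI[OF smooth_map_has_derivative]) (use assms in auto)

lemma differential_add:
  assumes "smooth_map A f" "smooth_map A g" "U \<in> tangent A p"
  shows "differential A (\<lambda>p. f p + g p) p U = differential A f p U + differential A g p U"
  using assms chart_at_in[of p]
  by (subst differential_eqI[OF has_derivative_add[OF smooth_map_has_derivative[OF assms(1)] smooth_map_has_derivative[OF assms(2)]]])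
    (auto simp: differential_chart)

lemma differential_linear:
  assumes "smooth_map A f" "bounded_linear L" "U \<in> tangent A p"
  shows "differential A (\<lambda>p. L (f p)) p U = L (differential A f p U)"
  using assms chart_at_in[of p]
  by (subst differential_eqI[OF bounded_linear.has_derivative[OF assms(2) smooth_map_has_derivative[OF assms(1)]]])
    (auto simp: differential_chart)

lemma smooth_map_add:
  "smooth_map A f \<Longrightarrow> smooth_map A g \<Longrightarrow> smooth_map A (\<lambda>p. f p + g p)"
  unfolding smooth_map_def o_def using smooth_on_add chart_homeomorphism(2) by blast

lemma smooth_map_linear:
  "smooth_map A f \<Longrightarrow> bounded_linear L \<Longrightarrow> smooth_map A (\<lambda>p. L (f p))"
  unfolding smooth_map_def o_def using smooth_on_linear chart_homeomorphism(2) by blast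

text \<open>Classes are sets of forms: a correction f for one representative becomes g + f for the
  other, and conversely f - g.\<close>

lemma dR_class_eqI:
  assumes g: "smooth_map A g"
    and eq: "\<And>p U. U \<in> tangent A p \<Longrightarrow> \<omega>' p U = \<omega> p U + differential A g p U"
  shows "dR_class A \<omega>' = dR_class A \<omega>"
proof -
  have m: "smooth_map A (\<lambda>p. - g p)" using smooth_map_linear[OF g bounded_linear_minus[OF bounded_linear_ident]] .
  have dm: "differential A (\<lambda>p. - g p) p U = - differential A g p U" if "U \<in> tangent A p" for p U
    using differential_linear[OF g bounded_linear_minus[OF bounded_linear_ident] that] .
  have "\<sigma> \<in> dR_class A \<omega>" if \<sigma>: "\<sigma> \<in> dR_class A \<omega>'" for \<sigma>
  proof -
    obtain f where "smooth_map A f" "\<And>p U. U \<in> tangent A p \<Longrightarrow> \<sigma> p U = \<omega>' p U + differential A f p U"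
      using \<sigma> unfolding dR_class_def by blast
    then have "smooth_map A (\<lambda>p. g p + f p)"
      "\<And>p U. U \<in> tangent A p \<Longrightarrow> \<sigma> p U = \<omega> p U + differential A (\<lambda>p. g p + f p) p U"
      using smooth_map_add[OF g] differential_add[OF g] eq by (auto simp: add.assoc)
    then show ?thesis unfolding dR_class_def by blast
  qed
  moreover have "\<sigma> \<in> dR_class A \<omega>'" if \<sigma>: "\<sigma> \<in> dR_class A \<omega>" for \<sigma>
  proof -
    obtain f where "smooth_map A f" "\<And>p U. U \<in> tangent A p \<Longrightarrow> \<sigma> p U = \<omega> p U + differential A f p U"
      using \<sigma> unfolding dR_class_def by blast
    then have "smooth_map A (\<lambda>p. - g p + f p)"
      "\<And>p U. U \<in> tangent A p \<Longrightarrow> \<sigma> p U = \<omega>' p U + differential A (\<lambda>p. - g p + f p) p U"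
      using smooth_map_add[OF m] differential_add[OF m] eq dm by auto
    then show ?thesis unfolding dR_class_def by blast
  qed
  ultimately show ?thesis by blast
qed

lemma dR_class_self:
  fixes \<omega> :: "('a, 'b::real_normed_vector) form1"
  shows "\<omega> \<in> dR_class A \<omega>"
proof -
  have "smooth_map A (\<lambda>p. 0 :: 'b)" by (simp add: smooth_map_def o_def smooth_on_const)
  moreover have "differential A (\<lambda>p. 0 :: 'b) p U = 0" for p U
    by (simp add: differential_def o_def)
  ultimately show ?thesis unfolding dR_class_def by (intro CollectI exI[of _ "\<lambda>p. 0"]) simp
qed

text \<open>Transition maps have positive Jacobian determinant, so the sign seen in
  \<open>chart_at\<close> is the sign seen in every chart.\<close>

lemma orient_sgn_chart:
  assumes c: "c \<in> A" "p \<in> fst c" and UV: "U \<in> tangent A p" "V \<in> tangent A p"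
  shows "orient_sgn A p U V = sgn (det (vector [U c, V c]))"
proof -
  let ?d = "chart_at A p"
  note d = chart_at_in[of p]
  have lin: "linear (trD ?d c p)"
    using transition_has_derivative[OF d(1) c(1) d(2) c(2)] has_derivative_linear by blast
  have pos: "det (matrix (trD ?d c p)) > 0"
    using surf c d unfolding oriented_surface_def by blast
  have "U c = matrix (trD ?d c p) *v U ?d" "V c = matrix (trD ?d c p) *v V ?d"
    using tangent_transform[OF d(1) c(1) d(2) c(2)] UV fun_cong[OF matrix_vector_mul(2)[OF lin]] by auto
  moreover have "det (vector [M *v a, M *v b]) = det M * det (vector [a, b])" for M :: "real^2^2" and a b
    by (simp add: det_2 matrix_vector_mult_def sum_2 algebra_simps)
  ultimately show ?thesis using pos
    unfolding orient_sgn_def by (simp add: sgn_mult)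
qed

end


section \<open>Lorentz geometry and volume forms\<close>

lemma bounded_bilinear_lor: "bounded_bilinear lor"
  unfolding bilinear_conv_bounded_bilinear[symmetric] bilinear_def
  by (auto intro!: linearI simp: lor_def algebra_simps sum.distrib sum_distrib_left)

interpretation lor: bounded_bilinear lor by (rule bounded_bilinear_lor)

lemma lor_commute: "lor v w = lor w v"
  by (simp add: lor_def mult_ac)

lemma lor_eq_0: "(\<And>w. lor v w = 0) \<Longrightarrow> v = 0"
proof -
  assume "\<And>w. lor v w = 0"
  then have "v $ i = 0" for i using lor_axis[of v i] by (simp add: sig_def split: if_splits)
  then show "v = 0" by (simp add: vec_eq_iff)
qed

lemma lor_dual:
  fixes f :: "real^5 \<Rightarrow> real"
  assumes "linear f" shows "lor (\<chi> i. sig i * f (axis i 1)) v = f v"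
proof -
  have "f v = f (\<Sum>k\<in>UNIV. v $ k *\<^sub>R axis k 1)"
    by (simp add: basis_expansion scalar_mult_eq_scaleR[symmetric])
  also have "\<dots> = (\<Sum>k\<in>UNIV. v $ k * f (axis k 1))"
    by (simp add: linear_sum[OF assms] linear_scale[OF assms])
  finally show ?thesis
    unfolding lor_def by (auto simp: sig_def mult_ac intro!: sum.cong)
qed

lemma UNIV_5: "(UNIV :: 5 set) = {1, 2, 3, 4, 5}"
  using exhaust_5 by auto

lemma sum_5: "sum f (UNIV :: 5 set) = f 1 + f 2 + f 3 + f 4 + (f 5 :: 'b::comm_monoid_add)"
  unfolding UNIV_5 by (simp add: add.assoc)

text \<open>Subtracting the multiple of y that cancels the last coordinate of v does not change (v,
  v), since y is null and orthogonal to v. What remains is purely spacelike, so (v, v) is a sum of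
  squares.\<close>

lemma lor_null_orthogonal:
  assumes y: "lor y y = 0" "y \<noteq> 0" and v: "lor v y = 0"
  shows "lor v v \<ge> 0" and "lor v v = 0 \<Longrightarrow> \<exists>t. v = t *\<^sub>R y"
proof -
  let ?I = "{1,2,3,4::5}"
  have e: "lor a b = (\<Sum>i\<in>?I. a $ i * b $ i) - a $ 5 * b $ 5" for a b
    unfolding lor_def sum_5 by (simp add: sig_def)
  have yy: "(\<Sum>i\<in>?I. (y $ i)\<^sup>2) = (y $ 5)\<^sup>2" using y(1) by (simp add: e power2_eq_square)
  have y5: "y $ 5 \<noteq> 0"
  proof
    assume "y $ 5 = 0"
    then have "(\<Sum>i\<in>?I. (y $ i)\<^sup>2) = 0" using yy by simp
    then have "\<forall>i\<in>?I. y $ i = 0" by (subst (asm) sum_nonneg_eq_0_iff) auto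
    then have "y = 0" using \<open>y $ 5 = 0\<close> by (simp add: vec_eq_iff forall_5)
    then show False using y(2) by simp
  qed
  have key: "(y $ 5)\<^sup>2 * lor v v = (\<Sum>i\<in>?I. (y $ 5 * v $ i - v $ 5 * y $ i)\<^sup>2)"
  proof -
    have "(\<Sum>i\<in>?I. (y $ 5 * v $ i - v $ 5 * y $ i)\<^sup>2)
      = (y $ 5)\<^sup>2 * (\<Sum>i\<in>?I. v $ i * v $ i) - 2 * y $ 5 * v $ 5 * (\<Sum>i\<in>?I. v $ i * y $ i)
        + (v $ 5)\<^sup>2 * (\<Sum>i\<in>?I. (y $ i)\<^sup>2)"
      by (simp add: algebra_simps power2_eq_square)
    also have "(\<Sum>i\<in>?I. v $ i * y $ i) = v $ 5 * y $ 5" using v by (simp add: e)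
    finally show ?thesis unfolding yy by (simp add: e algebra_simps power2_eq_square)
  qed
  then have "(y $ 5)\<^sup>2 * lor v v \<ge> 0" by (simp add: sum_nonneg)
  then show "lor v v \<ge> 0" using y5 by (simp add: zero_le_mult_iff)
  show "\<exists>t. v = t *\<^sub>R y" if "lor v v = 0"
  proof -
    have "(\<Sum>i\<in>?I. (y $ 5 * v $ i - v $ 5 * y $ i)\<^sup>2) = 0" using key that by simp
    then have "\<forall>i\<in>?I. (y $ 5 * v $ i - v $ 5 * y $ i)\<^sup>2 = 0" by (subst (asm) sum_nonneg_eq_0_iff) auto
    then have "v = (v $ 5 / y $ 5) *\<^sub>R y" using y5 by (auto simp: vec_eq_iff forall_5 field_simps)
    then show ?thesis by blast
  qed
qed

lemma space_formD:
  assumes "y \<in> space_form \<qq>" shows "lor y y = 0" "lor y \<qq> = -1" "lor \<qq> y = -1" "y \<noteq> 0"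
proof -
  show "lor y y = 0" "lor y \<qq> = -1" using assms by (simp_all add: space_form_def E_plane_def)
  then show "lor \<qq> y = -1" "y \<noteq> 0" using lor_commute[of y \<qq>] by (auto simp: lor.zero_left)
qed

lemma tangent_M_commute:
  assumes "v \<in> tangent_M \<qq> y" shows "lor v y = 0" "lor y v = 0" "lor v \<qq> = 0" "lor \<qq> v = 0"
  using assms lor_commute[of v] by (simp_all add: tangent_M_def)

lemma tangent_M_add: "v \<in> tangent_M \<qq> y \<Longrightarrow> w \<in> tangent_M \<qq> y \<Longrightarrow> v + w \<in> tangent_M \<qq> y"
  and tangent_M_diff: "v \<in> tangent_M \<qq> y \<Longrightarrow> w \<in> tangent_M \<qq> y \<Longrightarrow> v - w \<in> tangent_M \<qq> y"
  and tangent_M_scaleR: "v \<in> tangent_M \<qq> y \<Longrightarrow> r *\<^sub>R v \<in> tangent_M \<qq> y"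
  by (auto simp: tangent_M_def lor.add_left lor.diff_left lor.scaleR_left)

text \<open>The only degenerate direction in the orthogonal complement of y is y itself, and
  orthogonality to \<qq> excludes it because (y, \<qq>) = -1.\<close>

lemma tangent_M_pos:
  assumes "y \<in> space_form \<qq>" "v \<in> tangent_M \<qq> y"
  shows "lor v v \<ge> 0" "lor v v = 0 \<longleftrightarrow> v = 0"
proof -
  note y = space_formD[OF assms(1)] and v = tangent_M_commute[OF assms(2)]
  show "lor v v \<ge> 0" using lor_null_orthogonal(1)[OF y(1,4) v(1)] .
  show "lor v v = 0 \<longleftrightarrow> v = 0"
  proof
    assume "lor v v = 0"
    then obtain t where "v = t *\<^sub>R y" using lor_null_orthogonal(2)[OF y(1,4) v(1)] by blast
    then show "v = 0" using v(3) y(2) by (simp add: lor.scaleR_left)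
  qed (simp add: lor.zero_left)
qed

lemma lor_mult_vec_skew:
  assumes "Y \<in> so41" shows "lor (Y *v v) w = - lor (Y *v w) v" "lor (Y *v v) v = 0"
proof -
  have *: "lor (Y *v v) w + lor v (Y *v w) = 0" for v w using assms by (simp add: so41_def)
  show "lor (Y *v v) w = - lor (Y *v w) v" using *[of v w] lor_commute[of v "Y *v w"] by linarith
  show "lor (Y *v v) v = 0" using *[of v v] lor_commute[of v "Y *v v"] by linarith
qed

lemma conf_field_tangent:
  assumes "y \<in> space_form \<qq>" "Y \<in> so41" shows "conf_field \<qq> Y y \<in> tangent_M \<qq> y"
  using space_formD(1,2)[OF assms(1)] lor_mult_vec_skew(2)[OF assms(2), of y]
  by (simp add: tangent_M_def conf_field_def lor.diff_left lor.minus_left lor.scaleR_left)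

lemma conf_field_killing:
  assumes "Y \<in> killing \<qq>" shows "conf_field \<qq> Y y = - (Y *v y)"
proof -
  have "lor (Y *v y) \<qq> = 0"
    using assms lor_mult_vec_skew(1)[of Y y \<qq>] by (simp add: killing_def lor.zero_left)
  then show ?thesis by (simp add: conf_field_def)
qed

lemma wedge_mult: "wedge a b *v c = lor a c *\<^sub>R b - lor b c *\<^sub>R a"
proof -
  have "linear (\<lambda>c. lor a c *\<^sub>R b - lor b c *\<^sub>R a)"
    by (auto intro!: linearI simp: lor.add_right lor.scaleR_right algebra_simps)
  from fun_cong[OF matrix_vector_mul(2)[OF this], of c] show ?thesis by (simp add: wedge_def)
qed

lemma wedge_so41: "wedge a b \<in> so41"
  by (simp add: so41_def wedge_mult lor.diff_left lor.diff_right lor.scaleR_left lor.scaleR_right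
      lor_commute mult_ac)

lemma bounded_bilinear_wedge: "bounded_bilinear wedge"
  unfolding bilinear_conv_bounded_bilinear[symmetric] bilinear_def
  by (auto intro!: linearI simp: vec_eq_iff wedge_nth algebra_simps)

interpretation wedge: bounded_bilinear wedge by (rule bounded_bilinear_wedge)

lemma wedge_self: "wedge a a = 0"
  by (simp add: vec_eq_iff wedge_nth)

lemma wedge_swap: "wedge b a = - wedge a b"
  by (simp add: vec_eq_iff wedge_nth algebra_simps)

text \<open>The two terms of the wedge contribute equally to the trace because Y is skew; the half
  in \<open>pairing_g\<close> leaves one of them.\<close>

lemma pairing_g_wedge:
  assumes "Y \<in> so41" shows "pairing_g (wedge a b) Y = lor a (Y *v b)"
proof -
  have "trace (wedge a b ** Y) = (\<Sum>j\<in>UNIV. \<Sum>i\<in>UNIV. sig i * a $ i * (Y $ i $ j * b $ j))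
      - (\<Sum>j\<in>UNIV. \<Sum>i\<in>UNIV. sig i * b $ i * (Y $ i $ j * a $ j))"
    unfolding trace_def matrix_matrix_mult_def sum_subtractf[symmetric]
    by (simp add: wedge_nth algebra_simps)
  also have "\<dots> = lor a (Y *v b) - lor b (Y *v a)"
    unfolding lor_def by (subst (1 2) sum.swap) (simp add: matrix_vector_mult_def sum_distrib_left)
  also have "lor b (Y *v a) = - lor a (Y *v b)"
    using lor_mult_vec_skew(1)[OF assms, of a b] by (simp add: lor_commute)
  finally show ?thesis by (simp add: pairing_g_def)
qed

text \<open>Testing with a \<and> b recovers every (a, Z b). This is the uniqueness behind
  \<open>retraction_form\<close>.\<close>

lemma pairing_g_nondegenerate:
  assumes "Z \<in> so41" "\<And>Y. Y \<in> so41 \<Longrightarrow> pairing_g Z Y = 0" shows "Z = 0"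
proof -
  have "lor (Z *v b) a = 0" for a b
  proof -
    have "pairing_g Z (wedge a b) = pairing_g (wedge a b) Z" unfolding pairing_g_def by (subst trace_mul_sym) (rule refl)
    then show ?thesis
      using assms(2)[OF wedge_so41[of a b]] pairing_g_wedge[OF assms(1), of a b] by (simp add: lor_commute)
  qed
  then have "Z *v b = 0" for b using lor_eq_0 by blast
  then show ?thesis by (simp add: matrix_eq)
qed

section \<open>Volume forms on five-space and their contraction with bivectors\<close>

locale volume_form =
  fixes D :: "real^5^5 \<Rightarrow> real"
  assumes vol: "is_volume_form D"
begin

abbreviation "row_upd M i v \<equiv> (\<chi> j. if j = i then v else M $ j)"

lemma volume_form_linear: "linear (\<lambda>v. D (row_upd M i v))"
  using vol unfolding is_volume_form_def by blast

lemma volume_form_alternating: "i \<noteq> j \<Longrightarrow> M $ i = M $ j \<Longrightarrow> D M = 0"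
  using vol unfolding is_volume_form_def by blast

lemma row_upd_self: "row_upd M i (M $ i) = (M :: real^5^5)"
  by (simp add: vec_eq_iff)

lemma volume_form_row_swap:
  assumes "i \<noteq> j"
  shows "D (row_upd (row_upd M i (M $ j)) j v) = - D (row_upd M i v)"
proof -
  let ?F = "\<lambda>u v. D (row_upd (row_upd M j v) i u)"
  have eq: "row_upd (row_upd M j v) i u = row_upd (row_upd M i u) j v" for u v
    using assms by (auto simp: vec_eq_iff)
  have "?F (M $ j) v = - ?F v (M $ j)"
  proof (rule linear_swap[where F = ?F])
    show "linear (\<lambda>u. ?F u v)" for v by (rule volume_form_linear)
    show "linear (?F u)" for u unfolding eq by (rule volume_form_linear)
    show "?F u u = 0" for u by (rule volume_form_alternating[OF assms]) (use assms in auto)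
  qed
  moreover have "row_upd (row_upd M j (M $ j)) i v = row_upd M i v"
    by (simp add: vec_eq_iff)
  ultimately show ?thesis by (simp add: eq)
qed

text \<open>If the rows are dependent, with \<open>\<Sum>i. c i * M i = 0\<close>, then the value of \<open>D\<close> after replacing
  the row \<open>k\<close> is proportional to \<open>c k\<close>.\<close>

lemma volume_form_contraction:
  assumes l: "linear l"
  shows "l v * D M = (\<Sum>k\<in>UNIV. l (M $ k) * D (row_upd M k v))"
\<comment> \<open>The difference of the two sides is, up to sign, the alternating 6-form l \<and> D,
  which vanishes in dimension five. The cases are independent rows, where v is a combination of
  them, and dependent rows.\<close>
proof (cases "inj (\<lambda>c :: real^5. \<Sum>i\<in>UNIV. c $ i *\<^sub>R M $ i)")
  case True
  have "linear (\<lambda>c :: real^5. \<Sum>i\<in>UNIV. c $ i *\<^sub>R M $ i)"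
    by (auto intro!: linearI simp: algebra_simps sum.distrib scaleR_sum_right)
  then have "surj (\<lambda>c :: real^5. \<Sum>i\<in>UNIV. c $ i *\<^sub>R M $ i)"
    using True by (rule linear_inj_imp_surj)
  then obtain c :: "real^5" where v: "v = (\<Sum>i\<in>UNIV. c $ i *\<^sub>R M $ i)" by (meson surjE)
  have "c $ i * D (row_upd M k (M $ i)) = (if i = k then c $ k * D M else 0)" for i k
    by (auto simp: row_upd_self intro!: volume_form_alternating[of k i])
  then have "D (row_upd M k v) = c $ k * D M" for k
    unfolding v by (simp add: linear_sum[OF volume_form_linear] linear_scale[OF volume_form_linear])
  then show ?thesis
    by (simp add: v linear_sum[OF l] linear_scale[OF l] sum_distrib_left sum_distrib_right mult_ac)
next
  case False
  have lin: "linear (\<lambda>c :: real^5. \<Sum>i\<in>UNIV. c $ i *\<^sub>R M $ i)"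
    by (auto intro!: linearI simp: algebra_simps sum.distrib scaleR_sum_right)
  then obtain c :: "real^5" where c: "c \<noteq> 0" "(\<Sum>i\<in>UNIV. c $ i *\<^sub>R M $ i) = 0"
    using False unfolding linear_injective_0[OF lin] by blast
  then obtain j where j: "c $ j \<noteq> 0" by (auto simp: vec_eq_iff)
  have *: "(\<Sum>i\<in>UNIV. c $ i * D (row_upd M' j (M $ i))) = 0" for M'
  proof -
    have "D (row_upd M' j (\<Sum>i\<in>UNIV. c $ i *\<^sub>R M $ i)) = 0"
      unfolding c using linear_0[OF volume_form_linear] .
    then show ?thesis by (simp add: linear_sum[OF volume_form_linear] linear_scale[OF volume_form_linear])
  qed
  have "c $ i * D (row_upd M j (M $ i)) = (if i = j then c $ j * D M else 0)" for i
    by (auto simp: row_upd_self intro!: volume_form_alternating[of j i])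
  then have DM: "D M = 0" using *[of M] j by simp
  \<comment> \<open>Insert the linear relation into row j of \<open>row_upd M k v\<close>: only the
    terms i = j and i = k have no repeated row, and the latter changes sign under a row
    exchange.\<close>
  have "c $ j * D (row_upd M k v) = c $ k * D (row_upd M j v)" for k
  proof (cases "k = j")
    case False
    let ?M = "row_upd M k v"
    have jj: "row_upd ?M j (M $ j) = ?M" using False by (simp add: vec_eq_iff)
    have jk: "row_upd ?M j (M $ k) = row_upd (row_upd M j (M $ k)) k v" using False by (auto simp: vec_eq_iff)
    have "c $ i * D (row_upd ?M j (M $ i))
        = (if i = j then c $ j * D ?M else 0) + (if i = k then - c $ k * D (row_upd M j v) else 0)" for i
    proof -
      consider "i = j" | "i = k" | "i \<noteq> j" "i \<noteq> k" by blast
      then show ?thesis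
      proof cases
        case 1 then show ?thesis using False by (simp only: jj) simp
      next
        case 2 then show ?thesis using False volume_form_row_swap[of j k v M] by (simp only: jk) simp
      next
        case 3
        then have "D (row_upd ?M j (M $ i)) = 0" by (intro volume_form_alternating[of j i]) auto
        then show ?thesis using 3 by simp
      qed
    qed
    then have "(\<Sum>i\<in>UNIV. c $ i * D (row_upd ?M j (M $ i))) = c $ j * D ?M - c $ k * D (row_upd M j v)"
      by (simp only: sum.distrib sum.delta finite_UNIV) simp
    then show ?thesis using *[of ?M] by simp
  qed simp
  then have "c $ j * (l (M $ k) * D (row_upd M k v)) = l (M $ k) * (c $ k * D (row_upd M j v))" for k
    by (simp only: mult.left_commute[of "c $ j" "l (M $ k)"])
  then have "c $ j * (\<Sum>k\<in>UNIV. l (M $ k) * D (row_upd M k v))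
      = (\<Sum>k\<in>UNIV. l (M $ k) * (c $ k * D (row_upd M j v)))"
    unfolding sum_distrib_left by (intro sum.cong refl)
  also have "\<dots> = l (\<Sum>k\<in>UNIV. c $ k *\<^sub>R M $ k) * D (row_upd M j v)"
    by (simp add: linear_sum[OF l] linear_scale[OF l] sum_distrib_right sum_distrib_left mult_ac)
  also have "\<dots> = 0" using c linear_0[OF l] by simp
  finally show ?thesis using j DM by simp
qed

lemma row_upd_vector:
  "row_upd (vector [a,b,c,d,e]) (1::5) v = vector [v,b,c,d,e]"
  "row_upd (vector [a,b,c,d,e]) (2::5) v = vector [a,v,c,d,e]"
  "row_upd (vector [a,b,c,d,e]) (3::5) v = vector [a,b,v,d,e]"
  "row_upd (vector [a,b,c,d,e]) (4::5) v = vector [a,b,c,v,e]"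
  "row_upd (vector [a,b,c,d,e]) (5::5) v = vector [a,b,c,d,v]"
  by (simp_all add: vec_eq_iff forall_5 vector_5)

abbreviation "dv a b c d e \<equiv> D (vector [a,b,c,d,e])"

lemma dv_linear:
  "linear (\<lambda>v. dv v b c d e)" "linear (\<lambda>v. dv a v c d e)" "linear (\<lambda>v. dv a b v d e)"
  "linear (\<lambda>v. dv a b c v e)" "linear (\<lambda>v. dv a b c d v)"
  using volume_form_linear[of 1 "vector [a,b,c,d,e]"] volume_form_linear[of 2 "vector [a,b,c,d,e]"]
    volume_form_linear[of 3 "vector [a,b,c,d,e]"] volume_form_linear[of 4 "vector [a,b,c,d,e]"]
    volume_form_linear[of 5 "vector [a,b,c,d,e]"]
  unfolding row_upd_vector by blast+

lemmas dv_add = dv_linear[THEN linear_add]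
lemmas dv_diff = dv_linear[THEN linear_diff]
lemmas dv_scaleR = dv_linear[THEN linear_scale]
lemmas dv_minus = dv_linear[THEN linear_neg]
lemmas dv_zero = dv_linear[THEN linear_0]

lemma dv_eq_0:
  "dv a a c d e = 0" "dv a b a d e = 0" "dv a b c a e = 0" "dv a b c d a = 0"
  "dv a b b d e = 0" "dv a b c b e = 0" "dv a b c d b = 0"
  "dv a b c c e = 0" "dv a b c d c = 0" "dv a b c d d = 0"
  by (rule volume_form_alternating[of 1 2] volume_form_alternating[of 1 3]
      volume_form_alternating[of 1 4] volume_form_alternating[of 1 5]
      volume_form_alternating[of 2 3] volume_form_alternating[of 2 4] volume_form_alternating[of 2 5]
      volume_form_alternating[of 3 4] volume_form_alternating[of 3 5] volume_form_alternating[of 4 5];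
      simp add: vector_5)+

lemma dv_swap:
  "dv b a c d e = - dv a b c d e" "dv a c b d e = - dv a b c d e"
  "dv a b d c e = - dv a b c d e" "dv a b c e d = - dv a b c d e"
  by (rule linear_swap[where F = "\<lambda>a b. dv a b c d e"] linear_swap[where F = "\<lambda>b c. dv a b c d e"]
      linear_swap[where F = "\<lambda>c d. dv a b c d e"] linear_swap[where F = "\<lambda>d e. dv a b c d e"];
      intro dv_linear dv_eq_0)+

lemma dv_contraction:
  assumes "linear l"
  shows "l v * dv a b c d e = l a * dv v b c d e + l b * dv a v c d e + l c * dv a b v d e
    + l d * dv a b c v e + l e * dv a b c d v"
  using volume_form_contraction[OF assms, of v "vector [a,b,c,d,e]"]
  by (simp add: sum_5 row_upd_vector vector_5)

lemma dv_orthonormal: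
  assumes "y \<in> space_form \<qq>"
    and T: "a \<in> tangent_M \<qq> y" "b \<in> tangent_M \<qq> y" "c \<in> tangent_M \<qq> y"
    and "lor a a = 1" "lor b b = 1" "lor c c = 1" "lor a b = 0" "lor a c = 0" "lor b c = 0"
  shows "\<bar>dv y \<qq> a b c\<bar> = 1"
proof -
  \<comment> \<open>n is the null vector in the plane of y and \<qq> with (y, n) = -1; s and t then
    form an orthonormal basis of this Lorentzian plane, with s timelike. Passing from s, t to y,
    \<qq> changes D only by a sign.\<close>
  define n where "n = \<qq> + (lor \<qq> \<qq> / 2) *\<^sub>R y"
  define s t where "s = (1 / sqrt 2) *\<^sub>R (y + n)" and "t = (1 / sqrt 2) *\<^sub>R (y - n)"
  note y = space_formD[OF assms(1)]
  have yn: "lor y n = -1" "lor n y = -1" "lor n n = 0"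
    using y by (simp_all add: n_def lor.add_left lor.add_right lor.scaleR_left lor.scaleR_right)
  have nT: "lor n v = 0" "lor v n = 0" "lor y v = 0" "lor v y = 0" if "v \<in> tangent_M \<qq> y" for v
    using tangent_M_commute[OF that]
    by (simp_all add: n_def lor.add_left lor.add_right lor.scaleR_left lor.scaleR_right)
  have ss: "sqrt 2 * sqrt 2 = (2::real)" by simp
  have st: "lor s s = -1" "lor t t = 1" "lor s t = 0" "lor t s = 0"
    using y yn by (simp_all add: s_def t_def lor.add_left lor.add_right lor.diff_left lor.diff_right
        lor.scaleR_left lor.scaleR_right field_simps)
  have stT: "lor s v = 0" "lor v s = 0" "lor t v = 0" "lor v t = 0" if "v \<in> tangent_M \<qq> y" for v
    using nT[OF that] by (simp_all add: s_def t_def lor.add_left lor.add_right lor.diff_left lor.diff_right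
        lor.scaleR_left lor.scaleR_right)
  let ?M = "vector [s,t,a,b,c] :: real^5^5"
  have "(\<forall>i j. i \<noteq> j \<longrightarrow> lor (?M $ i) (?M $ j) = 0) \<and> (\<forall>i. \<bar>lor (?M $ i) (?M $ i)\<bar> = 1)"
    unfolding forall_5 using assms st stT[OF T(1)] stT[OF T(2)] stT[OF T(3)]
    by (simp add: vector_5 lor_commute)
  then have "\<bar>dv s t a b c\<bar> = 1" using vol unfolding is_volume_form_def by blast
  moreover have "dv s t a b c = - dv y n a b c"
    using dv_swap(1)[of n y a b c]
    by (simp add: s_def t_def dv_add dv_diff dv_scaleR dv_eq_0 field_simps)
  moreover have "dv y n a b c = dv y \<qq> a b c"
    by (simp add: n_def dv_add dv_scaleR dv_eq_0)
  ultimately show ?thesis by simp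
qed

lemma det_wedge_linear: "linear (\<lambda>Z. det_wedge D v Z Y)"
  by (rule linearI) (simp_all add: det_wedge_def bivec_def algebra_simps sum.distrib sum_distrib_left
      add_divide_distrib)

text \<open>Only the first bivector is decomposed, so Y stays an arbitrary matrix; the remaining 1/2
  is the double counting of the pairs k, l.\<close>

lemma det_wedge_left_wedge:
  "det_wedge D v (wedge a b) Y = (\<Sum>k\<in>UNIV. \<Sum>l\<in>UNIV. bivec Y k l * dv v a b (axis k 1) (axis l 1)) / 2"
proof -
  have ex: "(\<Sum>i\<in>UNIV. a $ i * (\<Sum>j\<in>UNIV. b $ j * dv v (axis i 1) (axis j 1) c d)) = dv v a b c d" for a b c d
    unfolding volume_form_expand(2)[OF vol] volume_form_expand(1)[OF vol] ..
  have "(\<Sum>i\<in>UNIV. \<Sum>j\<in>UNIV. \<Sum>k\<in>UNIV. \<Sum>l\<in>UNIV. bivec (wedge a b) i j * bivec Y k l *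
        dv v (axis i 1) (axis j 1) (axis k 1) (axis l 1))
    = (\<Sum>i\<in>UNIV. \<Sum>j\<in>UNIV. \<Sum>k\<in>UNIV. \<Sum>l\<in>UNIV.
        bivec Y k l * (a $ i * (b $ j * dv v (axis i 1) (axis j 1) (axis k 1) (axis l 1))
          - b $ i * (a $ j * dv v (axis i 1) (axis j 1) (axis k 1) (axis l 1))))"
    unfolding bivec_wedge by (simp add: algebra_simps)
  also have "\<dots> = (\<Sum>i\<in>UNIV. \<Sum>k\<in>UNIV. \<Sum>l\<in>UNIV. \<Sum>j\<in>UNIV.
        bivec Y k l * (a $ i * (b $ j * dv v (axis i 1) (axis j 1) (axis k 1) (axis l 1))
          - b $ i * (a $ j * dv v (axis i 1) (axis j 1) (axis k 1) (axis l 1))))"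
    by (subst sum.swap, subst (2) sum.swap, rule refl)
  also have "\<dots> = (\<Sum>k\<in>UNIV. \<Sum>l\<in>UNIV. \<Sum>i\<in>UNIV. \<Sum>j\<in>UNIV.
        bivec Y k l * (a $ i * (b $ j * dv v (axis i 1) (axis j 1) (axis k 1) (axis l 1))
          - b $ i * (a $ j * dv v (axis i 1) (axis j 1) (axis k 1) (axis l 1))))"
    by (subst sum.swap, subst (2) sum.swap, rule refl)
  also have "\<dots> = (\<Sum>k\<in>UNIV. \<Sum>l\<in>UNIV. bivec Y k l *
      (dv v a b (axis k 1) (axis l 1) - dv v b a (axis k 1) (axis l 1)))"
    by (simp add: sum_distrib_left[symmetric] sum_subtractf ex)
  also have "\<dots> = 2 * (\<Sum>k\<in>UNIV. \<Sum>l\<in>UNIV. bivec Y k l * dv v a b (axis k 1) (axis l 1))"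
    unfolding sum_distrib_left by (intro sum.cong refl) (simp add: dv_swap(2)[of v b a])
  finally show ?thesis by (simp add: det_wedge_def)
qed

lemma det_wedge_left_linear:
  "linear (\<lambda>v. det_wedge D v (wedge a b) Y)" "linear (\<lambda>a. det_wedge D v (wedge a b) Y)"
  "linear (\<lambda>b. det_wedge D v (wedge a b) Y)"
proof -
  show "linear (\<lambda>v. det_wedge D v (wedge a b) Y)"
    by (rule linearI) (simp_all add: det_wedge_left_wedge dv_add dv_scaleR algebra_simps sum.distrib
        sum_distrib_left add_divide_distrib)
  show "linear (\<lambda>a. det_wedge D v (wedge a b) Y)"
    using linear_compose[OF bounded_linear.linear[OF wedge.bounded_linear_left] det_wedge_linear]
    by (simp add: o_def)
  show "linear (\<lambda>b. det_wedge D v (wedge a b) Y)"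
    using linear_compose[OF bounded_linear.linear[OF wedge.bounded_linear_right] det_wedge_linear]
    by (simp add: o_def)
qed

lemmas det_wedge_add = det_wedge_left_linear[THEN linear_add]
lemmas det_wedge_diff = det_wedge_left_linear[THEN linear_diff]
lemmas det_wedge_scaleR = det_wedge_left_linear[THEN linear_scale]

lemma det_wedge_swap:
  "det_wedge D a (wedge v b) Y = - det_wedge D v (wedge a b) Y"
  "det_wedge D v (wedge b a) Y = - det_wedge D v (wedge a b) Y"
  unfolding det_wedge_left_wedge dv_swap(1)[of a v] dv_swap(2)[of v b a]
  by (simp_all add: sum_negf)

lemma bivec_contract:
  fixes F :: "real^5 \<Rightarrow> real"
  assumes "linear F"
  shows "(\<Sum>k\<in>UNIV. \<Sum>l\<in>UNIV. bivec Y k l * (lor z (axis k 1) * F (axis l 1))) = F (Y *v z)"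
proof -
  have "(\<Sum>k\<in>UNIV. \<Sum>l\<in>UNIV. bivec Y k l * (lor z (axis k 1) * F (axis l 1)))
      = (\<Sum>l\<in>UNIV. \<Sum>k\<in>UNIV. Y $ l $ k * z $ k * F (axis l 1))"
    by (subst sum.swap) (intro sum.cong refl, simp add: bivec_def lor_axis sig_def)
  also have "\<dots> = (\<Sum>l\<in>UNIV. (Y *v z) $ l * F (axis l 1))"
    by (simp add: matrix_vector_mult_def sum_distrib_right)
  also have "\<dots> = F (\<Sum>l\<in>UNIV. (Y *v z) $ l *\<^sub>R axis l 1)"
    by (simp add: linear_sum[OF assms] linear_scale[OF assms])
  also have "(\<Sum>l\<in>UNIV. (Y *v z) $ l *\<^sub>R (axis l 1 :: real^5)) = Y *v z"
    by (simp add: basis_expansion scalar_mult_eq_scaleR[symmetric])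
  finally show ?thesis .
qed

text \<open>\<open>dv_contraction\<close> for v, a, b and two basis vectors, summed against the
  components of Y. The two terms in which z meets Y agree by skewness, each giving half of the last
  summand. Taking z = \<qq> or z = y yields the two Killing lemmas that follow.\<close>

lemma det_wedge_contraction:
  assumes "Y \<in> so41"
  shows "lor z u * det_wedge D v (wedge a b) Y = lor z v * det_wedge D u (wedge a b) Y
    + lor z a * det_wedge D v (wedge u b) Y + lor z b * det_wedge D v (wedge a u) Y
    + dv v a b u (Y *v z)"
proof -
  let ?e = "\<lambda>k. axis k 1 :: real^5"
  let ?S = "\<lambda>f :: 5 \<Rightarrow> 5 \<Rightarrow> real. \<Sum>k\<in>UNIV. \<Sum>l\<in>UNIV. bivec Y k l * f k l"
  have l: "linear (lor z)" by (rule bounded_linear.linear[OF lor.bounded_linear_right])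
  have skew: "bivec Y k l = - bivec Y l k" for k l
    using so41_skew[OF assms, of k l] by (auto simp: bivec_def sig_def split: if_splits)
  have "?S (\<lambda>k l. lor z (?e l) * dv v a b (?e k) u) = - ?S (\<lambda>k l. lor z (?e k) * dv v a b (?e l) u)"
    by (subst sum.swap, subst sum_negf[symmetric], intro sum.cong refl, subst sum_negf[symmetric],
        intro sum.cong refl, subst skew, simp)
  also have "\<dots> = - dv v a b (Y *v z) u"
    by (rule arg_cong[OF bivec_contract[OF dv_linear(4)]])
  finally have 2: "?S (\<lambda>k l. lor z (?e l) * dv v a b (?e k) u) = dv v a b u (Y *v z)"
    using dv_swap(4)[of v a b u "Y *v z"] by simp
  have 1: "?S (\<lambda>k l. lor z (?e k) * dv v a b u (?e l)) = dv v a b u (Y *v z)"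
    by (rule bivec_contract[OF dv_linear(5)])
  have "lor z u * ?S (\<lambda>k l. dv v a b (?e k) (?e l)) = ?S (\<lambda>k l. lor z u * dv v a b (?e k) (?e l))"
    by (simp add: sum_distrib_left mult_ac)
  also have "\<dots> = lor z v * ?S (\<lambda>k l. dv u a b (?e k) (?e l)) + lor z a * ?S (\<lambda>k l. dv v u b (?e k) (?e l))
     + lor z b * ?S (\<lambda>k l. dv v a u (?e k) (?e l))
     + ?S (\<lambda>k l. lor z (?e k) * dv v a b u (?e l)) + ?S (\<lambda>k l. lor z (?e l) * dv v a b (?e k) u)"
    unfolding dv_contraction[OF l, of u]
    by (simp add: distrib_left sum.distrib sum_distrib_left mult_ac)
  finally show ?thesis unfolding det_wedge_left_wedge 1 2 by (simp add: field_simps)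
qed

text \<open>A Killing Y is a bivector of the orthogonal complement of \<qq>, which has dimension
  four, so v \<and> a \<and> b \<and> Y is a 5-vector on a 4-space. Contraction with \<qq> makes
  this explicit.\<close>

lemma det_wedge_killing_orthogonal:
  assumes "Y \<in> killing \<qq>" "\<qq> \<noteq> 0" "lor v \<qq> = 0" "lor a \<qq> = 0" "lor b \<qq> = 0"
  shows "det_wedge D v (wedge a b) Y = 0"
proof -
  obtain u where u: "lor \<qq> u \<noteq> 0" using lor_eq_0[of \<qq>] assms(2) by blast
  have "lor \<qq> u * det_wedge D v (wedge a b) Y = 0"
    using det_wedge_contraction[of Y \<qq> u v a b] assms by (simp add: killing_def lor_commute dv_zero)
  then show ?thesis using u by simp
qed

text \<open>Contracting with y and inserting \<qq> kills all terms but the last, since y is null and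
  orthogonal to a and b; the sign from (y, \<qq>) = -1 turns Y y into the Killing field.\<close>

lemma det_wedge_killing_tangent:
  assumes "Y \<in> killing \<qq>" "y \<in> space_form \<qq>" "a \<in> tangent_M \<qq> y" "b \<in> tangent_M \<qq> y"
  shows "det_wedge D y (wedge a b) Y = dv y a b \<qq> (conf_field \<qq> Y y)"
  using det_wedge_contraction[of Y y \<qq> y a b] space_formD[OF assms(2)] assms(1)
    tangent_M_commute[OF assms(3)] tangent_M_commute[OF assms(4)]
  by (simp add: killing_def conf_field_killing[OF assms(1)] dv_minus)

end


section \<open>Closed 1-forms on a space form are exact\<close>

lemma lor_eq_inner: "lor v w = v \<bullet> (\<chi> i. sig i * w $ i)"
  by (simp add: lor_def inner_vec_def mult_ac)

lemma lor_orthogonal_exists: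
  assumes "finite F" "card F < 5" shows "\<exists>m\<noteq>0. \<forall>v\<in>F. lor m v = 0"
proof -
  let ?J = "\<lambda>w :: real^5. \<chi> i. sig i * w $ i"
  have "dim (?J ` F) \<le> card (?J ` F)" using assms by (simp add: dim_le_card')
  also have "\<dots> < 5" using card_image_le[OF assms(1), of ?J] assms(2) by linarith
  finally have "dim (?J ` F) < DIM(real^5)" by simp
  then obtain m where "m \<noteq> 0" "\<And>y. y \<in> span (?J ` F) \<Longrightarrow> orthogonal m y"
    using orthogonal_to_subspace_exists by blast
  then have "lor m v = 0" if "v \<in> F" for v
    using span_base[of "?J v" "?J ` F"] that by (simp add: lor_eq_inner orthogonal_def)
  then show ?thesis using \<open>m \<noteq> 0\<close> by blast
qed

lemma dim_tangent_M: "dim (tangent_M \<qq> y) \<ge> 3"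
proof -
  let ?J = "\<lambda>w :: real^5. \<chi> i. sig i * w $ i"
  let ?A = "span {?J y, ?J \<qq>}"
  have "tangent_M \<qq> y = {v \<in> UNIV. \<forall>x\<in>?A. orthogonal x v}"
  proof (intro equalityI subsetI)
    fix v assume "v \<in> tangent_M \<qq> y"
    then have "orthogonal v a" if "a \<in> {?J y, ?J \<qq>}" for a
      using that by (auto simp: tangent_M_def orthogonal_def lor_eq_inner)
    then have "orthogonal v a" if "a \<in> ?A" for a using orthogonal_to_span[OF that] by blast
    then show "v \<in> {v \<in> UNIV. \<forall>x\<in>?A. orthogonal x v}" by (simp add: orthogonal_commute)
  next
    fix v assume "v \<in> {v \<in> UNIV. \<forall>x\<in>?A. orthogonal x v}"
    then have "orthogonal (?J y) v" "orthogonal (?J \<qq>) v" by (auto simp: span_base)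
    then show "v \<in> tangent_M \<qq> y"
      by (simp add: tangent_M_def orthogonal_def lor_eq_inner inner_commute)
  qed
  then have "dim (tangent_M \<qq> y) + dim ?A = 5"
    using dim_subspace_orthogonal_to_vectors[of ?A UNIV] by simp
  moreover have "dim ?A \<le> 2"
  proof -
    have "dim ?A \<le> card {?J y, ?J \<qq>}" unfolding dim_span by (rule dim_le_card') simp
    also have "\<dots> \<le> 2" by (simp add: card_insert_if)
    finally show ?thesis .
  qed
  ultimately show ?thesis by linarith
qed

lemma subspace_tangent_M: "subspace (tangent_M \<qq> y)"
  unfolding subspace_def using tangent_M_add tangent_M_scaleR
  by (auto simp: tangent_M_def lor.zero_left)

section \<open>Pullbacks of 1-forms on the space form\<close>

lemma space_form_derivative_tangent:
  assumes h: "(h has_derivative h') (at u)" and "open S" "u \<in> S" "h ` S \<subseteq> space_form \<qq>"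
  shows "h' v \<in> tangent_M \<qq> (h u)"
proof -
  have M: "lor (h t) (h t) = 0" "lor (h t) \<qq> = -1" if "t \<in> S" for t
    using space_formD[of "h t" \<qq>] assms(4) that by auto
  have "((\<lambda>t. lor (h t) (h t)) has_derivative (\<lambda>v. lor (h u) (h' v) + lor (h' v) (h u))) (at u)"
    by (rule bounded_bilinear.FDERIV[OF bounded_bilinear_lor h h])
  then have "((\<lambda>t. 0) has_derivative (\<lambda>v. lor (h u) (h' v) + lor (h' v) (h u))) (at u)"
    by (rule has_derivative_transform_within_open[OF _ assms(2,3)]) (simp add: M)
  then have 1: "lor (h u) (h' v) + lor (h' v) (h u) = 0"
    using has_derivative_unique[OF _ has_derivative_const] by metis
  have "((\<lambda>t. lor (h t) \<qq>) has_derivative (\<lambda>v. lor (h' v) \<qq>)) (at u)"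
    by (rule bounded_linear.has_derivative[OF lor.bounded_linear_left h])
  then have "((\<lambda>t. - 1) has_derivative (\<lambda>v. lor (h' v) \<qq>)) (at u)"
    by (rule has_derivative_transform_within_open[OF _ assms(2,3)]) (simp add: M)
  then have "lor (h' v) \<qq> = 0"
    using has_derivative_unique[OF _ has_derivative_const] by metis
  with 1 show ?thesis by (simp add: tangent_M_def lor_commute)
qed

text \<open>Modelled on \<open>flux_primitive\<close> with zero curl. The extension may depend on y,
  and its curl is tested at y only, in tangent directions.\<close>

definition closed_on_space_form :: "real^5 \<Rightarrow> (real^5 \<Rightarrow> real^5 \<Rightarrow> real) \<Rightarrow> bool" where
  "closed_on_space_form \<qq> \<gamma> \<longleftrightarrow> (\<forall>y\<in>space_form \<qq>. \<exists>B \<beta>. y \<in> B \<and> local_extension \<qq> \<gamma> B \<beta> \<and>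
     (\<forall>v\<in>tangent_M \<qq> y. \<forall>w\<in>tangent_M \<qq> y.
        frechet_derivative (\<lambda>z. \<beta> z w) (at y) v = frechet_derivative (\<lambda>z. \<beta> z v) (at y) w))"

lemma linear_expand_axis:
  fixes L :: "real^5 \<Rightarrow> real"
  assumes "linear L" shows "L v = (\<Sum>i\<in>UNIV. v $ i * L (axis i 1))"
proof -
  have "L v = L (\<Sum>i\<in>UNIV. v $ i *\<^sub>R axis i 1)"
    by (simp add: basis_expansion scalar_mult_eq_scaleR[symmetric])
  then show ?thesis by (simp add: linear_sum[OF assms] linear_scale[OF assms])
qed

text \<open>Off the tangent space the values of \<gamma> are arbitrary; linearity is borrowed from a
  local extension, which agrees with \<gamma> on the tangent vectors h' v.\<close>

lemma pullback_linear:
  assumes "closed_on_space_form \<qq> \<gamma>" "(h has_derivative h') (at u)"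
    "open S" "u \<in> S" "h ` S \<subseteq> space_form \<qq>"
  shows "linear (\<lambda>v. \<gamma> (h u) (h' v))"
proof -
  have hu: "h u \<in> space_form \<qq>" using assms by auto
  then obtain B \<beta> where B: "h u \<in> B" "local_extension \<qq> \<gamma> B \<beta>"
    using assms(1) unfolding closed_on_space_form_def by blast
  then have lin: "linear (\<beta> (h u))" and eq: "\<And>v. v \<in> tangent_M \<qq> (h u) \<Longrightarrow> \<beta> (h u) v = \<gamma> (h u) v"
    using hu unfolding local_extension_def by auto
  have "linear (\<lambda>v. \<beta> (h u) (h' v))"
    using linear_compose[OF has_derivative_linear[OF assms(2)] lin] by (simp add: o_def)
  then show ?thesis using eq[OF space_form_derivative_tangent[OF assms(2-)]] by simp
qed

text \<open>Pullback commutes with the exterior derivative: one term contains the second derivative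
  of h and is symmetric, the other is the derivative of the extension, symmetric by closedness. As
  the extension belongs to the point h u, smoothness is obtained near u and the symmetry at
  u.\<close>

lemma pullback_local:
  fixes h :: "'m::euclidean_space \<Rightarrow> real^5"
  assumes cl: "closed_on_space_form \<qq> \<gamma>" and S: "open S" and h: "smooth_on S h"
    and M: "h ` S \<subseteq> space_form \<qq>" and u: "u \<in> S"
  obtains T where "open T" "u \<in> T" "T \<subseteq> S" "\<And>v. smooth_on T (\<lambda>t. \<gamma> (h t) (frechet_derivative h (at t) v))"
    and "\<And>v w. frechet_derivative (\<lambda>t. \<gamma> (h t) (frechet_derivative h (at t) v)) (at u) w
      = frechet_derivative (\<lambda>t. \<gamma> (h t) (frechet_derivative h (at t) w)) (at u) v"
proof -
  let ?h = "\<lambda>t. frechet_derivative h (at t)"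
  have der: "(h has_derivative ?h t) (at t)" if "t \<in> S" for t
    using smooth_on_has_derivative[OF h that] .
  have tan: "?h t v \<in> tangent_M \<qq> (h t)" if "t \<in> S" for t v
    by (rule space_form_derivative_tangent[OF der[OF that] S that M])
  obtain B \<beta> where B: "h u \<in> B" "local_extension \<qq> \<gamma> B \<beta>"
    and sym: "\<And>v w. v \<in> tangent_M \<qq> (h u) \<Longrightarrow> w \<in> tangent_M \<qq> (h u) \<Longrightarrow>
      frechet_derivative (\<lambda>z. \<beta> z w) (at (h u)) v = frechet_derivative (\<lambda>z. \<beta> z v) (at (h u)) w"
  proof -
    have "h u \<in> space_form \<qq>" using M u by blast
    from bspec[OF cl[unfolded closed_on_space_form_def] this] show thesis
      by (elim exE conjE, intro that) auto
  qed
  then have oB: "open B" and lin: "\<And>y. y \<in> B \<Longrightarrow> linear (\<beta> y)" and sm: "\<And>v. smooth_on B (\<lambda>y. \<beta> y v)"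
    and eq: "\<And>y v. y \<in> B \<Longrightarrow> y \<in> space_form \<qq> \<Longrightarrow> v \<in> tangent_M \<qq> y \<Longrightarrow> \<beta> y v = \<gamma> y v"
    unfolding local_extension_def by auto
  define T where "T = S \<inter> h -` B"
  have contS: "continuous_on S h" using h Ck_on_continuous unfolding smooth_on_def by blast
  have T: "open T" "u \<in> T" "T \<subseteq> S"
  proof -
    have "open (h -` B \<inter> S)" using continuous_on_open_vimage[OF S, of h] contS oB by blast
    then show "open T" by (simp add: T_def Int_commute)
  qed (use u B(1) in \<open>auto simp: T_def\<close>)
  \<comment> \<open>The extension is smooth for each fixed vector, whereas the vector inserted here
    varies with t; components separate the two dependences.\<close>
  let ?f = "\<lambda>v t. \<Sum>i\<in>UNIV. ?h t v $ i * \<beta> (h t) (axis i 1)"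
  have f: "?f v t = \<gamma> (h t) (?h t v)" if "t \<in> T" for v t
    using that eq[of "h t" "?h t v"] tan[of t v] M lin[of "h t"] linear_expand_axis[of "\<beta> (h t)" "?h t v"]
    by (auto simp: T_def)
  have sT: "smooth_on T h" using h T smooth_on_subset by blast
  have sf: "smooth_on T (\<lambda>t. \<gamma> (h t) (?h t v))" for v
  proof (rule smooth_on_cong[OF T(1) f])
    show "smooth_on T (?f v)"
      by (intro smooth_on_sum smooth_on_mult T(1) smooth_on_compose[OF T(1) oB _ sT sm]
          smooth_on_linear[OF _ bounded_linear_vec_nth] smooth_on_derivative sT) (auto simp: T_def)
  qed simp
  have D2: "frechet_derivative (\<lambda>t. \<gamma> (h t) (?h t v)) (at u) w
      = \<beta> (h u) (frechet_derivative (\<lambda>t. ?h t v) (at u) w)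
        + frechet_derivative (\<lambda>z. \<beta> z (?h u v)) (at (h u)) (?h u w)" for v w
  proof -
    let ?b = "\<lambda>i z. \<beta> z (axis i 1)"
    have b: "(?b i has_derivative frechet_derivative (?b i) (at (h u))) (at (h u))" for i
      by (rule smooth_on_has_derivative[OF sm B(1)])
    have bh: "((\<lambda>t. ?b i (h t)) has_derivative (\<lambda>w. frechet_derivative (?b i) (at (h u)) (?h u w))) (at u)" for i
      by (rule has_derivative_compose[OF der[OF u] b])
    have hv: "((\<lambda>t. ?h t v $ i) has_derivative (\<lambda>w. frechet_derivative (\<lambda>t. ?h t v) (at u) w $ i)) (at u)" for i
      by (rule bounded_linear.has_derivative[OF bounded_linear_vec_nth
            smooth_on_has_derivative[OF smooth_on_derivative[OF h] u]])
    have "(?f v has_derivative (\<lambda>w. \<Sum>i\<in>UNIV. ?h u v $ i * frechet_derivative (?b i) (at (h u)) (?h u w)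
        + frechet_derivative (\<lambda>t. ?h t v) (at u) w $ i * ?b i (h u))) (at u)"
      by (intro has_derivative_sum has_derivative_mult hv bh)
    then have F: "((\<lambda>t. \<gamma> (h t) (?h t v)) has_derivative
       (\<lambda>w. \<Sum>i\<in>UNIV. ?h u v $ i * frechet_derivative (?b i) (at (h u)) (?h u w)
        + frechet_derivative (\<lambda>t. ?h t v) (at u) w $ i * ?b i (h u))) (at u)"
      by (rule has_derivative_transform_within_open[OF _ T(1,2) f])
    have 1: "frechet_derivative (\<lambda>t. \<gamma> (h t) (?h t v)) (at u) w
      = (\<Sum>i\<in>UNIV. ?h u v $ i * frechet_derivative (?b i) (at (h u)) (?h u w)
        + frechet_derivative (\<lambda>t. ?h t v) (at u) w $ i * ?b i (h u))"
      by (rule fun_cong[OF frechet_derivative_at[OF F], symmetric])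
    have "((\<lambda>z. \<Sum>i\<in>UNIV. ?h u v $ i * ?b i z) has_derivative
       (\<lambda>w. \<Sum>i\<in>UNIV. ?h u v $ i * frechet_derivative (?b i) (at (h u)) w)) (at (h u))"
      by (intro has_derivative_sum has_derivative_mult_right b)
    then have G: "((\<lambda>z. \<beta> z (?h u v)) has_derivative
       (\<lambda>w. \<Sum>i\<in>UNIV. ?h u v $ i * frechet_derivative (?b i) (at (h u)) w)) (at (h u))"
      by (rule has_derivative_transform_within_open[OF _ oB B(1)])
        (rule linear_expand_axis[OF lin, symmetric])
    have 2: "frechet_derivative (\<lambda>z. \<beta> z (?h u v)) (at (h u)) (?h u w)
      = (\<Sum>i\<in>UNIV. ?h u v $ i * frechet_derivative (?b i) (at (h u)) (?h u w))"
      by (rule fun_cong[OF frechet_derivative_at[OF G], symmetric])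
    show ?thesis
      unfolding 1 2 linear_expand_axis[OF lin[OF B(1)], of "frechet_derivative (\<lambda>t. ?h t v) (at u) w"]
      by (simp add: sum.distrib)
  qed
  have "frechet_derivative (\<lambda>t. \<gamma> (h t) (?h t v)) (at u) w
      = frechet_derivative (\<lambda>t. \<gamma> (h t) (?h t w)) (at u) v" for v w
    unfolding D2 using symmetric_second_derivative[OF S h u, of v w] sym[OF tan[OF u] tan[OF u], of v w] by simp
  then show thesis using that T sf by blast
qed

lemma pullback_smooth:
  fixes h :: "'m::euclidean_space \<Rightarrow> real^5"
  assumes "closed_on_space_form \<qq> \<gamma>" "open S" "smooth_on S h" "h ` S \<subseteq> space_form \<qq>"
  shows "smooth_on S (\<lambda>t. \<gamma> (h t) (frechet_derivative h (at t) v))"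
  by (rule smooth_on_local) (metis pullback_local[OF assms])

text \<open>Stereographic coordinates about a point \<open>b\<close> of the space form: \<open>stereo_dual \<qq> b\<close> is the null
  vector \<open>n\<close> in the plane of \<open>b\<close> and \<open>\<qq>\<close> with \<open>(b, n) = -1\<close>, the null line through \<open>b + v + (v, v)/2 n\<close>
  is parametrized by \<open>v \<bottom> b, n\<close>, and \<open>stereo_den\<close> normalizes the product with \<open>\<qq>\<close> to \<open>-1\<close>. The
  coordinate is extended to all of the ambient space through the projection \<open>stereo_proj\<close>, so
  that no basis of the tangent space has to be chosen.\<close>

definition stereo_dual :: "real^5 \<Rightarrow> real^5 \<Rightarrow> real^5" where
  "stereo_dual \<qq> b = \<qq> + (lor \<qq> \<qq> / 2) *\<^sub>R b"

definition stereo_proj :: "real^5 \<Rightarrow> real^5 \<Rightarrow> real^5 \<Rightarrow> real^5" where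
  "stereo_proj \<qq> b w = w + lor w (stereo_dual \<qq> b) *\<^sub>R b + lor w b *\<^sub>R stereo_dual \<qq> b"

definition stereo_den :: "real^5 \<Rightarrow> real^5 \<Rightarrow> real^5 \<Rightarrow> real" where
  "stereo_den \<qq> b w = 1 - lor \<qq> \<qq> / 4 * lor (stereo_proj \<qq> b w) (stereo_proj \<qq> b w)"

definition stereo :: "real^5 \<Rightarrow> real^5 \<Rightarrow> real^5 \<Rightarrow> real^5" where
  "stereo \<qq> b w = (1 / stereo_den \<qq> b w) *\<^sub>R (b + stereo_proj \<qq> b w
     + (lor (stereo_proj \<qq> b w) (stereo_proj \<qq> b w) / 2) *\<^sub>R stereo_dual \<qq> b)"

definition stereo_height :: "real^5 \<Rightarrow> real^5 \<Rightarrow> real^5 \<Rightarrow> real" where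
  "stereo_height \<qq> b y = - lor y (stereo_dual \<qq> b)"

definition stereo_inv :: "real^5 \<Rightarrow> real^5 \<Rightarrow> real^5 \<Rightarrow> real^5" where
  "stereo_inv \<qq> b y = (1 / stereo_height \<qq> b y) *\<^sub>R stereo_proj \<qq> b y"

section \<open>Stereographic charts: domain, inverse and potentials\<close>

context
  fixes \<qq> b :: "real^5"
  assumes b: "b \<in> space_form \<qq>"
begin

lemma stereo_dual_lor:
  "lor b (stereo_dual \<qq> b) = -1" "lor (stereo_dual \<qq> b) b = -1"
  "lor (stereo_dual \<qq> b) (stereo_dual \<qq> b) = 0"
  "lor (stereo_dual \<qq> b) \<qq> = lor \<qq> \<qq> / 2"
  using space_formD[OF b]
  by (simp_all add: stereo_dual_def lor.add_left lor.add_right lor.scaleR_left lor.scaleR_right)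

lemma bounded_linear_stereo_proj: "bounded_linear (stereo_proj \<qq> b)"
  unfolding linear_conv_bounded_linear[symmetric]
  by (rule linearI) (simp_all add: stereo_proj_def lor.add_left lor.scaleR_left algebra_simps)

lemma stereo_proj_orthogonal:
  "lor (stereo_proj \<qq> b w) b = 0" "lor (stereo_proj \<qq> b w) (stereo_dual \<qq> b) = 0"
  "lor (stereo_proj \<qq> b w) \<qq> = 0"
proof -
  show 1: "lor (stereo_proj \<qq> b w) b = 0" "lor (stereo_proj \<qq> b w) (stereo_dual \<qq> b) = 0"
    using space_formD[OF b] stereo_dual_lor
    by (simp_all add: stereo_proj_def lor.add_left lor.scaleR_left)
  have "\<qq> = stereo_dual \<qq> b - (lor \<qq> \<qq> / 2) *\<^sub>R b" by (simp add: stereo_dual_def)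
  then have "lor (stereo_proj \<qq> b w) \<qq>
      = lor (stereo_proj \<qq> b w) (stereo_dual \<qq> b - (lor \<qq> \<qq> / 2) *\<^sub>R b)" by (rule arg_cong)
  then show "lor (stereo_proj \<qq> b w) \<qq> = 0"
    using 1 by (simp add: lor.diff_right lor.scaleR_right)
qed

lemma stereo_proj_tangent: "stereo_proj \<qq> b w \<in> tangent_M \<qq> b"
  using stereo_proj_orthogonal by (simp add: tangent_M_def)

lemma stereo_proj_id:
  assumes "v \<in> tangent_M \<qq> b" shows "stereo_proj \<qq> b v = v"
  using tangent_M_commute[OF assms]
  by (simp add: stereo_proj_def stereo_dual_def lor.add_right lor.scaleR_right)

lemma stereo_space_form:
  assumes "stereo_den \<qq> b w > 0" shows "stereo \<qq> b w \<in> space_form \<qq>"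
proof -
  let ?v = "stereo_proj \<qq> b w" and ?n = "stereo_dual \<qq> b"
  let ?s = "lor ?v ?v"
  let ?z = "b + ?v + (?s / 2) *\<^sub>R ?n"
  have "lor ?z ?z = 0"
    using stereo_dual_lor stereo_proj_orthogonal[of w] space_formD[OF b]
    by (simp add: lor.add_left lor.add_right lor.scaleR_left lor.scaleR_right lor_commute[of b ?v]
        lor_commute[of ?n ?v])
  moreover have "lor ?z \<qq> = - stereo_den \<qq> b w"
    using stereo_dual_lor stereo_proj_orthogonal[of w] space_formD[OF b]
    by (simp add: lor.add_left lor.scaleR_left stereo_den_def)
  ultimately show ?thesis
    using assms by (simp add: stereo_def space_form_def E_plane_def lor.scaleR_left lor.scaleR_right)
qed

text \<open>Components of y along b, along the dual null vector and along the orthogonal complement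
  of both. The second relation expresses (y, y) = 0, the third (y, \<qq>) = -1.\<close>

lemma stereo_coordinates:
  assumes y: "y \<in> space_form \<qq>"
  shows "y = stereo_proj \<qq> b y + stereo_height \<qq> b y *\<^sub>R b - lor y b *\<^sub>R stereo_dual \<qq> b"
    and "lor (stereo_proj \<qq> b y) (stereo_proj \<qq> b y) = - 2 * stereo_height \<qq> b y * lor y b"
    and "stereo_height \<qq> b y = 1 - lor \<qq> \<qq> / 2 * lor y b"
proof -
  let ?v = "stereo_proj \<qq> b y" and ?n = "stereo_dual \<qq> b" and ?a = "stereo_height \<qq> b y"
  show 1: "y = ?v + ?a *\<^sub>R b - lor y b *\<^sub>R ?n"
    by (simp add: stereo_proj_def stereo_height_def)
  have "lor y ?v = lor ?v ?v"
    using arg_cong[OF 1, of "\<lambda>z. lor z ?v"] stereo_proj_orthogonal[of y]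
    by (simp add: lor.add_left lor.diff_left lor.scaleR_left lor_commute[of b ?v] lor_commute[of ?n ?v])
  moreover have "lor y ?v = 2 * lor y ?n * lor y b"
    using space_formD[OF y]
    by (simp add: stereo_proj_def[of _ _ y] lor.add_right lor.scaleR_right)
  ultimately show "lor ?v ?v = - 2 * ?a * lor y b" by (simp add: stereo_height_def)
  show "?a = 1 - lor \<qq> \<qq> / 2 * lor y b"
    using space_formD[OF y]
    by (simp add: stereo_height_def stereo_dual_def lor.add_right lor.scaleR_right)
qed

text \<open>The denominator at the inverse image is the reciprocal of the height. Composing in this
  order gives the identity, whereas \<open>stereo\<close> forgets the components of w in the plane
  of b and \<qq>.\<close>

lemma stereo_stereo_inv:
  assumes y: "y \<in> space_form \<qq>" and a: "stereo_height \<qq> b y > 0"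
  shows "stereo \<qq> b (stereo_inv \<qq> b y) = y" "stereo_den \<qq> b (stereo_inv \<qq> b y) > 0"
proof -
  let ?v = "stereo_proj \<qq> b y" and ?n = "stereo_dual \<qq> b" and ?a = "stereo_height \<qq> b y"
  note co = stereo_coordinates[OF y]
  have p: "stereo_proj \<qq> b (stereo_inv \<qq> b y) = (1 / ?a) *\<^sub>R ?v"
    unfolding stereo_inv_def
    by (rule stereo_proj_id[OF tangent_M_scaleR[OF stereo_proj_tangent]])
  have s: "lor ((1 / ?a) *\<^sub>R ?v) ((1 / ?a) *\<^sub>R ?v) = - 2 * lor y b / ?a"
    using a by (simp add: lor.scaleR_left lor.scaleR_right co(2))
  have d: "stereo_den \<qq> b (stereo_inv \<qq> b y) = 1 / ?a"
    unfolding stereo_den_def p s using a co(3) by (simp add: field_simps)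
  then show "stereo_den \<qq> b (stereo_inv \<qq> b y) > 0" using a by simp
  have "stereo \<qq> b (stereo_inv \<qq> b y) = ?v + ?a *\<^sub>R b - lor y b *\<^sub>R ?n"
    unfolding stereo_def p d s using a by (simp add: algebra_simps)
  then show "stereo \<qq> b (stereo_inv \<qq> b y) = y" using co(1) by simp
qed

lemma smooth_on_stereo_proj_lor: "open S \<Longrightarrow> smooth_on S (\<lambda>w. lor (stereo_proj \<qq> b w) (stereo_proj \<qq> b w))"
  by (intro smooth_on_bilinear[OF _ bounded_bilinear_lor] smooth_on_linear[OF _ bounded_linear_stereo_proj]
      smooth_on_ident)

lemma smooth_on_stereo_den: "open S \<Longrightarrow> smooth_on S (stereo_den \<qq> b)"
  unfolding stereo_den_def[abs_def]
  by (intro smooth_on_diff smooth_on_const smooth_on_mult smooth_on_stereo_proj_lor)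

lemma open_stereo_domain: "open {w. stereo_den \<qq> b w > 0}"
proof -
  have "continuous_on UNIV (stereo_den \<qq> b)"
    using smooth_on_stereo_den[of UNIV] Ck_on_continuous unfolding smooth_on_def by blast
  then show ?thesis by (intro open_Collect_less) auto
qed

text \<open>For (\<qq>, \<qq>) \<le> 0 the domain is everything. Otherwise it is a strict sublevel
  set of a positive semidefinite quadratic form, the ball model of hyperbolic space times the
  directions that \<open>stereo_proj\<close> kills.\<close>

lemma convex_stereo_domain: "convex {w. stereo_den \<qq> b w > 0}"
proof (rule convexI, clarify)
  fix v w :: "real^5" and s t :: real
  assume den: "stereo_den \<qq> b v > 0" "stereo_den \<qq> b w > 0" and st: "s \<ge> 0" "t \<ge> 0" "s + t = 1"
  let ?p = "stereo_proj \<qq> b"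
  let ?Q = "\<lambda>w. lor (?p w) (?p w)"
  have Q: "?Q w \<ge> 0" for w by (rule tangent_M_pos(1)[OF b stereo_proj_tangent])
  show "stereo_den \<qq> b (s *\<^sub>R v + t *\<^sub>R w) > 0"
  proof (cases "lor \<qq> \<qq> \<le> 0")
    case True
    then have "lor \<qq> \<qq> * ?Q (s *\<^sub>R v + t *\<^sub>R w) \<le> 0" using Q by (intro mult_nonpos_nonneg)
    then show ?thesis by (simp add: stereo_den_def)
  next
    case False
    have lin: "?p (x + y) = ?p x + ?p y" "?p (r *\<^sub>R x) = r *\<^sub>R ?p x" "?p (x - y) = ?p x - ?p y" for x y r
      using bounded_linear_stereo_proj
      by (simp_all add: bounded_linear.linear linear_add linear_scale linear_diff)
    have "?Q (s *\<^sub>R v + t *\<^sub>R w) = s * ?Q v + t * ?Q w - s * t * ?Q (v - w)"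
    proof -
      have s: "s = 1 - t" using st by simp
      show ?thesis unfolding s lin lor.add_left lor.add_right lor.diff_left lor.diff_right
          lor.scaleR_left lor.scaleR_right lor_commute[of "?p w" "?p v"] real_scaleR_def
        by algebra
    qed
    also have "\<dots> \<le> s * ?Q v + t * ?Q w" using Q st by simp
    finally have "?Q (s *\<^sub>R v + t *\<^sub>R w) \<le> s * ?Q v + t * ?Q w" .
    then have "lor \<qq> \<qq> / 4 * ?Q (s *\<^sub>R v + t *\<^sub>R w) \<le> lor \<qq> \<qq> / 4 * (s * ?Q v + t * ?Q w)"
      using False by (intro mult_left_mono) auto
    then have "stereo_den \<qq> b (s *\<^sub>R v + t *\<^sub>R w) \<ge> (s + t) - lor \<qq> \<qq> / 4 * (s * ?Q v + t * ?Q w)"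
      using st by (simp add: stereo_den_def)
    also have "(s + t) - lor \<qq> \<qq> / 4 * (s * ?Q v + t * ?Q w) = s * stereo_den \<qq> b v + t * stereo_den \<qq> b w"
      by (simp add: stereo_den_def algebra_simps)
    finally have "stereo_den \<qq> b (s *\<^sub>R v + t *\<^sub>R w) \<ge> s * stereo_den \<qq> b v + t * stereo_den \<qq> b w" .
    moreover have "s * stereo_den \<qq> b v + t * stereo_den \<qq> b w > 0"
    proof (cases "s = 0")
      case False
      then show ?thesis using den st by (intro add_pos_nonneg) auto
    qed (use den st in simp)
    ultimately show ?thesis by linarith
  qed
qed

lemma smooth_on_stereo: "smooth_on {w. stereo_den \<qq> b w > 0} (stereo \<qq> b)"
proof -
  let ?W = "{w. stereo_den \<qq> b w > 0}"
  note W = open_stereo_domain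
  have "smooth_on ?W (\<lambda>w. stereo_den \<qq> b w powr (-1))"
    by (rule smooth_on_compose[OF W open_greaterThan _ smooth_on_stereo_den[OF W] smooth_on_powr]) auto
  then have 1: "smooth_on ?W (\<lambda>w. 1 / stereo_den \<qq> b w)"
    by (rule smooth_on_cong[OF W, rotated]) (simp add: powr_minus_divide)
  have 2: "smooth_on ?W (\<lambda>w. lor (stereo_proj \<qq> b w) (stereo_proj \<qq> b w) / 2)"
    using smooth_on_linear[OF W bounded_linear_divide[of 2] smooth_on_stereo_proj_lor[OF W]] .
  show ?thesis unfolding stereo_def[abs_def]
    by (intro smooth_on_scaleR smooth_on_add W 1 2 smooth_on_const
        smooth_on_linear[OF _ bounded_linear_stereo_proj] smooth_on_ident)
qed

lemma stereo_potential_exists: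
  assumes cl: "closed_on_space_form \<qq> \<gamma>"
  shows "\<exists>g. \<forall>w. stereo_den \<qq> b w > 0 \<longrightarrow> (g has_derivative
     (\<lambda>v. \<gamma> (stereo \<qq> b w) (frechet_derivative (stereo \<qq> b) (at w) v))) (at w)"
proof -
  let ?W = "{w. stereo_den \<qq> b w > 0}"
  have M: "stereo \<qq> b ` ?W \<subseteq> space_form \<qq>" using stereo_space_form by auto
  note * = open_stereo_domain smooth_on_stereo M
  have "\<exists>g. \<forall>w\<in>?W. (g has_derivative
     (\<lambda>v. \<gamma> (stereo \<qq> b w) (frechet_derivative (stereo \<qq> b) (at w) v))) (at w)"
  proof (rule poincare_lemma_convex[OF open_stereo_domain convex_stereo_domain])
    show "linear (\<lambda>v. \<gamma> (stereo \<qq> b w) (frechet_derivative (stereo \<qq> b) (at w) v))" if "w \<in> ?W" for w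
      by (rule pullback_linear[OF cl smooth_on_has_derivative[OF *(2) that] *(1) that *(3)])
    show "Ck_on 1 ?W (\<lambda>w. \<gamma> (stereo \<qq> b w) (frechet_derivative (stereo \<qq> b) (at w) v))" for v
      using pullback_smooth[OF cl *] unfolding smooth_on_def by blast
    show "frechet_derivative (\<lambda>w. \<gamma> (stereo \<qq> b w) (frechet_derivative (stereo \<qq> b) (at w) v)) (at w) h
      = frechet_derivative (\<lambda>w. \<gamma> (stereo \<qq> b w) (frechet_derivative (stereo \<qq> b) (at w) h)) (at w) v"
      if "w \<in> ?W" for w h v
      by (rule pullback_local[OF cl * that])
  qed
  then show ?thesis by simp
qed

text \<open>Near u the map h is \<open>stereo\<close> composed with its own coordinate expression,
  so h' is the derivative of \<open>stereo\<close> applied to that of the coordinates; the chain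
  rule for g then produces \<gamma>. Positivity of the height near u is recorded for the
  gluing.\<close>

lemma stereo_potential_derivative:
  fixes h :: "'m::real_normed_vector \<Rightarrow> real^5"
  assumes g: "\<forall>w. stereo_den \<qq> b w > 0 \<longrightarrow> (g has_derivative
       (\<lambda>v. \<gamma> (stereo \<qq> b w) (frechet_derivative (stereo \<qq> b) (at w) v))) (at w)"
    and h: "(h has_derivative h') (at u)" "open S" "u \<in> S" "h ` S \<subseteq> space_form \<qq>"
    and a: "stereo_height \<qq> b (h u) > 0"
  shows "((\<lambda>t. g (stereo_inv \<qq> b (h t))) has_derivative (\<lambda>v. \<gamma> (h u) (h' v))) (at u)"
    and "\<forall>\<^sub>F t in at u. stereo_height \<qq> b (h t) > 0"
proof -
  let ?st = "stereo \<qq> b" and ?k = "\<lambda>t. stereo_inv \<qq> b (h t)"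
  have hu: "h u \<in> space_form \<qq>" using h by auto
  have ah: "((\<lambda>t. stereo_height \<qq> b (h t)) has_derivative (\<lambda>v. - lor (h' v) (stereo_dual \<qq> b))) (at u)"
    unfolding stereo_height_def
    by (intro has_derivative_minus bounded_linear.has_derivative[OF lor.bounded_linear_left] h)
  then have "continuous (at u) (\<lambda>t. stereo_height \<qq> b (h t))" by (rule has_derivative_continuous)
  then show ev: "\<forall>\<^sub>F t in at u. stereo_height \<qq> b (h t) > 0"
    using a unfolding continuous_at by (rule order_tendstoD)
  have ph: "((\<lambda>t. stereo_proj \<qq> b (h t)) has_derivative (\<lambda>v. stereo_proj \<qq> b (h' v))) (at u)"
    by (rule bounded_linear.has_derivative[OF bounded_linear_stereo_proj h(1)])
  have a0: "stereo_height \<qq> b (h u) \<noteq> 0" using a by simp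
  obtain k' where k': "(?k has_derivative k') (at u)"
    using has_derivative_scaleR[OF has_derivative_divide[OF has_derivative_const[of 1] ah a0] ph]
    unfolding stereo_inv_def by blast
  have ku: "?st (?k u) = h u" "stereo_den \<qq> b (?k u) > 0" using stereo_stereo_inv[OF hu a] by auto
  have "((\<lambda>t. ?st (?k t)) has_derivative (\<lambda>v. frechet_derivative ?st (at (?k u)) (k' v))) (at u)"
    by (rule has_derivative_compose[OF k' smooth_on_has_derivative[OF smooth_on_stereo]]) (use ku in simp)
  moreover have "\<forall>\<^sub>F t in at u. ?st (?k t) = h t"
  proof -
    have "\<forall>\<^sub>F t in at u. t \<in> S" using h by (simp add: eventually_at_in_open')
    with ev show ?thesis
      by eventually_elim (use h(4) stereo_stereo_inv in auto)
  qed
  ultimately have "(h has_derivative (\<lambda>v. frechet_derivative ?st (at (?k u)) (k' v))) (at u)"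
    by (rule has_derivative_transform_eventually) (use ku in auto)
  then have eq: "h' v = frechet_derivative ?st (at (?k u)) (k' v)" for v
    using has_derivative_unique[OF h(1)] by metis
  have "((\<lambda>t. g (?k t)) has_derivative (\<lambda>v. \<gamma> (?st (?k u)) (frechet_derivative ?st (at (?k u)) (k' v)))) (at u)"
    by (rule has_derivative_compose[OF k' g[rule_format, OF ku(2)]])
  then show "((\<lambda>t. g (?k t)) has_derivative (\<lambda>v. \<gamma> (h u) (h' v))) (at u)"
    using ku eq by simp
qed

end

text \<open>Testing along maps from \<open>real^2\<close> replaces a calculus on the space form; the
  coordinate expressions of x are such maps.\<close>

definition space_form_potential ::
    "real^5 \<Rightarrow> (real^5 \<Rightarrow> real^5 \<Rightarrow> real) \<Rightarrow> (real^5 \<Rightarrow> real) \<Rightarrow> bool" where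
  "space_form_potential \<qq> \<gamma> G \<longleftrightarrow> (\<forall>(h :: real^2 \<Rightarrow> real^5) h' u S. (h has_derivative h') (at u) \<longrightarrow>
     open S \<longrightarrow> u \<in> S \<longrightarrow> h ` S \<subseteq> space_form \<qq> \<longrightarrow>
     ((\<lambda>t. G (h t)) has_derivative (\<lambda>v. \<gamma> (h u) (h' v))) (at u))"

section \<open>Potentials on the whole space form\<close>

lemma space_form_last_nonzero:
  assumes "y \<in> space_form \<qq>" shows "y $ 5 \<noteq> 0"
proof
  assume 5: "y $ 5 = 0"
  have "(\<Sum>i\<in>{1,2,3,4::5}. (y $ i)\<^sup>2) = 0"
    using space_formD(1)[OF assms] 5 by (simp add: lor_def sum_5 sig_def power2_eq_square)
  then have "\<forall>i\<in>{1,2,3,4::5}. y $ i = 0" by (subst (asm) sum_nonneg_eq_0_iff) auto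
  then have "y = 0" using 5 by (simp add: vec_eq_iff forall_5)
  then show False using space_formD(4)[OF assms] by simp
qed

lemma lor_null_same_cone:
  assumes y: "lor y y = 0" and b: "lor b b = 0" and pos: "y $ 5 * b $ 5 > 0"
  shows "lor y b \<le> 0"
proof -
  let ?I = "{1,2,3,4::5}"
  have e: "lor a b = (\<Sum>i\<in>?I. a $ i * b $ i) - a $ 5 * b $ 5" for a b
    unfolding lor_def sum_5 by (simp add: sig_def)
  have "(\<Sum>i\<in>?I. y $ i * b $ i)\<^sup>2 \<le> (\<Sum>i\<in>?I. (y $ i)\<^sup>2) * (\<Sum>i\<in>?I. (b $ i)\<^sup>2)"
    by (rule Cauchy_Schwarz_ineq_sum)
  also have "(\<Sum>i\<in>?I. (y $ i)\<^sup>2) = (y $ 5)\<^sup>2" using y by (simp add: e power2_eq_square)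
  also have "(\<Sum>i\<in>?I. (b $ i)\<^sup>2) = (b $ 5)\<^sup>2" using b by (simp add: e power2_eq_square)
  finally have "(\<Sum>i\<in>?I. y $ i * b $ i)\<^sup>2 \<le> (y $ 5 * b $ 5)\<^sup>2" by (simp add: power_mult_distrib)
  then have "(\<Sum>i\<in>?I. y $ i * b $ i) \<le> y $ 5 * b $ 5"
    using pos by (rule power2_le_imp_le[OF _ less_imp_le])
  then show ?thesis by (simp add: e)
qed

text \<open>In stereographic coordinates about y, this is the overlap of the charts from a point of
  a sphere and from its antipode.\<close>

lemma connected_tangent_M_punctured: "connected (tangent_M \<qq> y - {0})"
proof (rule connected_punctured_convex)
  show "convex (tangent_M \<qq> y)" by (rule subspace_imp_convex[OF subspace_tangent_M])
  show "aff_dim (tangent_M \<qq> y) \<noteq> 1"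
    using dim_tangent_M[of \<qq> y] by (simp add: aff_dim_subspace[OF subspace_tangent_M])
qed

text \<open>On one half of the light cone (y, b) \<le> 0, so the height 1 - (\<qq>, \<qq>) (y, b) /
  2 is at least 1: a single chart contains the whole component.\<close>

lemma stereo_height_same_cone:
  assumes "lor \<qq> \<qq> \<ge> 0" "b \<in> space_form \<qq>" "y \<in> space_form \<qq>" "y $ 5 * b $ 5 > 0"
  shows "stereo_height \<qq> b y > 0"
proof -
  have "lor \<qq> \<qq> / 2 * lor y b \<le> 0"
    using lor_null_same_cone[of y b] assms space_formD(1) by (intro mult_nonneg_nonpos) auto
  then show ?thesis using stereo_coordinates(3)[OF assms(2,3)] by linarith
qed

text \<open>The sign of the last coordinate, which never vanishes, separates the halves of the light
  cone. Each half has its own chart, and the two potentials meet nowhere.\<close>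

lemma space_form_potential_nonneg:
  assumes cl: "closed_on_space_form \<qq> \<gamma>" and q: "lor \<qq> \<qq> \<ge> 0"
  shows "\<exists>G. space_form_potential \<qq> \<gamma> G"
proof -
  have half: "\<exists>G. \<forall>(h :: real^2 \<Rightarrow> real^5) h' u S. (h has_derivative h') (at u) \<longrightarrow>
     open S \<longrightarrow> u \<in> S \<longrightarrow> h ` S \<subseteq> space_form \<qq> \<longrightarrow> s * h u $ 5 > 0 \<longrightarrow>
     ((\<lambda>t. G (h t)) has_derivative (\<lambda>v. \<gamma> (h u) (h' v))) (at u)" if s: "s \<noteq> 0" for s :: real
  proof (cases "\<exists>b\<in>space_form \<qq>. s * b $ 5 > 0")
    case True
    then obtain b where b: "b \<in> space_form \<qq>" "s * b $ 5 > 0" by blast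
    obtain g where g: "\<forall>w. stereo_den \<qq> b w > 0 \<longrightarrow> (g has_derivative
     (\<lambda>v. \<gamma> (stereo \<qq> b w) (frechet_derivative (stereo \<qq> b) (at w) v))) (at w)"
      using stereo_potential_exists[OF b(1) cl] by blast
    show ?thesis
    proof (intro exI[of _ "\<lambda>y. g (stereo_inv \<qq> b y)"] allI impI)
      fix h :: "real^2 \<Rightarrow> real^5" and h' u S
      assume h: "(h has_derivative h') (at u)" "open S" "u \<in> S" "h ` S \<subseteq> space_form \<qq>"
        and hs: "s * h u $ 5 > 0"
      have "0 < (s * h u $ 5) * (s * b $ 5)" using hs b(2) by (rule mult_pos_pos)
      also have "\<dots> = s\<^sup>2 * (h u $ 5 * b $ 5)" by (simp add: power2_eq_square mult_ac)
      finally have "h u $ 5 * b $ 5 > 0" using s by (simp add: zero_less_mult_iff)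
      then have "stereo_height \<qq> b (h u) > 0"
        using stereo_height_same_cone[OF q b(1)] h by blast
      then show "((\<lambda>t. g (stereo_inv \<qq> b (h t))) has_derivative (\<lambda>v. \<gamma> (h u) (h' v))) (at u)"
        by (rule stereo_potential_derivative(1)[OF b(1) g h])
    qed
  next
    \<comment> \<open>The space form misses this half, so the requirement on h is vacuous.\<close>
    case False
    then show ?thesis by (intro exI[of _ "\<lambda>y. 0"]) (auto simp: image_subset_iff)
  qed
  obtain Gp where Gp: "\<forall>(h :: real^2 \<Rightarrow> real^5) h' u S. (h has_derivative h') (at u) \<longrightarrow>
     open S \<longrightarrow> u \<in> S \<longrightarrow> h ` S \<subseteq> space_form \<qq> \<longrightarrow> 1 * h u $ 5 > 0 \<longrightarrow>
     ((\<lambda>t. Gp (h t)) has_derivative (\<lambda>v. \<gamma> (h u) (h' v))) (at u)"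
    using half[OF one_neq_zero] by blast
  obtain Gm where Gm: "\<forall>(h :: real^2 \<Rightarrow> real^5) h' u S. (h has_derivative h') (at u) \<longrightarrow>
     open S \<longrightarrow> u \<in> S \<longrightarrow> h ` S \<subseteq> space_form \<qq> \<longrightarrow> (- 1) * h u $ 5 > 0 \<longrightarrow>
     ((\<lambda>t. Gm (h t)) has_derivative (\<lambda>v. \<gamma> (h u) (h' v))) (at u)"
  proof -
    have "(- 1 :: real) \<noteq> 0" by simp
    from half[OF this] show thesis using that by blast
  qed
  show ?thesis unfolding space_form_potential_def
  proof (intro exI[of _ "\<lambda>y. if y $ 5 > 0 then Gp y else Gm y"] allI impI)
    fix h :: "real^2 \<Rightarrow> real^5" and h' u S
    assume h: "(h has_derivative h') (at u)" "open S" "u \<in> S" "h ` S \<subseteq> space_form \<qq>"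
    have lim: "((\<lambda>t. h t $ 5) \<longlongrightarrow> h u $ 5) (at u)"
      using has_derivative_continuous[OF h(1)] unfolding continuous_at by (rule tendsto_vec_nth)
    have "h u $ 5 \<noteq> 0" using space_form_last_nonzero h by blast
    then consider "h u $ 5 > 0" | "h u $ 5 < 0" by linarith
    then show "((\<lambda>t. if h t $ 5 > 0 then Gp (h t) else Gm (h t)) has_derivative (\<lambda>v. \<gamma> (h u) (h' v))) (at u)"
    proof cases
      case 1
      have "\<forall>\<^sub>F t in at u. Gp (h t) = (if h t $ 5 > 0 then Gp (h t) else Gm (h t))"
        using order_tendstoD(1)[OF lim 1] by eventually_elim simp
      then show ?thesis
        using Gp[rule_format, OF h] 1 by (intro has_derivative_transform_eventually[where g = "\<lambda>t. if h t $ 5 > 0 then Gp (h t) else Gm (h t)"]) auto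
    next
      case 2
      have "\<forall>\<^sub>F t in at u. Gm (h t) = (if h t $ 5 > 0 then Gp (h t) else Gm (h t))"
        using order_tendstoD(2)[OF lim 2] by eventually_elim simp
      then show ?thesis
        using Gm[rule_format, OF h] 2 by (intro has_derivative_transform_eventually[where g = "\<lambda>t. if h t $ 5 > 0 then Gp (h t) else Gm (h t)"]) auto
    qed
  qed
qed

text \<open>If \<open>(\<qq>, \<qq>) < 0\<close>, then \<open>M\<close> is a sphere, covered by the stereographic charts from a point
  and from its antipode; their overlap is connected.\<close>

lemma space_form_potential_neg:
  assumes cl: "closed_on_space_form \<qq> \<gamma>" and q: "lor \<qq> \<qq> < 0" and b: "b \<in> space_form \<qq>"
  shows "\<exists>G. space_form_potential \<qq> \<gamma> G"
proof -
  \<comment> \<open>The antipode: it spans the other null line in the plane of b and \<qq>, and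
    since the dual vector pairs with \<qq> to (\<qq>, \<qq>) / 2, this factor normalizes the product
    to -1.\<close>
  define b' where "b' = (- 2 / lor \<qq> \<qq>) *\<^sub>R stereo_dual \<qq> b"
  have b': "b' \<in> space_form \<qq>"
    using stereo_dual_lor[OF b] q
    by (simp add: b'_def space_form_def E_plane_def lor.scaleR_left lor.scaleR_right
        lor.minus_left lor.minus_right)
  have dual': "stereo_dual \<qq> b' = (- lor \<qq> \<qq> / 2) *\<^sub>R b"
    using q unfolding stereo_dual_def[of _ b'] by (simp add: b'_def stereo_dual_def algebra_simps)
  have height': "stereo_height \<qq> b' y = lor \<qq> \<qq> / 2 * lor y b" for y
    by (simp add: stereo_height_def dual' lor.scaleR_right lor.minus_right)
  obtain g where g: "\<forall>w. stereo_den \<qq> b w > 0 \<longrightarrow> (g has_derivative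
     (\<lambda>v. \<gamma> (stereo \<qq> b w) (frechet_derivative (stereo \<qq> b) (at w) v))) (at w)"
    using stereo_potential_exists[OF b cl] by blast
  obtain g' where g': "\<forall>w. stereo_den \<qq> b' w > 0 \<longrightarrow> (g' has_derivative
     (\<lambda>v. \<gamma> (stereo \<qq> b' w) (frechet_derivative (stereo \<qq> b') (at w) v))) (at w)"
    using stereo_potential_exists[OF b' cl] by blast
  let ?G = "\<lambda>y. g (stereo_inv \<qq> b y)" and ?G' = "\<lambda>y. g' (stereo_inv \<qq> b' y)"
  let ?p = "stereo_proj \<qq> b" and ?st = "stereo \<qq> b"
  have den: "stereo_den \<qq> b w > 0" for w
  proof -
    have "lor \<qq> \<qq> / 4 * lor (?p w) (?p w) \<le> 0"
      using q tangent_M_pos(1)[OF b stereo_proj_tangent[OF b]] by (intro mult_nonpos_nonneg) auto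
    then show ?thesis by (simp add: stereo_den_def)
  qed
  have stM: "?st w \<in> space_form \<qq>" for w by (rule stereo_space_form[OF b den])
  have st_b: "lor (?st w) b = - (lor (?p w) (?p w) / 2) / stereo_den \<qq> b w" for w
    using space_formD[OF b] stereo_dual_lor[OF b] stereo_proj_orthogonal[OF b, of w]
    by (simp add: stereo_def lor.add_left lor.scaleR_left)
  have h0: "stereo_height \<qq> b (?st w) > 0" for w
  proof -
    have "stereo_height \<qq> b (?st w) = 1 / stereo_den \<qq> b w"
      using stereo_dual_lor[OF b] stereo_proj_orthogonal[OF b, of w]
      by (simp add: stereo_height_def stereo_def lor.add_left lor.scaleR_left)
    then show ?thesis using den by simp
  qed
  have h1: "stereo_height \<qq> b' (?st w) > 0" if "?p w \<noteq> 0" for w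
  proof -
    have "lor (?p w) (?p w) > 0"
      using tangent_M_pos[OF b stereo_proj_tangent[OF b], of w] that by simp
    then have "lor (?st w) b < 0" unfolding st_b using den[of w] by (simp add: divide_neg_pos)
    then show ?thesis unfolding height' using q by (simp add: mult_neg_neg)
  qed
  \<comment> \<open>The difference of the two potentials, read in the chart about b.\<close>
  define k where "k w = ?G (?st w) - ?G' (?st w)" for w
  have W': "open {w. ?p w \<noteq> 0}"
  proof -
    have "continuous_on UNIV ?p"
      by (rule linear_continuous_on[OF bounded_linear_stereo_proj[OF b]])
    then show ?thesis by (intro open_Collect_neq) auto
  qed
  have kder: "(k has_derivative (\<lambda>v. 0)) (at w)" if "?p w \<noteq> 0" for w
  proof -
    have st: "(?st has_derivative frechet_derivative ?st (at w)) (at w)"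
      by (rule smooth_on_has_derivative[OF smooth_on_stereo[OF b]]) (use den in auto)
    have "?st ` UNIV \<subseteq> space_form \<qq>" using stM by auto
    note * = st open_UNIV UNIV_I this
    show ?thesis unfolding k_def
      using has_derivative_diff[OF stereo_potential_derivative(1)[OF b g * h0]
          stereo_potential_derivative(1)[OF b' g' * h1[OF that]]] by simp
  qed
  \<comment> \<open>Zero derivative makes k locally constant, and connectedness of the overlap makes
    it constant. Genuine tangent vectors suffice, being the values of
    \<open>stereo_inv\<close>.\<close>
  have "k constant_on (tangent_M \<qq> b - {0})"
  proof (rule locally_constant_imp_constant[OF connected_tangent_M_punctured])
    fix a assume a: "a \<in> tangent_M \<qq> b - {0}"
    then have "?p a \<noteq> 0" using stereo_proj_id[OF b] by auto
    then obtain e where e: "e > 0" "ball a e \<subseteq> {w. ?p w \<noteq> 0}" using W' openE by blast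
    have "k x = k a" if "x \<in> ball a e" for x
    proof -
      obtain c where c: "\<forall>x\<in>ball a e. k x = c"
        using has_derivative_zero_constant[OF convex_ball has_derivative_at_withinI[OF kder], of a e] e(2)
        by blast
      have "k a = c" by (rule bspec[OF c]) (use e(1) in simp)
      then show ?thesis using bspec[OF c that] by simp
    qed
    then have "\<forall>x\<in>(tangent_M \<qq> b - {0}) \<inter> ball a e. k x = k a" by blast
    moreover have "a \<in> (tangent_M \<qq> b - {0}) \<inter> ball a e" using e(1) a by simp
    ultimately show "\<exists>T. openin (top_of_set (tangent_M \<qq> b - {0})) T \<and> a \<in> T \<and> (\<forall>x\<in>T. k x = k a)"
      using openin_open_Int[OF open_ball] by blast
  qed
  then obtain C where C: "\<And>w. w \<in> tangent_M \<qq> b - {0} \<Longrightarrow> k w = C" unfolding constant_on_def by blast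
  have overlap: "?G y = ?G' y + C"
    if y: "y \<in> space_form \<qq>" "stereo_height \<qq> b y > 0" "stereo_height \<qq> b' y > 0" for y
  proof -
    let ?w = "stereo_inv \<qq> b y"
    have "lor (?p y) (?p y) \<noteq> 0"
      using stereo_coordinates(2)[OF b y(1)] y(2,3) unfolding height' by auto
    then have "?p y \<noteq> 0" by (auto simp: lor.zero_left)
    then have "?w \<in> tangent_M \<qq> b - {0}"
      using tangent_M_scaleR[OF stereo_proj_tangent[OF b]] y(2) by (simp add: stereo_inv_def)
    from C[OF this] show ?thesis
      using stereo_stereo_inv(1)[OF b y(1,2)] by (simp add: k_def)
  qed
  \<comment> \<open>The two heights add up to 1.\<close>
  have cover: "stereo_height \<qq> b y > 0 \<or> stereo_height \<qq> b' y > 0" if y: "y \<in> space_form \<qq>" for y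
    using stereo_coordinates(3)[OF b y] unfolding height' by argo
  show ?thesis unfolding space_form_potential_def
  proof (intro exI[of _ "\<lambda>y. if stereo_height \<qq> b y > 0 then ?G y else ?G' y + C"] allI impI)
    fix h :: "real^2 \<Rightarrow> real^5" and h' u S
    assume h: "(h has_derivative h') (at u)" "open S" "u \<in> S" "h ` S \<subseteq> space_form \<qq>"
    have hS: "\<forall>\<^sub>F t in at u. h t \<in> space_form \<qq>"
      using h by (intro eventually_at_topological[THEN iffD2] exI[of _ S]) auto
    have hu: "h u \<in> space_form \<qq>" using h by blast
    consider "stereo_height \<qq> b (h u) > 0" | "stereo_height \<qq> b' (h u) > 0" using cover[OF hu] by blast
    then show "((\<lambda>t. if stereo_height \<qq> b (h t) > 0 then ?G (h t) else ?G' (h t) + C)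
        has_derivative (\<lambda>v. \<gamma> (h u) (h' v))) (at u)"
    proof cases
      case 1
      note der = stereo_potential_derivative[OF b g h 1]
      have "\<forall>\<^sub>F t in at u. ?G (h t) = (if stereo_height \<qq> b (h t) > 0 then ?G (h t) else ?G' (h t) + C)"
        using der(2) by eventually_elim simp
      then show ?thesis by (rule has_derivative_transform_eventually[OF der(1)]) (use 1 in auto)
    next
      case 2
      note der = stereo_potential_derivative[OF b' g' h 2]
      have "\<forall>\<^sub>F t in at u. ?G' (h t) + C = (if stereo_height \<qq> b (h t) > 0 then ?G (h t) else ?G' (h t) + C)"
        using der(2) hS by eventually_elim (use overlap in simp)
      then show ?thesis
        by (rule has_derivative_transform_eventually[OF has_derivative_add_const[OF der(1)]])
          (use overlap[OF hu] 2 in auto)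
    qed
  qed
qed

lemma space_form_potential_exists:
  assumes "closed_on_space_form \<qq> \<gamma>"
  shows "\<exists>G. space_form_potential \<qq> \<gamma> G"
proof (cases "lor \<qq> \<qq> < 0")
  case True
  show ?thesis
  proof (cases "space_form \<qq> = {}")
    case False
    then show ?thesis using space_form_potential_neg[OF assms True] by blast
  qed (auto simp: space_form_potential_def)
qed (use space_form_potential_nonneg[OF assms] in simp)


section \<open>Adapted frames and the unit normal\<close>

lemma det_rows_2: "det (vector [v, w] :: real^2^2) = v $ 1 * w $ 2 - v $ 2 * w $ 1"
  by (simp add: det_2)

text \<open>Gram-Schmidt applied to the images of the standard basis. The orientation comes for
  free: a is a positive multiple of the first basis vector, and b has positive second
  coordinate.\<close>

lemma exists_adapted_frame:
  fixes L :: "real^2 \<Rightarrow> real^5"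
  assumes y: "y \<in> space_form \<qq>" and L: "linear L" "inj L" "\<And>v. L v \<in> tangent_M \<qq> y"
  shows "\<exists>a b. lor (L a) (L a) = 1 \<and> lor (L b) (L b) = 1 \<and> lor (L a) (L b) = 0 \<and> det (vector [a, b]) > 0"
proof -
  let ?u = "axis 1 1 :: real^2" and ?w = "axis 2 1 :: real^2"
  have pos: "lor (L v) (L v) > 0" if "v \<noteq> 0" for v
  proof -
    have "L v \<noteq> 0" using that L(1,2) linear_injective_0 by blast
    then show ?thesis using tangent_M_pos[OF y L(3)[of v]] by simp
  qed
  define a where "a = (1 / sqrt (lor (L ?u) (L ?u))) *\<^sub>R ?u"
  have pu: "lor (L ?u) (L ?u) > 0" by (rule pos) (simp add: axis_eq_0_iff)
  have a: "lor (L a) (L a) = 1"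
    using pu by (simp add: a_def linear_scale[OF L(1)] lor.scaleR_left lor.scaleR_right)
  define r where "r = ?w - lor (L ?w) (L a) *\<^sub>R a"
  have r2: "r $ 2 = 1" "a $ 2 = 0" "a $ 1 > 0" using pu by (simp_all add: r_def a_def axis_def)
  have pr: "lor (L r) (L r) > 0" using r2(1) by (intro pos) auto
  have ra: "lor (L r) (L a) = 0"
    using a by (simp add: r_def linear_diff[OF L(1)] linear_scale[OF L(1)] lor.diff_left lor.scaleR_left)
  define b where "b = (1 / sqrt (lor (L r) (L r))) *\<^sub>R r"
  have "lor (L b) (L b) = 1"
    using pr by (simp add: b_def linear_scale[OF L(1)] lor.scaleR_left lor.scaleR_right)
  moreover have "lor (L a) (L b) = 0"
    using ra by (simp add: b_def linear_scale[OF L(1)] lor.scaleR_right lor_commute)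
  moreover have "det (vector [a, b]) > 0"
    using r2 pr by (simp add: det_rows_2 b_def)
  ultimately show ?thesis using a by blast
qed

text \<open>Linear algebra at one point: L plays the role of dx read in a chart, and
  \<open>ca\<close>, \<open>cb\<close> are coordinates with respect to the frame. The definite
  descriptions are evaluated in these coordinates.\<close>

locale adapted_frame = volume_form +
  fixes \<qq> y :: "real^5" and L :: "real^2 \<Rightarrow> real^5" and a b :: "real^2"
  assumes y: "y \<in> space_form \<qq>"
    and L: "linear L" and LT: "L v \<in> tangent_M \<qq> y"
    and orthonormal: "lor (L a) (L a) = 1" "lor (L b) (L b) = 1" "lor (L a) (L b) = 0"
    and oriented: "det (vector [a, b]) > 0"
begin

definition ca :: "real^2 \<Rightarrow> real" where "ca v = lor (L v) (L a)"
definition cb :: "real^2 \<Rightarrow> real" where "cb v = lor (L v) (L b)"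
text \<open>The cross product of \<open>L a\<close> and \<open>L b\<close> in the tangent space of
  the space form, written as the metric dual of the functional z \<mapsto> det(y, \<qq>, z, L a, L
  b).\<close>

definition n :: "real^5" where "n = (\<chi> i. sig i * dv y \<qq> (axis i 1) (L a) (L b))"

lemma frame_expand: "v = ca v *\<^sub>R a + cb v *\<^sub>R b"
proof -
  let ?d = "a $ 1 * b $ 2 - a $ 2 * b $ 1"
  have d: "?d \<noteq> 0" using oriented by (simp add: det_rows_2)
  define s t where "s = (v $ 1 * b $ 2 - v $ 2 * b $ 1) / ?d" and "t = (a $ 1 * v $ 2 - a $ 2 * v $ 1) / ?d"
  have "?d *\<^sub>R v = (v $ 1 * b $ 2 - v $ 2 * b $ 1) *\<^sub>R a + (a $ 1 * v $ 2 - a $ 2 * v $ 1) *\<^sub>R b"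
    by (simp add: vec_eq_iff forall_2 algebra_simps)
  then have "(1 / ?d) *\<^sub>R (?d *\<^sub>R v) = s *\<^sub>R a + t *\<^sub>R b"
    by (simp add: s_def t_def scaleR_add_right)
  then have v: "v = s *\<^sub>R a + t *\<^sub>R b" using d by simp
  then have "L v = s *\<^sub>R L a + t *\<^sub>R L b" by (simp add: linear_add[OF L] linear_scale[OF L])
  then have "ca v = s" "cb v = t"
    using orthonormal lor_commute[of "L b" "L a"] by (simp_all add: ca_def cb_def lor.add_left lor.scaleR_left)
  with v show ?thesis by simp
qed

lemma L_expand: "L v = ca v *\<^sub>R L a + cb v *\<^sub>R L b"
  using arg_cong[OF frame_expand, of L v] by (simp add: linear_add[OF L] linear_scale[OF L])

lemma lor_L: "lor (L v) (L w) = ca v * ca w + cb v * cb w"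
  unfolding L_expand[of v] L_expand[of w] using orthonormal lor_commute[of "L b" "L a"]
  by (simp add: lor.add_left lor.add_right lor.scaleR_left lor.scaleR_right)

lemma ca_cb_frame: "ca a = 1" "ca b = 0" "cb a = 0" "cb b = 1"
  using orthonormal lor_commute[of "L b" "L a"] by (simp_all add: ca_def cb_def)

lemma ca_cb_combination: "ca (s *\<^sub>R a + t *\<^sub>R b) = s" "cb (s *\<^sub>R a + t *\<^sub>R b) = t"
  using orthonormal lor_commute[of "L b" "L a"]
  by (simp_all add: ca_def cb_def linear_add[OF L] linear_scale[OF L] lor.add_left lor.scaleR_left)

lemma frame_eqI: "ca v = ca w \<Longrightarrow> cb v = cb w \<Longrightarrow> v = w"
  by (metis frame_expand)

lemma det_frame: "det (vector [v, w]) = (ca v * cb w - cb v * ca w) * det (vector [a, b])"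
proof -
  have "det (vector [s *\<^sub>R a + t *\<^sub>R b, s' *\<^sub>R a + t' *\<^sub>R b]) = (s * t' - t * s') * det (vector [a, b])" for s t s' t'
    by (simp add: det_rows_2 algebra_simps)
  from this[of "ca v" "cb v" "ca w" "cb w"] show ?thesis unfolding frame_expand[symmetric] .
qed

text \<open>The Gram determinant is the square of the signed frame area, and a positively oriented
  frame restores the sign lost in the root.\<close>

lemma frame_area:
  "sgn (det (vector [v, w])) * sqrt (lor (L v) (L v) * lor (L w) (L w) - (lor (L v) (L w))\<^sup>2)
    = ca v * cb w - cb v * ca w"
proof -
  have "lor (L v) (L v) * lor (L w) (L w) - (lor (L v) (L w))\<^sup>2 = (ca v * cb w - cb v * ca w)\<^sup>2"
    unfolding lor_L by (simp add: power2_eq_square algebra_simps)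
  moreover have "sgn (det (vector [v, w])) = sgn (ca v * cb w - cb v * ca w)"
    using oriented by (simp add: det_frame[of v w] sgn_mult)
  ultimately show ?thesis
    by (simp only: real_sqrt_abs sgn_mult_abs mult_sgn_abs)
qed

lemma lor_n: "lor n z = dv y \<qq> z (L a) (L b)"
  unfolding n_def by (rule lor_dual[OF dv_linear(3)])

lemma n_tangent: "n \<in> tangent_M \<qq> y"
  by (simp add: tangent_M_def lor_n dv_eq_0)

lemma lor_n_L: "lor n (L v) = 0"
  unfolding L_expand[of v] by (simp add: lor.add_right lor.scaleR_right lor_n dv_eq_0)

text \<open>A unit tangent vector orthogonal to the frame completes an orthonormal triple, so its
  product with n is 1 or -1. Some such vector exists, whence n is nonzero; then the normalized n is
  itself one.\<close>

lemma lor_n_n: "lor n n = 1"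
proof -
  note pos = tangent_M_pos[OF y]
  have "card {y, \<qq>, L a, L b} < 5"
    using card_length[of "[y, \<qq>, L a, L b]"] by simp
  then obtain m where m: "m \<noteq> 0" "\<forall>v\<in>{y, \<qq>, L a, L b}. lor m v = 0"
    using lor_orthogonal_exists[of "{y, \<qq>, L a, L b}"] by blast
  have mT: "m \<in> tangent_M \<qq> y" using m by (simp add: tangent_M_def)
  have unit: "\<bar>lor n ((1 / sqrt (lor z z)) *\<^sub>R z)\<bar> = 1"
    if "z \<noteq> 0" "z \<in> tangent_M \<qq> y" "lor z (L a) = 0" "lor z (L b) = 0" for z
  proof -
    have "lor z z > 0" using pos[OF that(2)] that(1) by simp
    then show ?thesis unfolding lor_n using that orthonormal
      by (intro dv_orthonormal[OF y tangent_M_scaleR LT LT]) (auto simp: lor.scaleR_left lor.scaleR_right)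
  qed
  have "lor n m \<noteq> 0"
    using unit[OF m(1) mT] m by (auto simp: lor.scaleR_right)
  then have n0: "n \<noteq> 0" by (auto simp: lor.zero_left)
  have "\<bar>lor n ((1 / sqrt (lor n n)) *\<^sub>R n)\<bar> = 1"
    by (rule unit[OF n0 n_tangent lor_n_L lor_n_L])
  moreover have "lor n n > 0" using pos[OF n_tangent] n0 by simp
  ultimately have "lor n n = sqrt (lor n n)" by (simp add: lor.scaleR_right field_simps)
  then have "lor n n * lor n n = lor n n" using \<open>lor n n > 0\<close> by (metis less_imp_le real_sqrt_mult_self abs_of_nonneg)
  then show ?thesis using \<open>lor n n > 0\<close> by simp
qed

lemma dv_frame: "dv y \<qq> z (L v) (L w) = (ca v * cb w - cb v * ca w) * lor n z"
proof -
  have "dv y \<qq> z (s *\<^sub>R L a + t *\<^sub>R L b) (s' *\<^sub>R L a + t' *\<^sub>R L b) = (s * t' - t * s') * lor n z" for s t s' t'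
    using dv_swap(4)[of y \<qq> z "L b" "L a"]
    by (simp add: lor_n dv_add dv_scaleR dv_eq_0 algebra_simps)
  from this[of "ca v" "cb v" "ca w" "cb w"] show ?thesis unfolding L_expand[symmetric] .
qed

text \<open>Otherwise the normalized z would complete an orthonormal triple and have product 1 or -1
  with n.\<close>

lemma tangent_eq_frameI:
  assumes "z \<in> tangent_M \<qq> y" "lor z n = 0" "lor z (L a) = 0" "lor z (L b) = 0"
  shows "z = 0"
proof (rule ccontr)
  assume "z \<noteq> 0"
  then have p: "lor z z > 0" using tangent_M_pos[OF y assms(1)] by simp
  then have "\<bar>lor n ((1 / sqrt (lor z z)) *\<^sub>R z)\<bar> = 1" unfolding lor_n using assms orthonormal
    by (intro dv_orthonormal[OF y tangent_M_scaleR LT LT]) (auto simp: lor.scaleR_left lor.scaleR_right)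
  then show False using assms(2) by (simp add: lor.scaleR_right lor_commute)
qed

lemma tangent_expand:
  assumes "z \<in> tangent_M \<qq> y"
  shows "z = lor z (L a) *\<^sub>R L a + lor z (L b) *\<^sub>R L b + lor z n *\<^sub>R n"
proof -
  let ?r = "z - (lor z (L a) *\<^sub>R L a + lor z (L b) *\<^sub>R L b + lor z n *\<^sub>R n)"
  have "?r = 0"
  proof (rule tangent_eq_frameI)
    show "?r \<in> tangent_M \<qq> y"
      by (intro tangent_M_diff tangent_M_add tangent_M_scaleR LT n_tangent assms)
  qed (use orthonormal lor_n_L lor_n_n in \<open>simp_all add: lor.diff_left lor.add_left lor.scaleR_left
      lor_commute[of "L a" n] lor_commute[of "L b" n] lor_commute[of "L b" "L a"]\<close>)
  then show ?thesis by simp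
qed

text \<open>Two unit vectors with product 1 differ by a vector of length zero, and the tangent space
  is definite.\<close>

lemma n_unique:
  assumes "m \<in> tangent_M \<qq> y" "lor m m = 1" "dv y \<qq> m (L a) (L b) = 1"
  shows "m = n"
proof -
  have "lor n m = 1" using assms(3) by (simp add: lor_n)
  then have "lor (n - m) (n - m) = 0"
    using assms(2) lor_n_n by (simp add: lor.diff_left lor.diff_right lor_commute[of m n])
  then show ?thesis using tangent_M_pos(2)[OF y tangent_M_diff[OF n_tangent assms(1)]] by simp
qed

end

section \<open>The unit normal of an immersed surface\<close>

locale immersed_surface = surface A + volume_form D
  for A :: "('a::{t2_space,second_countable_topology}) chart set" and D +
  fixes \<qq> :: "real^5" and x :: "'a \<Rightarrow> real^5"
  assumes imm: "immersion A \<qq> x"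
begin

abbreviation "N \<equiv> unit_normal A D \<qq> x"
abbreviation "dX c p \<equiv> frechet_derivative (\<lambda>u. x (chart_inv c u)) (at (snd c p))"
abbreviation "dN c p \<equiv> frechet_derivative (\<lambda>u. N (chart_inv c u)) (at (snd c p))"

lemma smooth_x: "smooth_map A x" and x_space_form: "x p \<in> space_form \<qq>"
  using imm by (auto simp: immersion_def)

lemma dX_has_derivative:
  "c \<in> A \<Longrightarrow> p \<in> fst c \<Longrightarrow> ((\<lambda>u. x (chart_inv c u)) has_derivative dX c p) (at (snd c p))"
  by (rule smooth_map_has_derivative[OF smooth_x])

lemma dX_tangent: "c \<in> A \<Longrightarrow> p \<in> fst c \<Longrightarrow> dX c p v \<in> tangent_M \<qq> (x p)"
  using space_form_derivative_tangent[OF dX_has_derivative chart_homeomorphism(2), where \<qq> = \<qq>]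
    x_space_form chart_inv_snd by (metis (no_types, lifting) image_eqI image_subsetI)

lemma differential_x:
  "c \<in> A \<Longrightarrow> p \<in> fst c \<Longrightarrow> U \<in> tangent A p \<Longrightarrow> differential A x p U = dX c p (U c)"
  by (rule differential_chart[OF smooth_x])

lemma dx_tangent: "U \<in> tangent A p \<Longrightarrow> differential A x p U \<in> tangent_M \<qq> (x p)"
  using differential_x[OF chart_at_in] dX_tangent[OF chart_at_in] by metis

lemma inj_dX:
  assumes c: "c \<in> A" "p \<in> fst c" shows "inj (dX c p)"
proof (rule injI)
  fix v w assume "dX c p v = dX c p w"
  then have "differential A x p (coord_vec A c p v) = differential A x p (coord_vec A c p w)"
    using c by (simp add: differential_x coord_vec_tangent coord_vec_self)
  then have "coord_vec A c p v = coord_vec A c p w"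
    using imm coord_vec_tangent[OF c] unfolding immersion_def by (meson inj_onD)
  then show "v = w" using coord_vec_self[OF c] by metis
qed

lemma obtain_frame:
  assumes c: "c \<in> A" "p \<in> fst c"
  obtains a b where "adapted_frame D \<qq> (x p) (dX c p) a b"
proof -
  have lin: "linear (dX c p)" by (rule has_derivative_linear[OF dX_has_derivative[OF c]])
  obtain a b where "lor (dX c p a) (dX c p a) = 1" "lor (dX c p b) (dX c p b) = 1"
    "lor (dX c p a) (dX c p b) = 0" "det (vector [a, b]) > 0"
    using exists_adapted_frame[OF x_space_form lin inj_dX[OF c] dX_tangent[OF c]] by blast
  then have "adapted_frame D \<qq> (x p) (dX c p) a b"
    by (intro adapted_frame.intro adapted_frame_axioms.intro volume_form_axioms x_space_form lin
        dX_tangent[OF c])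
  then show thesis by (rule that)
qed

lemma fundI_chart:
  "c \<in> A \<Longrightarrow> p \<in> fst c \<Longrightarrow> U \<in> tangent A p \<Longrightarrow> V \<in> tangent A p \<Longrightarrow>
    fundI A x p U V = lor (dX c p (U c)) (dX c p (V c))"
  by (simp add: fundI_def differential_x)

lemma area_form_chart:
  assumes c: "c \<in> A" "p \<in> fst c" and fr: "adapted_frame D \<qq> (x p) (dX c p) a b"
    and UV: "U \<in> tangent A p" "V \<in> tangent A p"
  shows "area_form A x p U V = adapted_frame.ca (dX c p) a (U c) * adapted_frame.cb (dX c p) b (V c)
      - adapted_frame.cb (dX c p) b (U c) * adapted_frame.ca (dX c p) a (V c)"
proof -
  interpret adapted_frame D \<qq> "x p" "dX c p" a b by (rule fr)
  show ?thesis
    using frame_area[of "U c" "V c"] UV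
    by (simp add: area_form_def orient_sgn_chart[OF c] fundI_chart[OF c])
qed

lemma unit_normal_frame:
  assumes c: "c \<in> A" "p \<in> fst c" and fr: "adapted_frame D \<qq> (x p) (dX c p) a b"
  shows "N p = adapted_frame.n D \<qq> (x p) (dX c p) a b"
proof -
  interpret adapted_frame D \<qq> "x p" "dX c p" a b by (rule fr)
  note t = coord_vec_tangent[OF c] and s = coord_vec_self[OF c]
  show ?thesis unfolding unit_normal_def
  proof (rule the_equality)
    show "n \<in> tangent_M \<qq> (x p) \<and> lor n n = 1 \<and> (\<forall>U\<in>tangent A p. lor n (differential A x p U) = 0) \<and>
      (\<forall>U\<in>tangent A p. \<forall>V\<in>tangent A p.
         vol_M D \<qq> (x p) n (differential A x p U) (differential A x p V) = area_form A x p U V)"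
      using n_tangent lor_n_n lor_n_L
      by (simp add: differential_x[OF c] vol_M_def dv_frame area_form_chart[OF c fr])
  next
    fix m assume m: "m \<in> tangent_M \<qq> (x p) \<and> lor m m = 1 \<and> (\<forall>U\<in>tangent A p. lor m (differential A x p U) = 0) \<and>
      (\<forall>U\<in>tangent A p. \<forall>V\<in>tangent A p.
         vol_M D \<qq> (x p) m (differential A x p U) (differential A x p V) = area_form A x p U V)"
    then have "vol_M D \<qq> (x p) m (differential A x p (coord_vec A c p a)) (differential A x p (coord_vec A c p b))
      = area_form A x p (coord_vec A c p a) (coord_vec A c p b)"
      using t by blast
    then have "dv (x p) \<qq> m (dX c p a) (dX c p b) = 1"
      by (simp add: vol_M_def differential_x[OF c t] s area_form_chart[OF c fr t t] ca_cb_frame)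
    then show "m = n" using m n_unique by blast
  qed
qed

text \<open>The adapted frame is chosen separately at each point. Here N is expressed through the
  coordinate fields and their Gram determinant, from which its smoothness can be read off.\<close>

lemma lor_unit_normal:
  assumes c: "c \<in> A" "p \<in> fst c"
  defines "e1 \<equiv> axis 1 1 :: real^2" and "e2 \<equiv> axis 2 1 :: real^2"
  defines "W \<equiv> lor (dX c p e1) (dX c p e1) * lor (dX c p e2) (dX c p e2) - (lor (dX c p e1) (dX c p e2))\<^sup>2"
  shows "W > 0" "lor (N p) z = dv (x p) \<qq> z (dX c p e1) (dX c p e2) * W powr (- 1 / 2)"
proof -
  obtain a b where fr: "adapted_frame D \<qq> (x p) (dX c p) a b" by (rule obtain_frame[OF c])
  interpret adapted_frame D \<qq> "x p" "dX c p" a b by (rule fr)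
  \<comment> \<open>The frame area of the coordinate parallelogram: positive because both bases of
    the plane are positively oriented, hence equal to the root of W.\<close>
  define t where "t = ca e1 * cb e2 - cb e1 * ca e2"
  have d: "det (vector [e1, e2] :: real^2^2) = 1" by (simp add: det_rows_2 e1_def e2_def axis_def)
  have "t * det (vector [a, b]) = 1" using d by (simp add: det_frame[of e1 e2] t_def)
  then have t: "t > 0" using oriented zero_less_mult_pos2[of t "det (vector [a, b])"] by simp
  have "sqrt W = t" using frame_area[of e1 e2] d by (simp add: W_def t_def)
  have "0 < sqrt W" using t \<open>sqrt W = t\<close> by simp
  then show W: "W > 0" by simp
  have "W powr (- 1 / 2) = 1 / t"
    using W \<open>sqrt W = t\<close> by (simp add: powr_minus_divide powr_half_sqrt)
  then show "lor (N p) z = dv (x p) \<qq> z (dX c p e1) (dX c p e2) * W powr (- 1 / 2)"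
    using t unfolding unit_normal_frame[OF c fr] dv_frame by (simp add: t_def)
qed

lemma smooth_on_dv:
  assumes S: "open S" and f: "smooth_on S f" "smooth_on S g" "smooth_on S h"
  shows "smooth_on S (\<lambda>u. dv (f u) \<qq> z (g u) (h u))"
proof -
  have 1: "dv p \<qq> z r s = (\<Sum>i\<in>UNIV. p $ i * dv (axis i 1) \<qq> z r s)"
    "dv p \<qq> z r s = (\<Sum>i\<in>UNIV. r $ i * dv p \<qq> z (axis i 1) s)"
    "dv p \<qq> z r s = (\<Sum>i\<in>UNIV. s $ i * dv p \<qq> z r (axis i 1))" for p r s
    by (rule linear_expand_axis[OF dv_linear(1)] linear_expand_axis[OF dv_linear(4)]
        linear_expand_axis[OF dv_linear(5)])+
  have "dv (f u) \<qq> z (g u) (h u) = (\<Sum>k\<in>UNIV. h u $ k * (\<Sum>j\<in>UNIV. g u $ j * (\<Sum>i\<in>UNIV. f u $ i *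
      dv (axis i 1) \<qq> z (axis j 1) (axis k 1))))" for u
    by (simp only: 1(1)[of "f u"] 1(2)[of _ "g u"] 1(3)[of _ _ "h u"])
  then show ?thesis
    by (simp, intro smooth_on_sum smooth_on_mult S smooth_on_const
        smooth_on_linear[OF _ bounded_linear_vec_nth] f)
qed

lemma smooth_N: "smooth_map A N"
  unfolding smooth_map_def o_def
proof
  fix c assume c: "c \<in> A"
  let ?O = "snd c ` fst c" and ?X = "\<lambda>u. x (chart_inv c u)"
  note O = chart_homeomorphism(2)[OF c]
  let ?d = "\<lambda>i u. frechet_derivative ?X (at u) (axis i 1)"
  let ?W = "\<lambda>u. lor (?d 1 u) (?d 1 u) * lor (?d 2 u) (?d 2 u) - lor (?d 1 u) (?d 2 u) * lor (?d 1 u) (?d 2 u)"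
  have X: "smooth_on ?O ?X" by (rule smooth_map_chart[OF smooth_x c])
  note d = smooth_on_derivative[OF X]
  have u: "chart_inv c u \<in> fst c" "snd c (chart_inv c u) = u" if "u \<in> ?O" for u
    using chart_inv_in[OF c that] snd_chart_inv[OF c that] .
  have W0: "?W ` ?O \<subseteq> {0<..}"
  proof (rule image_subsetI)
    fix v assume v: "v \<in> ?O"
    from lor_unit_normal(1)[OF c u(1)[OF v]] show "?W v \<in> {0<..}"
      by (simp add: power2_eq_square u(2)[OF v])
  qed
  have W1: "smooth_on ?O ?W"
    by (intro smooth_on_diff smooth_on_mult smooth_on_bilinear[OF _ bounded_bilinear_lor] d O)
  have W: "smooth_on ?O (\<lambda>u. ?W u powr (- 1 / 2))"
    by (rule smooth_on_compose[OF O open_greaterThan W0 W1 smooth_on_powr])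
  show "smooth_on ?O (\<lambda>u. N (chart_inv c u))"
  proof (rule smooth_on_vec[OF O])
    fix i
    have "smooth_on ?O (\<lambda>u. sig i * (dv (?X u) \<qq> (axis i 1) (?d 1 u) (?d 2 u) * ?W u powr (- 1 / 2)))"
      by (intro smooth_on_mult smooth_on_const O W smooth_on_dv X d)
    then show "smooth_on ?O (\<lambda>u. N (chart_inv c u) $ i)"
    proof (rule smooth_on_cong[OF O, rotated])
      fix u assume "u \<in> ?O"
      have "N (chart_inv c u) $ i = sig i * lor (N (chart_inv c u)) (axis i 1)"
        by (simp add: lor_axis sig_def)
      then show "sig i * (dv (?X u) \<qq> (axis i 1) (?d 1 u) (?d 2 u) * ?W u powr (- 1 / 2)) = N (chart_inv c u) $ i"
        using lor_unit_normal(2)[OF c u(1)[OF \<open>u \<in> ?O\<close>], of "axis i 1"] u(2)[OF \<open>u \<in> ?O\<close>]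
        by (simp add: power2_eq_square)
    qed
  qed
qed

end


section \<open>Second fundamental form and Hopf differential\<close>

lemma so41_diff:
  assumes "Y \<in> so41" "Z \<in> so41" shows "Y - Z \<in> so41"
  unfolding so41_def
proof (intro CollectI allI)
  fix v w
  have "lor (Y *v v) w + lor v (Y *v w) = 0" "lor (Z *v v) w + lor v (Z *v w) = 0"
    using assms by (simp_all add: so41_def)
  then show "lor ((Y - Z) *v v) w + lor v ((Y - Z) *v w) = 0"
    by (simp add: matrix_vector_mult_diff_rdistrib lor.diff_left lor.diff_right)
qed

context surface
begin

lemma differential_bilinear:
  assumes "smooth_map A f" "smooth_map A g" "bounded_bilinear B" "U \<in> tangent A p"
  shows "differential A (\<lambda>p. B (f p) (g p)) p U = B (f p) (differential A g p U) + B (differential A f p U) (g p)"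
  using assms chart_at_in[of p] chart_inv_snd[OF chart_at_in, of p]
  by (subst differential_eqI[OF bounded_bilinear.FDERIV[OF assms(3) smooth_map_has_derivative[OF assms(1)]
        smooth_map_has_derivative[OF assms(2)]]])
    (auto simp: differential_chart)

lemma smooth_map_bilinear:
  "smooth_map A f \<Longrightarrow> smooth_map A g \<Longrightarrow> bounded_bilinear B \<Longrightarrow> smooth_map A (\<lambda>p. B (f p) (g p))"
  unfolding smooth_map_def o_def using smooth_on_bilinear chart_homeomorphism(2) by blast

end

context immersed_surface
begin

lemma N_tangent: "N p \<in> tangent_M \<qq> (x p)"
  and lor_N_N: "lor (N p) (N p) = 1"
  and lor_N_dX: "c \<in> A \<Longrightarrow> p \<in> fst c \<Longrightarrow> lor (N p) (dX c p v) = 0"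
proof -
  obtain a b where fr: "adapted_frame D \<qq> (x p) (dX (chart_at A p) p) a b"
    by (rule obtain_frame[OF chart_at_in])
  show "N p \<in> tangent_M \<qq> (x p)" "lor (N p) (N p) = 1"
    using adapted_frame.n_tangent[OF fr] adapted_frame.lor_n_n[OF fr] unit_normal_frame[OF chart_at_in fr]
    by simp_all
next
  assume c: "c \<in> A" "p \<in> fst c"
  obtain a b where fr: "adapted_frame D \<qq> (x p) (dX c p) a b" by (rule obtain_frame[OF c])
  show "lor (N p) (dX c p v) = 0"
    using adapted_frame.lor_n_L[OF fr] unit_normal_frame[OF c fr] by simp
qed

lemma dN_has_derivative:
  "c \<in> A \<Longrightarrow> p \<in> fst c \<Longrightarrow> ((\<lambda>u. N (chart_inv c u)) has_derivative dN c p) (at (snd c p))"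
  by (rule smooth_map_has_derivative[OF smooth_N])

lemma differential_N:
  "c \<in> A \<Longrightarrow> p \<in> fst c \<Longrightarrow> U \<in> tangent A p \<Longrightarrow> differential A N p U = dN c p (U c)"
  by (rule differential_chart[OF smooth_N])

lemma lor_const_derivative:
  assumes c: "c \<in> A" "p \<in> fst c"
    and f: "(f has_derivative f') (at (snd c p))" and g: "(g has_derivative g') (at (snd c p))"
    and const: "\<And>r. r \<in> fst c \<Longrightarrow> lor (f (snd c r)) (g (snd c r)) = k"
  shows "lor (f (snd c p)) (g' v) + lor (f' v) (g (snd c p)) = 0"
proof -
  have "((\<lambda>u. lor (f u) (g u)) has_derivative (\<lambda>v. lor (f (snd c p)) (g' v) + lor (f' v) (g (snd c p)))) (at (snd c p))"
    by (rule bounded_bilinear.FDERIV[OF bounded_bilinear_lor f g])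
  then have "((\<lambda>u. k) has_derivative (\<lambda>v. lor (f (snd c p)) (g' v) + lor (f' v) (g (snd c p)))) (at (snd c p))"
    by (rule has_derivative_transform_within_open[OF _ chart_homeomorphism(2)[OF c(1)]])
      (use c const in auto)
  from has_derivative_unique[OF this has_derivative_const] show ?thesis by (rule fun_cong)
qed

lemma lor_dN:
  assumes c: "c \<in> A" "p \<in> fst c"
  shows "lor (dN c p v) (x p) = 0" "lor (dN c p v) \<qq> = 0" "lor (dN c p v) (N p) = 0"
proof -
  have s: "chart_inv c (snd c r) = r" if "r \<in> fst c" for r using chart_inv_snd[OF c(1) that] .
  have "lor (N p) (dX c p v) + lor (dN c p v) (x p) = 0"
    using lor_const_derivative[OF c dN_has_derivative[OF c] dX_has_derivative[OF c], of 0 v]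
      tangent_M_commute[OF N_tangent] by (simp add: s c)
  then show "lor (dN c p v) (x p) = 0" using lor_N_dX[OF c] by simp
  show "lor (dN c p v) \<qq> = 0"
    using lor_const_derivative[OF c dN_has_derivative[OF c] has_derivative_const[of \<qq>], of 0 v]
      tangent_M_commute[OF N_tangent] by (simp add: s c lor.zero_right)
  have "lor (N p) (dN c p v) + lor (dN c p v) (N p) = 0"
    using lor_const_derivative[OF c dN_has_derivative[OF c] dN_has_derivative[OF c], of 1 v]
      lor_N_N by (simp add: s c)
  then show "lor (dN c p v) (N p) = 0" using lor_commute[of "N p" "dN c p v"] by simp
qed

lemma dN_tangent: "c \<in> A \<Longrightarrow> p \<in> fst c \<Longrightarrow> dN c p v \<in> tangent_M \<qq> (x p)"
  using lor_dN by (simp add: tangent_M_def)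

text \<open>Differentiating (N, dx(w)) = 0 along v replaces (dN(v), dx(w)) by minus the product of N
  with a second derivative of x, which is symmetric.\<close>

lemma dN_symmetric:
  assumes c: "c \<in> A" "p \<in> fst c"
  shows "lor (dN c p v) (dX c p w) = lor (dN c p w) (dX c p v)"
proof -
  let ?O = "snd c ` fst c" and ?X = "\<lambda>u. x (chart_inv c u)"
  let ?D2 = "\<lambda>w. frechet_derivative (\<lambda>u. frechet_derivative ?X (at u) w) (at (snd c p))"
  have X: "smooth_on ?O ?X" by (rule smooth_map_chart[OF smooth_x c(1)])
  have O: "snd c p \<in> ?O" using c by simp
  have "lor (N p) (?D2 w v) + lor (dN c p v) (dX c p w) = 0" for v w
    using lor_const_derivative[OF c dN_has_derivative[OF c]
        smooth_on_has_derivative[OF smooth_on_derivative[OF X, of w] O], of 0 v]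
      lor_N_dX[OF c(1)] by (simp add: chart_inv_snd[OF c(1)] c)
  from this[of v w] this[of w v] show ?thesis
    using symmetric_second_derivative[OF chart_homeomorphism(2)[OF c(1)] X O, of v w] by simp
qed

lemma fundII_chart:
  "c \<in> A \<Longrightarrow> p \<in> fst c \<Longrightarrow> U \<in> tangent A p \<Longrightarrow> V \<in> tangent A p \<Longrightarrow>
    fundII A D \<qq> x p U V = - lor (dN c p (U c)) (dX c p (V c))"
  by (simp add: fundII_def differential_x differential_N)

lemma dv_area_form:
  assumes UV: "U \<in> tangent A p" "V \<in> tangent A p"
  shows "dv (x p) \<qq> (N p) (differential A x p U) (differential A x p V) = area_form A x p U V"
proof -
  let ?c = "chart_at A p"
  note c = chart_at_in[of p]
  obtain a b where fr: "adapted_frame D \<qq> (x p) (dX ?c p) a b" by (rule obtain_frame[OF c])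
  interpret adapted_frame D \<qq> "x p" "dX ?c p" a b by (rule fr)
  show ?thesis
    unfolding area_form_chart[OF c fr UV] unit_normal_frame[OF c fr] differential_x[OF c UV(1)]
      differential_x[OF c UV(2)] dv_frame lor_n_n by simp
qed

text \<open>The conformal field is tangent to the space form, so it is a combination of dx(a), dx(b)
  and N; the first two coefficients are the chart components of the tangential part.\<close>

lemma tan_part_differential:
  assumes Y: "Y \<in> so41"
  shows "tan_part A \<qq> x Y p \<in> tangent A p"
    and "differential A x p (tan_part A \<qq> x Y p)
      = conf_field \<qq> Y (x p) - lor (conf_field \<qq> Y (x p)) (N p) *\<^sub>R N p"
proof -
  let ?c = "chart_at A p" and ?Y = "conf_field \<qq> Y (x p)"
  note c = chart_at_in[of p]
  obtain a b where fr: "adapted_frame D \<qq> (x p) (dX ?c p) a b" by (rule obtain_frame[OF c])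
  interpret adapted_frame D \<qq> "x p" "dX ?c p" a b by (rule fr)
  note t = coord_vec_tangent[OF c] and s = coord_vec_self[OF c]
  let ?v = "lor ?Y (dX ?c p a) *\<^sub>R a + lor ?Y (dX ?c p b) *\<^sub>R b"
  let ?U = "coord_vec A ?c p ?v"
  have YT: "?Y \<in> tangent_M \<qq> (x p)" by (rule conf_field_tangent[OF x_space_form Y])
  have n: "N p = n" by (rule unit_normal_frame[OF c fr])
  have dU: "differential A x p ?U = ?Y - lor ?Y n *\<^sub>R n"
  proof -
    have "differential A x p ?U = lor ?Y (dX ?c p a) *\<^sub>R dX ?c p a + lor ?Y (dX ?c p b) *\<^sub>R dX ?c p b"
      by (simp add: differential_x[OF c t] s linear_add[OF L] linear_scale[OF L])
    then show ?thesis using tangent_expand[OF YT] by (simp add: algebra_simps)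
  qed
  have "tan_part A \<qq> x Y p = ?U" unfolding tan_part_def
  proof (rule the_equality)
    have "lor (?Y - differential A x p ?U) (differential A x p V) = 0" if "V \<in> tangent A p" for V
      unfolding dU differential_x[OF c that] by (simp add: lor.scaleR_left lor_n_L)
    then show "?U \<in> tangent A p \<and> (\<forall>V\<in>tangent A p. lor (?Y - differential A x p ?U) (differential A x p V) = 0)"
      using t by blast
  next
    fix U assume U: "U \<in> tangent A p \<and> (\<forall>V\<in>tangent A p. lor (?Y - differential A x p U) (differential A x p V) = 0)"
    have "lor ?Y (dX ?c p v) = lor (dX ?c p (U ?c)) (dX ?c p v)" for v
      using U t[of v] by (auto simp: differential_x[OF c] s lor.diff_left)
    then have "ca (U ?c) = ca ?v" "cb (U ?c) = cb ?v"
      unfolding ca_cb_combination by (simp_all add: ca_def cb_def)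
    then have "U ?c = ?v" by (rule frame_eqI)
    then show "U = ?U" using U t tangent_eqI[OF c] s by metis
  qed
  then show "tan_part A \<qq> x Y p \<in> tangent A p"
    "differential A x p (tan_part A \<qq> x Y p) = ?Y - lor ?Y (N p) *\<^sub>R N p"
    using t dU n by simp_all
qed

lemma cplx_J_frame:
  assumes c: "c \<in> A" "p \<in> fst c" and fr: "adapted_frame D \<qq> (x p) (dX c p) a b"
    and U: "U \<in> tangent A p"
  shows "cplx_J A x p U = coord_vec A c p (- adapted_frame.cb (dX c p) b (U c) *\<^sub>R a
     + adapted_frame.ca (dX c p) a (U c) *\<^sub>R b)"
proof -
  interpret adapted_frame D \<qq> "x p" "dX c p" a b by (rule fr)
  note t = coord_vec_tangent[OF c] and s = coord_vec_self[OF c]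
  let ?s = "ca (U c)" and ?t = "cb (U c)"
  let ?J = "coord_vec A c p (- ?t *\<^sub>R a + ?s *\<^sub>R b)"
  show ?thesis unfolding cplx_J_def
  proof (rule the_equality)
    show "?J \<in> tangent A p \<and> fundI A x p U ?J = 0 \<and> fundI A x p ?J ?J = fundI A x p U U \<and> area_form A x p U ?J \<ge> 0"
      unfolding fundI_chart[OF c U t] fundI_chart[OF c t t] fundI_chart[OF c U U] s
        area_form_chart[OF c fr U t] lor_L ca_cb_combination
      using t by (simp add: algebra_simps)
  next
    fix V assume V: "V \<in> tangent A p \<and> fundI A x p U V = 0 \<and> fundI A x p V V = fundI A x p U U \<and> area_form A x p U V \<ge> 0"
    define e f where "e = ca (V c)" and "f = cb (V c)"
    have 1: "?s * e + ?t * f = 0" and 2: "e * e + f * f = ?s * ?s + ?t * ?t" and 3: "?s * f - ?t * e \<ge> 0"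
      using V by (auto simp: fundI_chart[OF c] U area_form_chart[OF c fr] lor_L e_def f_def)
    \<comment> \<open>Lagrange's identity: V is orthogonal to U and of the same length, so the area
      of the pair is plus or minus the squared length of U, and its sign is prescribed.\<close>
    have "(?s * f - ?t * e)\<^sup>2 = (?s * ?s + ?t * ?t) * (e * e + f * f) - (?s * e + ?t * f)\<^sup>2"
      by (simp add: power2_eq_square algebra_simps)
    also have "\<dots> = (?s * ?s + ?t * ?t)\<^sup>2" unfolding 1 2 by (simp add: power2_eq_square)
    finally have 4: "?s * f - ?t * e = ?s * ?s + ?t * ?t"
      using 3 by (simp add: power2_eq_iff_nonneg)
    \<comment> \<open>The squared distance between V and the rotated U, which therefore
      vanishes.\<close>
    have "(e + ?t)\<^sup>2 + (f - ?s)\<^sup>2 = (e * e + f * f) + (?s * ?s + ?t * ?t) - 2 * (?s * f - ?t * e)"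
      by (simp add: power2_eq_square algebra_simps)
    also have "\<dots> = 0" unfolding 4 2 by simp
    finally have "e = - ?t" "f = ?s" by (simp_all add: sum_power2_eq_zero_iff)
    then have "V c = - ?t *\<^sub>R a + ?s *\<^sub>R b"
      by (intro frame_eqI) (simp_all only: ca_cb_combination e_def f_def)
    then show "V = ?J" using V t tangent_eqI[OF c] s by metis
  qed
qed

end

section \<open>Constant mean curvature and the retraction form\<close>

locale cmc_surface = immersed_surface A D \<qq> x
  for A :: "('a::{t2_space,second_countable_topology}) chart set" and D \<qq> x +
  fixes H :: real
  assumes cmc: "mean_curvature A D \<qq> x p = H"
begin

text \<open>k, l, m are the entries of II in the frame, the off-diagonal ones agreeing by
  \<open>dN_symmetric\<close>. The description of the mean curvature has the value (k + m) / 2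
  because every orthonormal basis gives the same trace.\<close>

lemma dN_expand:
  assumes c: "c \<in> A" "p \<in> fst c" and fr: "adapted_frame D \<qq> (x p) (dX c p) a b"
  obtains k l m where "\<forall>v. dN c p v = - (adapted_frame.ca (dX c p) a v * k + adapted_frame.cb (dX c p) b v * l) *\<^sub>R dX c p a
       - (adapted_frame.ca (dX c p) a v * l + adapted_frame.cb (dX c p) b v * m) *\<^sub>R dX c p b"
    and "k + m = 2 * H"
proof -
  interpret adapted_frame D \<qq> "x p" "dX c p" a b by (rule fr)
  note t = coord_vec_tangent[OF c] and s = coord_vec_self[OF c]
  let ?L = "dX c p"
  let ?k = "- lor (dN c p a) (?L a)" and ?l = "- lor (dN c p a) (?L b)" and ?m = "- lor (dN c p b) (?L b)"
  have lin: "linear (dN c p)" by (rule has_derivative_linear[OF dN_has_derivative[OF c]])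
  have ab: "dN c p v = ca v *\<^sub>R dN c p a + cb v *\<^sub>R dN c p b" for v
    using arg_cong[OF frame_expand, of "dN c p" v] by (simp add: linear_add[OF lin] linear_scale[OF lin])
  have e: "dN c p v = lor (dN c p v) (?L a) *\<^sub>R ?L a + lor (dN c p v) (?L b) *\<^sub>R ?L b" for v
    using tangent_expand[OF dN_tangent[OF c], of v] lor_dN(3)[OF c, of v] unit_normal_frame[OF c fr] by simp
  have ea: "dN c p a = - ?k *\<^sub>R ?L a - ?l *\<^sub>R ?L b" using e[of a] by simp
  have eb: "dN c p b = - ?l *\<^sub>R ?L a - ?m *\<^sub>R ?L b" using e[of b] dN_symmetric[OF c, of b a] by simp
  have form: "dN c p v = - (ca v * ?k + cb v * ?l) *\<^sub>R ?L a - (ca v * ?l + cb v * ?m) *\<^sub>R ?L b" for v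
  proof -
    have "dN c p v = ca v *\<^sub>R (- ?k *\<^sub>R ?L a - ?l *\<^sub>R ?L b) + cb v *\<^sub>R (- ?l *\<^sub>R ?L a - ?m *\<^sub>R ?L b)"
      using ab[of v] unfolding ea[symmetric] eb[symmetric] .
    then show ?thesis by (simp add: algebra_simps)
  qed
  have "mean_curvature A D \<qq> x p = (?k + ?m) / 2" unfolding mean_curvature_def
  proof (rule the_equality)
    show "\<forall>E\<in>tangent A p. \<forall>F\<in>tangent A p. fundI A x p E E = 1 \<and> fundI A x p F F = 1 \<and> fundI A x p E F = 0 \<longrightarrow>
      (?k + ?m) / 2 = (fundII A D \<qq> x p E E + fundII A D \<qq> x p F F) / 2"
    proof (intro ballI impI)
      fix E F assume EF: "E \<in> tangent A p" "F \<in> tangent A p"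
        and o: "fundI A x p E E = 1 \<and> fundI A x p F F = 1 \<and> fundI A x p E F = 0"
      define e f g h where efgh: "e = ca (E c)" "f = cb (E c)" "g = ca (F c)" "h = cb (F c)"
      have 1: "e * e + f * f = 1" "g * g + h * h = 1" "e * g + f * h = 0"
        using o EF by (simp_all add: fundI_chart[OF c] lor_L efgh)
      have II: "fundII A D \<qq> x p V V = (ca (V c) * ca (V c)) * ?k + 2 * (ca (V c) * cb (V c)) * ?l + (cb (V c) * cb (V c)) * ?m"
        if "V \<in> tangent A p" for V
      proof -
        have "lor (dN c p (V c)) (?L (V c)) = ca (V c) * lor (dN c p (V c)) (?L a) + cb (V c) * lor (dN c p (V c)) (?L b)"
          using arg_cong[OF L_expand[of "V c"], of "lor (dN c p (V c))"]
          by (simp add: lor.add_right lor.scaleR_right)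
        moreover have "lor (dN c p (V c)) (?L a) = - (ca (V c) * ?k + cb (V c) * ?l)"
          "lor (dN c p (V c)) (?L b) = - (ca (V c) * ?l + cb (V c) * ?m)"
          using dN_symmetric[OF c, of b a]
          by (subst ab, simp add: lor.add_left lor.scaleR_left)+
        ultimately show ?thesis unfolding fundII_chart[OF c that that] by (simp add: algebra_simps)
      qed
      \<comment> \<open>The pair E, F may have either orientation; d is the determinant of its
        coordinate matrix and turns out to be 1 or -1.\<close>
      define d where "d = e * h - f * g"
      have gh: "g = - d * f" "h = d * e" unfolding d_def using 1 by algebra+
      have "d * d = 1"
      proof -
        have "g * g + h * h = d * d * (e * e + f * f)" unfolding gh by (simp add: algebra_simps)
        then show ?thesis using 1 by simp
      qed
      \<comment> \<open>Orthonormal rows force orthonormal columns, which is what the trace of II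
        requires.\<close>
      then have "e * e + g * g = 1" "f * f + h * h = 1" "e * f + g * h = 0"
        using 1(1) unfolding gh by algebra+
      then have "(e * e + g * g) * ?k + 2 * (e * f + g * h) * ?l + (f * f + h * h) * ?m = ?k + ?m" by simp
      moreover have "(e * e * K + 2 * (e * f) * M + f * f * P) + (g * g * K + 2 * (g * h) * M + h * h * P)
          = (e * e + g * g) * K + 2 * (e * f + g * h) * M + (f * f + h * h) * P" for K M P
        by algebra
      ultimately show "(?k + ?m) / 2 = (fundII A D \<qq> x p E E + fundII A D \<qq> x p F F) / 2"
        unfolding II[OF EF(1)] II[OF EF(2)] efgh[symmetric] by (simp only:)
    qed
  next
    fix r assume r: "\<forall>E\<in>tangent A p. \<forall>F\<in>tangent A p. fundI A x p E E = 1 \<and> fundI A x p F F = 1 \<and> fundI A x p E F = 0 \<longrightarrow>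
      r = (fundII A D \<qq> x p E E + fundII A D \<qq> x p F F) / 2"
    have "fundI A x p (coord_vec A c p a) (coord_vec A c p a) = 1 \<and> fundI A x p (coord_vec A c p b) (coord_vec A c p b) = 1
      \<and> fundI A x p (coord_vec A c p a) (coord_vec A c p b) = 0"
      using orthonormal by (simp add: fundI_chart[OF c t t] s)
    then have "r = (fundII A D \<qq> x p (coord_vec A c p a) (coord_vec A c p a)
        + fundII A D \<qq> x p (coord_vec A c p b) (coord_vec A c p b)) / 2"
      using r t by blast
    then show "r = (?k + ?m) / 2" by (simp add: fundII_chart[OF c t t] s)
  qed
  then have "?k + ?m = 2 * H" using cmc by simp
  then show thesis using that form by blast
qed

text \<open>For a symmetric form in the plane, rotating both arguments by J gives its trace times
  the metric minus the form itself; here the trace is 2 H.\<close>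

lemma Re_hopf:
  assumes UV: "U \<in> tangent A p" "V \<in> tangent A p"
  shows "2 * Re (hopf A D \<qq> x p U V) = fundII A D \<qq> x p U V - H * fundI A x p U V"
proof -
  let ?c = "chart_at A p"
  note c = chart_at_in[of p]
  obtain a b where fr: "adapted_frame D \<qq> (x p) (dX ?c p) a b" by (rule obtain_frame[OF c])
  interpret adapted_frame D \<qq> "x p" "dX ?c p" a b by (rule fr)
  note t = coord_vec_tangent[OF c] and s = coord_vec_self[OF c]
  obtain k l m where dN: "\<forall>v. dN ?c p v = - (ca v * k + cb v * l) *\<^sub>R dX ?c p a - (ca v * l + cb v * m) *\<^sub>R dX ?c p b"
    and H: "k + m = 2 * H" by (rule dN_expand[OF c fr])
  have II: "- lor (dN ?c p v) (dX ?c p w) = (ca v * k + cb v * l) * ca w + (ca v * l + cb v * m) * cb w" for v w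
    unfolding dN[rule_format] lor.diff_left lor.minus_left lor.scaleR_left
    using lor_commute[of "dX ?c p a"] lor_commute[of "dX ?c p b"]
    by (simp add: ca_def[symmetric] cb_def[symmetric] algebra_simps)
  have m: "m = 2 * H - k" using H by simp
  have rot: "ca (s *\<^sub>R b - t *\<^sub>R a) = - t" "cb (s *\<^sub>R b - t *\<^sub>R a) = s" for s t
    using ca_cb_combination[of "- t" s] by simp_all
  show ?thesis
    unfolding hopf_def Let_def cplx_J_frame[OF c fr UV(1)] cplx_J_frame[OF c fr UV(2)]
    by (simp add: fundII_chart[OF c] fundI_chart[OF c] UV t s II lor_L rot)
      (simp add: m algebra_simps)
qed

text \<open>Pairing a \<and> x with Y gives (a, Y x). For tangential a the normal part of the
  conformal field and its multiple of x drop out, so this is minus the product of a with the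
  tangential part.\<close>

lemma retraction_form_wedge:
  assumes U: "U \<in> tangent A p"
  shows "retraction_form A \<qq> x (hopf A D \<qq> x) p U
    = wedge (differential A N p U + H *\<^sub>R differential A x p U) (x p)"
proof -
  let ?w = "differential A N p U + H *\<^sub>R differential A x p U"
  let ?c = "chart_at A p"
  note c = chart_at_in[of p]
  have eq: "pairing_g (wedge ?w (x p)) Y = 2 * Re (hopf A D \<qq> x p (tan_part A \<qq> x Y p) U)" if Y: "Y \<in> so41" for Y
  proof -
    let ?T = "tan_part A \<qq> x Y p"
    note T = tan_part_differential[OF Y, of p]
    have "fundII A D \<qq> x p ?T U = - lor (differential A N p U) (differential A x p ?T)"
      unfolding fundII_chart[OF c T(1) U] differential_N[OF c U] differential_x[OF c T(1)]
      using dN_symmetric[OF c] by simp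
    also have "\<dots> = lor (differential A N p U) (Y *v x p)"
      unfolding T(2) differential_N[OF c U] using lor_dN[OF c, of "U ?c"]
      by (simp add: conf_field_def lor.diff_right lor.minus_right lor.scaleR_right)
    finally have 1: "fundII A D \<qq> x p ?T U = lor (differential A N p U) (Y *v x p)" .
    have "fundI A x p ?T U = lor (differential A x p U) (differential A x p ?T)"
      by (simp add: fundI_def lor_commute)
    also have "\<dots> = - lor (differential A x p U) (Y *v x p)"
      unfolding T(2) differential_x[OF c U]
      using lor_N_dX[OF c, of "U ?c"] tangent_M_commute[OF dX_tangent[OF c, of "U ?c"]]
      by (simp add: conf_field_def lor.diff_right lor.minus_right lor.scaleR_right lor_commute[of _ "N p"])
    finally have 2: "fundI A x p ?T U = - lor (differential A x p U) (Y *v x p)" .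
    show ?thesis
      unfolding pairing_g_wedge[OF Y] Re_hopf[OF T(1) U] 1 2
      by (simp add: lor.add_left lor.scaleR_left)
  qed
  show ?thesis unfolding retraction_form_def
  proof (rule the_equality)
    show "wedge ?w (x p) \<in> so41 \<and> (\<forall>Y\<in>so41. pairing_g (wedge ?w (x p)) Y
        = 2 * Re (hopf A D \<qq> x p (tan_part A \<qq> x Y p) U))"
      using eq wedge_so41 by blast
  next
    fix Z assume Z: "Z \<in> so41 \<and> (\<forall>Y\<in>so41. pairing_g Z Y = 2 * Re (hopf A D \<qq> x p (tan_part A \<qq> x Y p) U))"
    have "Z - wedge ?w (x p) = 0"
    proof (rule pairing_g_nondegenerate)
      show "Z - wedge ?w (x p) \<in> so41"
        using so41_diff Z wedge_so41 by blast
      show "pairing_g (Z - wedge ?w (x p)) Y = 0" if "Y \<in> so41" for Y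
      proof -
        have "pairing_g (Z - wedge ?w (x p)) Y = pairing_g Z Y - pairing_g (wedge ?w (x p)) Y"
          by (simp add: pairing_g_def trace_def matrix_matrix_mult_def left_diff_distrib sum_subtractf
              diff_divide_distrib)
        then show ?thesis using Z eq[OF that] that by simp
      qed
    qed
    then show "Z = wedge ?w (x p)" by simp
  qed
qed

text \<open>For an endomorphism B of a plane, B v \<and> w + v \<and> B w is the trace of B times v
  \<and> w. Here dN + H dx is dx composed with a trace-free B.\<close>

lemma wedge_structure_equation:
  assumes c: "c \<in> A" "p \<in> fst c"
  shows "wedge (dN c p w + H *\<^sub>R dX c p w) (dX c p v) = wedge (dN c p v + H *\<^sub>R dX c p v) (dX c p w)"
proof -
  obtain a b where fr: "adapted_frame D \<qq> (x p) (dX c p) a b" by (rule obtain_frame[OF c])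
  interpret adapted_frame D \<qq> "x p" "dX c p" a b by (rule fr)
  obtain k l m where dN: "\<forall>v. dN c p v = - (ca v * k + cb v * l) *\<^sub>R dX c p a - (ca v * l + cb v * m) *\<^sub>R dX c p b"
    and H: "k + m = 2 * H" by (rule dN_expand[OF c fr])
  let ?a = "dX c p a" and ?b = "dX c p b"
  have W: "wedge (s *\<^sub>R ?a + t *\<^sub>R ?b) (s' *\<^sub>R ?a + t' *\<^sub>R ?b) = (s * t' - t * s') *\<^sub>R wedge ?a ?b" for s t s' t'
    using wedge_swap[of ?b ?a]
    by (simp add: wedge.add_left wedge.add_right wedge.scaleR_left wedge.scaleR_right wedge_self algebra_simps)
  have Z: "dN c p v + H *\<^sub>R dX c p v = (H * ca v - (ca v * k + cb v * l)) *\<^sub>R ?a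
      + (H * cb v - (ca v * l + cb v * m)) *\<^sub>R ?b" for v
    unfolding dN[rule_format] L_expand[of v] by (simp add: algebra_simps)
  have m: "m = 2 * H - k" using H by simp
  show ?thesis
    unfolding Z unfolding L_expand[of v] L_expand[of w] W
    by (rule arg_cong[where f = "\<lambda>r. r *\<^sub>R wedge ?a ?b"]) (simp add: m algebra_simps)
qed

end


section \<open>The retraction form and the moment class\<close>

lemma E_plane_some:
  assumes "\<qq> \<noteq> 0" shows "lor (SOME v. v \<in> E_plane \<qq>) \<qq> = -1"
proof -
  obtain u where u: "lor \<qq> u \<noteq> 0" using lor_eq_0 assms by blast
  then have "(- 1 / lor \<qq> u) *\<^sub>R u \<in> E_plane \<qq>"
    by (simp add: E_plane_def lor.minus_left lor.scaleR_left lor_commute[of u])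
  then have "(SOME v. v \<in> E_plane \<qq>) \<in> E_plane \<qq>" by (rule someI)
  then show ?thesis by (simp add: E_plane_def)
qed

context volume_form
begin

lemma det_wedge_base_change:
  assumes "Y \<in> killing \<qq>" "\<qq> \<noteq> 0" "lor v \<qq> = lor w \<qq>" "lor a \<qq> = 0" "lor b \<qq> = 0"
  shows "det_wedge D v (wedge a b) Y = det_wedge D w (wedge a b) Y"
proof -
  have "det_wedge D (v - w) (wedge a b) Y = 0"
    by (rule det_wedge_killing_orthogonal[OF assms(1,2) _ assms(4,5)]) (simp add: lor.diff_left assms(3))
  then show ?thesis by (simp add: det_wedge_diff(1))
qed

lemma bounded_linear_det_wedge: "bounded_linear (\<lambda>Z. det_wedge D v Z Y)"
  using det_wedge_linear by (simp add: linear_conv_bounded_linear)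

text \<open>The formula is linear in y on all of the ambient space, so it is its own extension and
  its derivative is again the formula; antisymmetrizing then cancels the 1/2.\<close>

lemma flux_primitive_explicit:
  assumes Y: "Y \<in> killing \<qq>" and q: "\<qq> \<noteq> 0" and o: "lor v0 \<qq> = -1"
  shows "flux_primitive D \<qq> Y (\<lambda>y v. det_wedge D v0 (wedge y v) Y / 2)"
  unfolding flux_primitive_def
proof
  let ?\<alpha> = "\<lambda>y v. det_wedge D v0 (wedge y v) Y / 2"
  fix y assume y: "y \<in> space_form \<qq>"
  have bl: "bounded_linear (\<lambda>y. ?\<alpha> y v)" for v
    using bounded_linear_compose[OF bounded_linear_divide[of 2]
        bounded_linear_compose[OF bounded_linear_det_wedge wedge.bounded_linear_left]] by simp
  have lin: "linear (?\<alpha> y)" for y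
    using bounded_linear.linear[OF bounded_linear_compose[OF bounded_linear_divide[of 2]
        bounded_linear_compose[OF bounded_linear_det_wedge wedge.bounded_linear_right]]] by simp
  have ext: "local_extension \<qq> ?\<alpha> UNIV ?\<alpha>"
    unfolding local_extension_def
    using lin smooth_on_linear[OF open_UNIV bl smooth_on_ident] by simp
  have der: "frechet_derivative (\<lambda>z. ?\<alpha> z w) (at y) v = ?\<alpha> v w" for v w
    using fun_cong[OF frechet_derivative_at[OF bounded_linear_imp_has_derivative[OF bl]]] by metis
  have "?\<alpha> v w - ?\<alpha> w v = vol_M D \<qq> y (conf_field \<qq> Y y) v w"
    if v: "v \<in> tangent_M \<qq> y" and w: "w \<in> tangent_M \<qq> y" for v w
  proof -
    let ?K = "conf_field \<qq> Y y"
    have "?\<alpha> v w - ?\<alpha> w v = det_wedge D v0 (wedge v w) Y"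
      using det_wedge_swap(2)[of v0 w v Y] by simp
    also have "\<dots> = det_wedge D y (wedge v w) Y"
      using det_wedge_base_change[OF Y q] space_formD(2)[OF y] o tangent_M_commute[OF v] tangent_M_commute[OF w]
      by simp
    also have "\<dots> = dv y v w \<qq> ?K" by (rule det_wedge_killing_tangent[OF Y y v w])
    \<comment> \<open>Exchanging the pair v, w with the pair \<qq>, K is an even
      permutation.\<close>
    also have "\<dots> = dv y \<qq> ?K v w"
      using dv_swap(3)[of y v \<qq> w ?K] dv_swap(2)[of y \<qq> v w ?K] dv_swap(4)[of y \<qq> v ?K w]
        dv_swap(3)[of y \<qq> ?K v w] by simp
    finally show ?thesis by (simp add: vol_M_def)
  qed
  then show "\<exists>B \<beta>. y \<in> B \<and> local_extension \<qq> ?\<alpha> B \<beta> \<and>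
     (\<forall>v\<in>tangent_M \<qq> y. \<forall>w\<in>tangent_M \<qq> y.
        frechet_derivative (\<lambda>z. \<beta> z w) (at y) v - frechet_derivative (\<lambda>z. \<beta> z v) (at y) w
          = vol_M D \<qq> y (conf_field \<qq> Y y) v w)"
    by (intro exI[of _ UNIV] exI[of _ ?\<alpha>] conjI ext ballI) (simp_all only: UNIV_I der)
qed

end

lemma flux_primitive_diff_closed:
  assumes "flux_primitive D \<qq> Y \<alpha>" "flux_primitive D \<qq> Y \<alpha>'"
  shows "closed_on_space_form \<qq> (\<lambda>y v. \<alpha> y v - \<alpha>' y v)"
  unfolding closed_on_space_form_def
proof
  fix y assume y: "y \<in> space_form \<qq>"
  let ?d = "\<lambda>\<beta> v w. frechet_derivative (\<lambda>z. \<beta> z w) (at y) v"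
  obtain B \<beta> where B: "y \<in> B" "local_extension \<qq> \<alpha> B \<beta>" and d: "\<forall>v\<in>tangent_M \<qq> y. \<forall>w\<in>tangent_M \<qq> y.
      ?d \<beta> v w - ?d \<beta> w v = vol_M D \<qq> y (conf_field \<qq> Y y) v w"
    using bspec[OF assms(1)[unfolded flux_primitive_def] y] by blast
  obtain B' \<beta>' where B': "y \<in> B'" "local_extension \<qq> \<alpha>' B' \<beta>'" and d': "\<forall>v\<in>tangent_M \<qq> y. \<forall>w\<in>tangent_M \<qq> y.
      ?d \<beta>' v w - ?d \<beta>' w v = vol_M D \<qq> y (conf_field \<qq> Y y) v w"
    using bspec[OF assms(2)[unfolded flux_primitive_def] y] by blast
  let ?\<beta> = "\<lambda>y v. \<beta> y v - \<beta>' y v"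
  note e = B(2)[unfolded local_extension_def] B'(2)[unfolded local_extension_def]
  have oB: "open (B \<inter> B')" using e by blast
  have sm: "smooth_on (B \<inter> B') (\<lambda>y. \<beta> y v)" "smooth_on (B \<inter> B') (\<lambda>y. \<beta>' y v)" for v
    using e smooth_on_subset[of B _ "B \<inter> B'"] smooth_on_subset[of B' _ "B \<inter> B'"] by blast+
  have ext: "local_extension \<qq> (\<lambda>y v. \<alpha> y v - \<alpha>' y v) (B \<inter> B') ?\<beta>"
    unfolding local_extension_def
    using e oB smooth_on_diff[OF oB sm] by (auto intro: linear_compose_sub)
  have \<beta>: "?d ?\<beta> v w = ?d \<beta> v w - ?d \<beta>' v w" for v w
  proof -
    have "y \<in> B \<inter> B'" using B B' by blast
    from has_derivative_diff[OF smooth_on_has_derivative[OF sm(1) this] smooth_on_has_derivative[OF sm(2) this], of w w]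
    show ?thesis by (rule fun_cong[OF frechet_derivative_at, symmetric])
  qed
  have "?d ?\<beta> v w = ?d ?\<beta> w v" if "v \<in> tangent_M \<qq> y" "w \<in> tangent_M \<qq> y" for v w
    using bspec[OF bspec[OF d that(1)] that(2)] bspec[OF bspec[OF d' that(1)] that(2)]
    unfolding \<beta>[of v w] \<beta>[of w v] by linarith
  then show "\<exists>B \<beta>. y \<in> B \<and> local_extension \<qq> (\<lambda>y v. \<alpha> y v - \<alpha>' y v) B \<beta> \<and>
     (\<forall>v\<in>tangent_M \<qq> y. \<forall>w\<in>tangent_M \<qq> y. ?d \<beta> v w = ?d \<beta> w v)"
    using B(1) B'(1) ext by blast
qed

section \<open>Exactness on the surface of closed forms pulled back from the space form\<close>

context immersed_surface
begin

text \<open>Composing one potential on the space form with x works for every topology of the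
  surface; smoothness of the result is inherited from its derivative, the pulled-back form.\<close>

lemma closed_on_space_form_exact:
  assumes cl: "closed_on_space_form \<qq> \<gamma>"
  shows "\<exists>F. smooth_map A F \<and> (\<forall>p. \<forall>U\<in>tangent A p. differential A F p U = \<gamma> (x p) (differential A x p U))"
proof -
  obtain G where G: "space_form_potential \<qq> \<gamma> G" using space_form_potential_exists[OF cl] by blast
  let ?F = "\<lambda>p. G (x p)"
  have M: "(\<lambda>u. x (chart_inv c u)) ` S \<subseteq> space_form \<qq>" for c S using x_space_form by blast
  have X: "smooth_on (snd c ` fst c) (\<lambda>u. x (chart_inv c u))" if "c \<in> A" for c
    by (rule smooth_map_chart[OF smooth_x that])
  have der: "((\<lambda>u. G (x (chart_inv c u))) has_derivative
      (\<lambda>v. \<gamma> (x (chart_inv c u)) (frechet_derivative (\<lambda>u. x (chart_inv c u)) (at u) v))) (at u)"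
    if c: "c \<in> A" and u: "u \<in> snd c ` fst c" for c u
    using G[unfolded space_form_potential_def, rule_format,
        OF smooth_on_has_derivative[OF X[OF c] u] chart_homeomorphism(2)[OF c] u M] .
  have "smooth_map A ?F"
    unfolding smooth_map_def o_def
    by (intro ballI smooth_onI[OF chart_homeomorphism(2) der]
        pullback_smooth[OF cl chart_homeomorphism(2) X M])
  moreover have "differential A ?F p U = \<gamma> (x p) (differential A x p U)" if U: "U \<in> tangent A p" for p U
  proof -
    let ?c = "chart_at A p"
    note c = chart_at_in[of p]
    have "((\<lambda>u. G (x (chart_inv ?c u))) has_derivative (\<lambda>v. \<gamma> (x p) (dX ?c p v))) (at (snd ?c p))"
      using der[OF c(1), of "snd ?c p"] c by (simp add: chart_inv_snd)
    from differential_eqI[OF this c U] show ?thesis by (simp add: differential_x[OF c U])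
  qed
  ultimately show ?thesis by blast
qed

lemma flux_classes_equal:
  assumes "flux_primitive D \<qq> Y \<alpha>" "flux_primitive D \<qq> Y \<alpha>'"
  shows "dR_class A (\<lambda>p U. \<tau> p U - 2 * H * \<alpha> (x p) (differential A x p U))
    = dR_class A (\<lambda>p U. \<tau> p U - 2 * H * \<alpha>' (x p) (differential A x p U))"
proof -
  obtain F where F: "smooth_map A F" "\<And>p U. U \<in> tangent A p \<Longrightarrow>
      differential A F p U = \<alpha> (x p) (differential A x p U) - \<alpha>' (x p) (differential A x p U)"
    using closed_on_space_form_exact[OF flux_primitive_diff_closed[OF assms]] by blast
  have bl: "bounded_linear (\<lambda>r. - (2 * H) * r)" by (rule bounded_linear_mult_right)
  show ?thesis
    by (rule dR_class_eqI[OF smooth_map_linear[OF F(1) bl]])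
      (simp only: differential_linear[OF F(1) bl] F(2), simp add: algebra_simps)
qed

end

section \<open>The Killing-valued representative and its image under S\<close>

context cmc_surface
begin

text \<open>v is kept free: closedness and the class hold for every v, and (v, \<qq>) = -1 is
  imposed only where Killing values are needed.\<close>

definition \<omega> :: "real^5 \<Rightarrow> ('a, real^5^5) form1" where
  "\<omega> v p U = wedge (differential A N p U + H *\<^sub>R differential A x p U) (x p - v)"

lemma smooth_NHx: "smooth_map A (\<lambda>p. N p + H *\<^sub>R x p)"
  by (intro smooth_map_add smooth_N smooth_map_linear[OF smooth_x bounded_linear_scaleR_right])

lemma differential_NHx:
  "U \<in> tangent A p \<Longrightarrow> differential A (\<lambda>p. N p + H *\<^sub>R x p) p U = differential A N p U + H *\<^sub>R differential A x p U"
  by (simp add: differential_add[OF smooth_N smooth_map_linear[OF smooth_x bounded_linear_scaleR_right]]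
      differential_linear[OF smooth_x bounded_linear_scaleR_right])

lemma lor_differential_q:
  assumes "U \<in> tangent A p"
  shows "lor (differential A N p U) \<qq> = 0" "lor (differential A x p U) \<qq> = 0"
  using lor_dN(2)[OF chart_at_in] tangent_M_commute[OF dx_tangent[OF assms]]
  by (simp_all add: differential_N[OF chart_at_in assms])

lemma retraction_form_class:
  "dR_class A (retraction_form A \<qq> x (hopf A D \<qq> x)) = dR_class A (\<omega> v)"
proof (rule dR_class_eqI)
  show "smooth_map A (\<lambda>p. wedge (N p + H *\<^sub>R x p) v)"
    by (rule smooth_map_linear[OF smooth_NHx wedge.bounded_linear_left])
  show "retraction_form A \<qq> x (hopf A D \<qq> x) p U
      = \<omega> v p U + differential A (\<lambda>p. wedge (N p + H *\<^sub>R x p) v) p U" if "U \<in> tangent A p" for p U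
    by (simp add: retraction_form_wedge[OF that] \<omega>_def wedge.diff_right
        differential_linear[OF smooth_NHx wedge.bounded_linear_left that] differential_NHx[OF that])
qed

lemma \<omega>_killing:
  assumes "lor v \<qq> = -1" "U \<in> tangent A p" shows "\<omega> v p U \<in> killing \<qq>"
  using assms(1) lor_differential_q[OF assms(2)] space_formD(2)[OF x_space_form]
  by (simp add: \<omega>_def killing_def wedge_so41 wedge_mult lor.add_left lor.scaleR_left lor.diff_left)

lemma \<omega>_closed: "closed_form A (\<omega> v)"
proof -
  have *: "(\<forall>u\<in>snd c ` fst c. linear (\<lambda>w. local_coeff A c (\<omega> v) w u)) \<and>
      (\<forall>w. smooth_on (snd c ` fst c) (local_coeff A c (\<omega> v) w)) \<and>
      (\<forall>u\<in>snd c ` fst c. \<forall>w w'. frechet_derivative (local_coeff A c (\<omega> v) w') (at u) w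
         = frechet_derivative (local_coeff A c (\<omega> v) w) (at u) w')" if c: "c \<in> A" for c
  proof -
    let ?O = "snd c ` fst c"
    let ?X = "\<lambda>u. x (chart_inv c u)" and ?Z = "\<lambda>u. N (chart_inv c u) + H *\<^sub>R x (chart_inv c u)"
    let ?f = "\<lambda>w u. wedge (frechet_derivative ?Z (at u) w) (?X u - v)"
    note O = chart_homeomorphism(2)[OF c]
    have Z: "smooth_on ?O ?Z" by (rule smooth_map_chart[OF smooth_NHx c])
    have X: "smooth_on ?O ?X" by (rule smooth_map_chart[OF smooth_x c])
    have p: "chart_inv c u \<in> fst c" "snd c (chart_inv c u) = u" if "u \<in> ?O" for u
      using chart_inv_in[OF c that] snd_chart_inv[OF c that] .
    have lc: "local_coeff A c (\<omega> v) w u = ?f w u" if "u \<in> ?O" for w u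
    proof -
      note t = coord_vec_tangent[OF c p(1)[OF that], of w]
      show ?thesis
        using differential_chart[OF smooth_NHx c p(1)[OF that] t]
        by (simp add: local_coeff_def \<omega>_def differential_NHx[OF t, symmetric] p(2)[OF that]
            coord_vec_self[OF c p(1)[OF that]])
    qed
    have sm: "smooth_on ?O (?f w)" for w
      by (intro smooth_on_bilinear[OF O bounded_bilinear_wedge] smooth_on_derivative Z
          smooth_on_diff O X smooth_on_const)
    have lin: "linear (\<lambda>w. ?f w u)" if "u \<in> ?O" for u
      using linear_compose[OF has_derivative_linear[OF smooth_on_has_derivative[OF Z that]]
          bounded_linear.linear[OF wedge.bounded_linear_left]] by (simp add: o_def)
    have dZ: "frechet_derivative ?Z (at (snd c p)) w = dN c p w + H *\<^sub>R dX c p w" if "p \<in> fst c" for p w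
      using has_derivative_add[OF dN_has_derivative[OF c that]
          bounded_linear.has_derivative[OF bounded_linear_scaleR_right dX_has_derivative[OF c that]]]
      by (rule fun_cong[OF frechet_derivative_at, symmetric])
    \<comment> \<open>In the product rule the first term is symmetric in w, w' as a second
      derivative, the second by \<open>wedge_structure_equation\<close>.\<close>
    have der: "frechet_derivative (local_coeff A c (\<omega> v) w') (at u) w
      = wedge (frechet_derivative (\<lambda>u. frechet_derivative ?Z (at u) w') (at u) w) (?X u - v)
        + wedge (frechet_derivative ?Z (at u) w') (frechet_derivative ?X (at u) w)" if u: "u \<in> ?O" for u w w'
    proof -
      have "(?X has_derivative frechet_derivative ?X (at u)) (at u)" by (rule smooth_on_has_derivative[OF X u])
      then have "((\<lambda>u. ?X u - v) has_derivative frechet_derivative ?X (at u)) (at u)"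
        by (auto intro!: derivative_eq_intros)
      from bounded_bilinear.FDERIV[OF bounded_bilinear_wedge
          smooth_on_has_derivative[OF smooth_on_derivative[OF Z] u] this]
      have "(?f w' has_derivative (\<lambda>w. wedge (frechet_derivative ?Z (at u) w') (frechet_derivative ?X (at u) w)
        + wedge (frechet_derivative (\<lambda>u. frechet_derivative ?Z (at u) w') (at u) w) (?X u - v))) (at u)" .
      then have "(local_coeff A c (\<omega> v) w' has_derivative (\<lambda>w. wedge (frechet_derivative ?Z (at u) w') (frechet_derivative ?X (at u) w)
        + wedge (frechet_derivative (\<lambda>u. frechet_derivative ?Z (at u) w') (at u) w) (?X u - v))) (at u)"
        by (rule has_derivative_transform_within_open[OF _ O u]) (simp add: lc)
      from fun_cong[OF frechet_derivative_at[OF this, symmetric], of w] show ?thesis by (simp add: add.commute)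
    qed
    have "frechet_derivative (local_coeff A c (\<omega> v) w') (at u) w
         = frechet_derivative (local_coeff A c (\<omega> v) w) (at u) w'" if u: "u \<in> ?O" for u w w'
    proof -
      have "wedge (frechet_derivative ?Z (at u) w') (frechet_derivative ?X (at u) w)
        = wedge (frechet_derivative ?Z (at u) w) (frechet_derivative ?X (at u) w')"
        using wedge_structure_equation[OF c p(1)[OF u], of w' w] dZ[OF p(1)[OF u]] by (simp add: p(2)[OF u])
      then show ?thesis
        unfolding der[OF u] using symmetric_second_derivative[OF O Z u, of w' w] by simp
    qed
    moreover have "linear (\<lambda>w. local_coeff A c (\<omega> v) w u)" if "u \<in> ?O" for u
      using lin[OF that] by (simp add: lc[OF that])
    moreover have "smooth_on ?O (local_coeff A c (\<omega> v) w)" for w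
      by (rule smooth_on_cong[OF O _ sm]) (simp add: lc)
    ultimately show ?thesis by blast
  qed
  then show ?thesis unfolding closed_form_def one_form_def by simp
qed

lemma det_wedge_\<omega>:
  assumes Y: "Y \<in> killing \<qq>" and q: "\<qq> \<noteq> 0" and v: "lor v \<qq> = -1" and U: "U \<in> tangent A p"
  shows "det_wedge D v (\<omega> v p U) Y
    = area_form A x p (tan_part A \<qq> x Y p) U - 2 * H * (det_wedge D v (wedge (x p) (differential A x p U)) Y / 2)
      + differential A (\<lambda>p. det_wedge D v (wedge (N p) (x p)) Y) p U"
proof -
  let ?dN = "differential A N p U" and ?dx = "differential A x p U" and ?K = "conf_field \<qq> Y (x p)"
  let ?P = "\<lambda>v a b. det_wedge D v (wedge a b) Y"
  have Y': "Y \<in> so41" using Y by (simp add: killing_def)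
  note T = tan_part_differential[OF Y', of p]
  have vv: "?P v a v = 0" for a
    using det_wedge_swap(1)[of v v a Y] det_wedge_swap(2)[of v a v Y] by simp
  have "det_wedge D v (\<omega> v p U) Y = ?P v ?dN (x p) + H * ?P v ?dx (x p)"
    unfolding \<omega>_def by (simp add: det_wedge_add det_wedge_diff det_wedge_scaleR vv)
  moreover have "differential A (\<lambda>p. ?P v (N p) (x p)) p U = ?P v (N p) ?dx + ?P v ?dN (x p)"
    using differential_linear[OF smooth_map_bilinear[OF smooth_N smooth_x bounded_bilinear_wedge]
        bounded_linear_det_wedge U, of v Y]
    by (simp add: differential_bilinear[OF smooth_N smooth_x bounded_bilinear_wedge U]
        linear_add[OF det_wedge_linear])
  moreover have "?P v ?dx (x p) = - ?P v (x p) ?dx" by (rule det_wedge_swap(2))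
  \<comment> \<open>N and dx are orthogonal to \<qq>, so v may be replaced by x; the contraction
    then leaves the volume of N, dx and the Killing field.\<close>
  moreover have "?P v (N p) ?dx = - area_form A x p (tan_part A \<qq> x Y p) U"
  proof -
    have "?P v (N p) ?dx = ?P (x p) (N p) ?dx"
      using det_wedge_base_change[OF Y q] v space_formD(2)[OF x_space_form, of p]
        tangent_M_commute[OF N_tangent, of p] lor_differential_q[OF U] by simp
    also have "\<dots> = dv (x p) (N p) ?dx \<qq> ?K"
      by (rule det_wedge_killing_tangent[OF Y x_space_form N_tangent dx_tangent[OF U]])
    also have "\<dots> = - dv (x p) \<qq> (N p) ?K ?dx"
      using dv_swap(3)[of "x p" "N p" \<qq> ?dx ?K] dv_swap(2)[of "x p" \<qq> "N p" ?dx ?K]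
        dv_swap(4)[of "x p" \<qq> "N p" ?K ?dx] by simp
    \<comment> \<open>The field and its tangential part differ by a multiple of N, which already
      fills another slot.\<close>
    also have "dv (x p) \<qq> (N p) ?K ?dx = dv (x p) \<qq> (N p) (differential A x p (tan_part A \<qq> x Y p)) ?dx"
      unfolding T(2) by (simp add: dv_diff dv_scaleR dv_eq_0)
    finally show ?thesis using dv_area_form[OF T(1) U] by simp
  qed
  ultimately show ?thesis by simp
qed

lemma moment_class_retraction_form:
  assumes q: "\<qq> \<noteq> 0"
  shows "dR_class A (retraction_form A \<qq> x (hopf A D \<qq> x)) \<in> H1 A (killing \<qq>) \<and>
         (\<forall>Y\<in>killing \<qq>.
           apply_coeff A (killing \<qq>) (\<lambda>Z. S_form D \<qq> Z Y)
             (dR_class A (retraction_form A \<qq> x (hopf A D \<qq> x)))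
           = moment_class A D \<qq> x H Y)"
proof (intro conjI ballI)
  \<comment> \<open>The same choice as in \<open>S_form\<close>, so that S is literally
    \<open>det_wedge D v\<close>.\<close>
  define v where "v = (SOME v. v \<in> E_plane \<qq>)"
  have v: "lor v \<qq> = -1" unfolding v_def by (rule E_plane_some[OF q])
  have valued: "valued_in A (killing \<qq>) (\<omega> v)" using \<omega>_killing[OF v] by (simp add: valued_in_def)
  then show "dR_class A (retraction_form A \<qq> x (hopf A D \<qq> x)) \<in> H1 A (killing \<qq>)"
    unfolding retraction_form_class[of v] H1_def using \<omega>_closed by blast
  fix Y assume Y: "Y \<in> killing \<qq>"
  let ?\<alpha> = "\<lambda>y w. det_wedge D v (wedge y w) Y / 2"
  let ?\<theta> = "\<lambda>\<alpha> p U. area_form A x p (tan_part A \<qq> x Y p) U - 2 * H * \<alpha> (x p) (differential A x p U)"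
  have prim: "flux_primitive D \<qq> Y ?\<alpha>" by (rule flux_primitive_explicit[OF Y q v])
  \<comment> \<open>All primitives give one class, and the explicit primitive shows that the union
    is not empty.\<close>
  have moment: "moment_class A D \<qq> x H Y = dR_class A (?\<theta> ?\<alpha>)"
  proof -
    have "dR_class A (?\<theta> \<alpha>) = dR_class A (?\<theta> ?\<alpha>)" if "flux_primitive D \<qq> Y \<alpha>" for \<alpha>
      by (rule flux_classes_equal[OF that prim])
    then show ?thesis unfolding moment_class_def using prim by blast
  qed
  have S: "(\<lambda>Z. S_form D \<qq> Z Y) = (\<lambda>Z. det_wedge D v Z Y)"
    by (simp add: S_form_def v_def fun_eq_iff)
  \<comment> \<open>The functional is linear on all matrices, so it applies directly to the
    correction g, whose values may leave \<open>killing \<qq>\<close>.\<close>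
  have S_class: "dR_class A (\<lambda>p U. det_wedge D v (\<sigma> p U) Y) = dR_class A (?\<theta> ?\<alpha>)"
    if \<sigma>: "\<sigma> \<in> dR_class A (\<omega> v)" for \<sigma>
  proof -
    obtain g where g: "smooth_map A g" "\<And>p U. U \<in> tangent A p \<Longrightarrow> \<sigma> p U = \<omega> v p U + differential A g p U"
      using \<sigma> unfolding dR_class_def by blast
    let ?h = "\<lambda>p. det_wedge D v (wedge (N p) (x p)) Y" and ?k = "\<lambda>p. det_wedge D v (g p) Y"
    have h: "smooth_map A ?h"
      by (rule smooth_map_linear[OF smooth_map_bilinear[OF smooth_N smooth_x bounded_bilinear_wedge] bounded_linear_det_wedge])
    have k: "smooth_map A ?k" by (rule smooth_map_linear[OF g(1) bounded_linear_det_wedge])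
    show ?thesis
    proof (rule dR_class_eqI[OF smooth_map_add[OF h k]])
      fix p U assume U: "U \<in> tangent A p"
      show "det_wedge D v (\<sigma> p U) Y = ?\<theta> ?\<alpha> p U + differential A (\<lambda>p. ?h p + ?k p) p U"
        unfolding g(2)[OF U] differential_add[OF h k U] linear_add[OF det_wedge_linear]
          det_wedge_\<omega>[OF Y q v U] differential_linear[OF g(1) bounded_linear_det_wedge U] by simp
    qed
  qed
  show "apply_coeff A (killing \<qq>) (\<lambda>Z. S_form D \<qq> Z Y)
      (dR_class A (retraction_form A \<qq> x (hopf A D \<qq> x))) = moment_class A D \<qq> x H Y"
    \<comment> \<open>\<open>\<omega> v\<close> is itself a Killing-valued member of the class, so
      this union is not empty either.\<close>
    unfolding retraction_form_class[of v] apply_coeff_def S moment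
    using S_class valued dR_class_self[of "\<omega> v"] by blast
qed

end

theorem theorem4p4:
  fixes A :: "('a::{t2_space,second_countable_topology}) chart set"
    and x :: "'a \<Rightarrow> real^5" and \<qq> :: "real^5" and H :: real
    and D :: "real^5^5 \<Rightarrow> real"
  assumes "oriented_surface A"
    and "is_volume_form D"
    and "\<qq> \<noteq> 0"
    and "immersion A \<qq> x"
    and "\<And>p. mean_curvature A D \<qq> x p = H"
  shows "dR_class A (retraction_form A \<qq> x (hopf A D \<qq> x)) \<in> H1 A (killing \<qq>) \<and>
         (\<forall>Y\<in>killing \<qq>.
           apply_coeff A (killing \<qq>) (\<lambda>Z. S_form D \<qq> Z Y)
             (dR_class A (retraction_form A \<qq> x (hopf A D \<qq> x)))
           = moment_class A D \<qq> x H Y)"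
proof -
  interpret cmc_surface A D \<qq> x H
    by unfold_locales (use assms in auto)
  show ?thesis using moment_class_retraction_form[OF assms(3)] .
qed

end
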